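(* Let $A$ be a separable, simple, unital, non-elementary, tracially LTH-algebra with locally flat dimension growth. Then the tracial ultrapower $A^{\mathcal U}$ has real rank zero.
   Context: A $C^\ast$-algebra is non-elementary if it is not isomorphic to the algebra of compact operators on some Hilbert space. A unital $C^\ast$-algebra has real rank zero if the invertible self-adjoint elements are dense in its self-adjoint part. For a $C^\ast$-algebra $A$, $A_1$ is its set of contractions and $T(A)$ the set of its tracial states (traces). For $\tau\in T(A)$, $\|a\|_{2,\tau}=\tau(a^\ast a)^{1/2}$ and $\|a\|_{2,T(A)}=\sup_{\tau\in T(A)}\|a\|_{2,\tau}$. $\dim(Z)$ is the covering dimension of $Z$. Tracial ultrapower: $\mathcal{U}$ is a fixed non-principal ultrafilter on $\mathbb{N}$, and $A^{\mathcal U}=\ell^\infty(A)/J_{T(A)}$ with $J_{T(A)}=\{(a_n)_n\in\ell^\infty(A):\lim_{n\to\mathcal U}\|a_n\|_{2,T(A)}=0\}$. Tracially LTH-algebras: a $C^\ast$-algebra $A$ with $T(A)\ne\emptyset$ is a tracially locally trivially homogeneous $C^\ast$-algebra (tracially LTH-algebra) if for every finite $F\subset A_1$ and every $\varepsilon>0$ there is a $C^\ast$-subalgebra $C\subseteq A$ with $C\cong\bigoplus_{i<m}M_{n_i}(C_0(Z_i))$, where $m,n_0,\dots,n_{m-1}\in\mathbb N$ and each $Z_i$ is a locally compact metric space, such that for every $a\in F$ there is $c\in C_1$ with $\|a-c\|_{2,T(A)}<\varepsilon$. A tracially LTH-algebra $A$ has locally flat dimension growth if for every finite $F\subset A_1$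 and $\varepsilon>0$ there is a constant $N>0$ such that, for every $k\in\mathbb N$, the approximating $C^\ast$-subalgebra $C\cong\bigoplus_{i<m}M_{n_i}(C_0(Z_i))$ (for $F$ and $\varepsilon$) can be chosen so that $n_i\ge k$ for all $i<m$ and $\max_{i<m}\{\dim(Z_i)/n_i\}<N$. *)

theory Defs
  imports
    "HOL-Algebra.QuotRing"
    "HOL-Library.FuncSet"
    "HOL-Library.Extended_Real"
    "HOL-Analysis.Abstract_Metric_Spaces"
    "Jordan_Normal_Form.VS_Connect"
    "Jordan_Normal_Form.Schur_Decomposition"
begin

section \<open>C*-algebras\<close>

text \<open>
  C*-algebras are carrier-based, extending the modules of HOL-Algebra (here over the complex field).
  The record field \<open>one\<close> is meaningful only for unital algebras: no axiom
  mentions it, and it need not belong to the carrier of a non-unital algebra.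
\<close>

record 'a cstar_struct = "(complex, 'a) module" +
  adj :: "'a \<Rightarrow> 'a"
  alg_norm :: "'a \<Rightarrow> real"

text \<open>The metric is cut off outside the carrier because the locale \<^locale>\<open>Metric_space\<close> requires
  symmetry and non-negativity on the whole type.\<close>

definition alg_dist :: "('a, 'm) cstar_struct_scheme \<Rightarrow> 'a \<Rightarrow> 'a \<Rightarrow> real" where
  "alg_dist A x y =
     (if x \<in> carrier A \<and> y \<in> carrier A then alg_norm A (x \<ominus>\<^bsub>A\<^esub> y) else 0)"

definition alg_topology :: "('a, 'm) cstar_struct_scheme \<Rightarrow> 'a topology" where
  "alg_topology A = Metric_space.mtopology (carrier A) (alg_dist A)"

locale cstar_algebra = module "class_ring :: complex ring" A
  for A :: "('a, 'm) cstar_struct_scheme" (structure) +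
  assumes mult_closed: "\<lbrakk>x \<in> carrier A; y \<in> carrier A\<rbrakk> \<Longrightarrow> x \<otimes> y \<in> carrier A"
    and mult_assoc: "\<lbrakk>x \<in> carrier A; y \<in> carrier A; z \<in> carrier A\<rbrakk>
      \<Longrightarrow> (x \<otimes> y) \<otimes> z = x \<otimes> (y \<otimes> z)"
    and mult_add_left: "\<lbrakk>x \<in> carrier A; y \<in> carrier A; z \<in> carrier A\<rbrakk>
      \<Longrightarrow> (x \<oplus> y) \<otimes> z = x \<otimes> z \<oplus> y \<otimes> z"
    and mult_add_right: "\<lbrakk>x \<in> carrier A; y \<in> carrier A; z \<in> carrier A\<rbrakk>
      \<Longrightarrow> z \<otimes> (x \<oplus> y) = z \<otimes> x \<oplus> z \<otimes> y"
    and smult_mult_left: "\<lbrakk>x \<in> carrier A; y \<in> carrier A\<rbrakk> \<Longrightarrow> (c \<odot> x) \<otimes> y = c \<odot> (x \<otimes> y)"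
    and smult_mult_right: "\<lbrakk>x \<in> carrier A; y \<in> carrier A\<rbrakk> \<Longrightarrow> x \<otimes> (c \<odot> y) = c \<odot> (x \<otimes> y)"
    and adj_closed: "x \<in> carrier A \<Longrightarrow> adj A x \<in> carrier A"
    and adj_adj: "x \<in> carrier A \<Longrightarrow> adj A (adj A x) = x"
    and adj_add: "\<lbrakk>x \<in> carrier A; y \<in> carrier A\<rbrakk> \<Longrightarrow> adj A (x \<oplus> y) = adj A x \<oplus> adj A y"
    and adj_smult: "x \<in> carrier A \<Longrightarrow> adj A (c \<odot> x) = cnj c \<odot> adj A x"
    and adj_mult: "\<lbrakk>x \<in> carrier A; y \<in> carrier A\<rbrakk> \<Longrightarrow> adj A (x \<otimes> y) = adj A y \<otimes> adj A x"
    and norm_eq_zero: "x \<in> carrier A \<Longrightarrow> alg_norm A x = 0 \<longleftrightarrow> x = \<zero>"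
    and norm_triangle: "\<lbrakk>x \<in> carrier A; y \<in> carrier A\<rbrakk>
      \<Longrightarrow> alg_norm A (x \<oplus> y) \<le> alg_norm A x + alg_norm A y"
    and norm_smult: "x \<in> carrier A \<Longrightarrow> alg_norm A (c \<odot> x) = cmod c * alg_norm A x"
    and norm_mult: "\<lbrakk>x \<in> carrier A; y \<in> carrier A\<rbrakk>
      \<Longrightarrow> alg_norm A (x \<otimes> y) \<le> alg_norm A x * alg_norm A y"
    and cstar_identity: "x \<in> carrier A \<Longrightarrow> alg_norm A (adj A x \<otimes> x) = (alg_norm A x)\<^sup>2"
    and complete: "Metric_space.mcomplete (carrier A) (alg_dist A)"

locale unital_cstar_algebra = cstar_algebra A + monoid A
  for A :: "('a, 'm) cstar_struct_scheme" (structure)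

definition contractions :: "('a, 'm) cstar_struct_scheme \<Rightarrow> 'a set" where
  "contractions A = {a \<in> carrier A. alg_norm A a \<le> 1}"

definition self_adjoints :: "('a, 'm) cstar_struct_scheme \<Rightarrow> 'a set" where
  "self_adjoints A = {a \<in> carrier A. adj A a = a}"

definition separable_algebra :: "('a, 'm) cstar_struct_scheme \<Rightarrow> bool" where
  "separable_algebra A \<longleftrightarrow> separable_space (alg_topology A)"

definition closed_two_sided_ideal :: "'a set \<Rightarrow> ('a, 'm) cstar_struct_scheme \<Rightarrow> bool" where
  "closed_two_sided_ideal I A \<longleftrightarrow>
     \<zero>\<^bsub>A\<^esub> \<in> I \<and> closedin (alg_topology A) I \<and>
     (\<forall>x\<in>I. \<forall>y\<in>I. x \<oplus>\<^bsub>A\<^esub> y \<in> I) \<and>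
     (\<forall>c. \<forall>x\<in>I. c \<odot>\<^bsub>A\<^esub> x \<in> I) \<and>
     (\<forall>a\<in>carrier A. \<forall>x\<in>I. a \<otimes>\<^bsub>A\<^esub> x \<in> I \<and> x \<otimes>\<^bsub>A\<^esub> a \<in> I)"

definition simple_algebra :: "('a, 'm) cstar_struct_scheme \<Rightarrow> bool" where
  "simple_algebra A \<longleftrightarrow> carrier A \<noteq> {\<zero>\<^bsub>A\<^esub>} \<and>
     (\<forall>I. closed_two_sided_ideal I A \<longrightarrow> I = {\<zero>\<^bsub>A\<^esub>} \<or> I = carrier A)"

definition cstar_subalgebra :: "'a set \<Rightarrow> ('a, 'm) cstar_struct_scheme \<Rightarrow> bool" where
  "cstar_subalgebra C A \<longleftrightarrow>
     \<zero>\<^bsub>A\<^esub> \<in> C \<and> closedin (alg_topology A) C \<and>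
     (\<forall>x\<in>C. \<forall>y\<in>C. x \<oplus>\<^bsub>A\<^esub> y \<in> C \<and> x \<otimes>\<^bsub>A\<^esub> y \<in> C) \<and>
     (\<forall>c. \<forall>x\<in>C. c \<odot>\<^bsub>A\<^esub> x \<in> C) \<and>
     (\<forall>x\<in>C. adj A x \<in> C)"

definition cstar_iso ::
  "('a, 'm) cstar_struct_scheme \<Rightarrow> ('b, 'n) cstar_struct_scheme \<Rightarrow> bool" where
  "cstar_iso A B \<longleftrightarrow>
     (\<exists>\<phi>. bij_betw \<phi> (carrier A) (carrier B) \<and>
        (\<forall>x\<in>carrier A. \<forall>y\<in>carrier A.
           \<phi> (x \<oplus>\<^bsub>A\<^esub> y) = \<phi> x \<oplus>\<^bsub>B\<^esub> \<phi> y \<and> \<phi> (x \<otimes>\<^bsub>A\<^esub> y) = \<phi> x \<otimes>\<^bsub>B\<^esub> \<phi> y) \<and>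
        (\<forall>c. \<forall>x\<in>carrier A. \<phi> (c \<odot>\<^bsub>A\<^esub> x) = c \<odot>\<^bsub>B\<^esub> \<phi> x) \<and>
        (\<forall>x\<in>carrier A. \<phi> (adj A x) = adj B (\<phi> x)))"

text \<open>Intended for unital C*-algebras; \<^const>\<open>Units\<close> is the set of invertible elements.\<close>

definition real_rank_zero :: "('a, 'm) cstar_struct_scheme \<Rightarrow> bool" where
  "real_rank_zero A \<longleftrightarrow>
     (\<forall>a\<in>self_adjoints A. \<forall>\<epsilon>>0. \<exists>b\<in>self_adjoints A \<inter> Units A. alg_norm A (a \<ominus>\<^bsub>A\<^esub> b) < \<epsilon>)"


section \<open>Compact operators on Hilbert spaces\<close>

text \<open>Inner products are linear in the first argument. The fields \<open>mult\<close> and \<open>one\<close> inherited from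
  the HOL-Algebra module record are unused.\<close>

record 'h hilbert_struct = "(complex, 'h) module" +
  hinner :: "'h \<Rightarrow> 'h \<Rightarrow> complex"

definition hnorm :: "('h, 'm) hilbert_struct_scheme \<Rightarrow> 'h \<Rightarrow> real" where
  "hnorm H x = sqrt (Re (hinner H x x))"

definition hdist :: "('h, 'm) hilbert_struct_scheme \<Rightarrow> 'h \<Rightarrow> 'h \<Rightarrow> real" where
  "hdist H x y =
     (if x \<in> carrier H \<and> y \<in> carrier H then hnorm H (x \<ominus>\<^bsub>H\<^esub> y) else 0)"

locale hilbert_space = module "class_ring :: complex ring" H
  for H :: "('h, 'm) hilbert_struct_scheme" (structure) +
  assumes inner_add: "\<lbrakk>x \<in> carrier H; y \<in> carrier H; z \<in> carrier H\<rbrakk>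
      \<Longrightarrow> hinner H (x \<oplus> y) z = hinner H x z + hinner H y z"
    and inner_smult: "\<lbrakk>x \<in> carrier H; y \<in> carrier H\<rbrakk> \<Longrightarrow> hinner H (c \<odot> x) y = c * hinner H x y"
    and inner_cnj: "\<lbrakk>x \<in> carrier H; y \<in> carrier H\<rbrakk> \<Longrightarrow> hinner H y x = cnj (hinner H x y)"
    and inner_nonneg: "x \<in> carrier H \<Longrightarrow> 0 \<le> Re (hinner H x x)"
    and inner_eq_zero: "x \<in> carrier H \<Longrightarrow> hinner H x x = 0 \<longleftrightarrow> x = \<zero>"
    and complete: "Metric_space.mcomplete (carrier H) (hdist H)"

definition compact_operators :: "('h, 'm) hilbert_struct_scheme \<Rightarrow> ('h \<Rightarrow> 'h) set" where
  "compact_operators H =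
     {T \<in> carrier H \<rightarrow>\<^sub>E carrier H.
        (\<forall>x\<in>carrier H. \<forall>y\<in>carrier H. T (x \<oplus>\<^bsub>H\<^esub> y) = T x \<oplus>\<^bsub>H\<^esub> T y) \<and>
        (\<forall>c. \<forall>x\<in>carrier H. T (c \<odot>\<^bsub>H\<^esub> x) = c \<odot>\<^bsub>H\<^esub> T x) \<and>
        (let X = Metric_space.mtopology (carrier H) (hdist H)
         in compactin X (X closure_of (T ` {x \<in> carrier H. hnorm H x \<le> 1})))}"

definition compact_operator_algebra ::
  "('h, 'm) hilbert_struct_scheme \<Rightarrow> ('h \<Rightarrow> 'h) cstar_struct" where
  "compact_operator_algebra H =
     \<lparr>carrier = compact_operators H,
      monoid.mult = (\<lambda>S T. \<lambda>x\<in>carrier H. S (T x)),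
      one = (\<lambda>x\<in>carrier H. x),
      zero = (\<lambda>x\<in>carrier H. \<zero>\<^bsub>H\<^esub>),
      add = (\<lambda>S T. \<lambda>x\<in>carrier H. S x \<oplus>\<^bsub>H\<^esub> T x),
      module.smult = (\<lambda>c T. \<lambda>x\<in>carrier H. c \<odot>\<^bsub>H\<^esub> T x),
      adj = (\<lambda>T. \<lambda>y\<in>carrier H.
        THE z. z \<in> carrier H \<and> (\<forall>x\<in>carrier H. hinner H (T x) y = hinner H x z)),
      alg_norm = (\<lambda>T. SUP x\<in>{x \<in> carrier H. hnorm H x \<le> 1}. hnorm H (T x))\<rparr>"

text \<open>
  It suffices to let the Hilbert space range over carriers inside the element type of the algebra:
  for a Hilbert space \<open>H\<close> and a unit vector \<open>e\<close>, the operators \<open>x \<mapsto> \<langle>x, e\<rangle> v\<close> with \<open>v\<close> in \<open>H\<close>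
  inject \<open>H\<close> into \<open>K(H)\<close>, so if the algebra is isomorphic to \<open>K(H)\<close> then \<open>H\<close> can be transported
  into its element type.
\<close>

definition elementary_algebra :: "('a, 'm) cstar_struct_scheme \<Rightarrow> bool" where
  "elementary_algebra A \<longleftrightarrow>
     (\<exists>H :: 'a hilbert_struct. hilbert_space H \<and> cstar_iso A (compact_operator_algebra H))"


section \<open>The algebras \<open>\<Oplus>\<^sub>i M\<^bsub>n\<^sub>i\<^esub>(C\<^sub>0(Z\<^sub>i))\<close>\<close>

definition C0_functions :: "'z topology \<Rightarrow> ('z \<Rightarrow> complex) set" where
  "C0_functions X = {g. continuous_map X euclidean g \<and>
     (\<forall>\<epsilon>>0. \<exists>K. compactin X K \<and> (\<forall>z\<in>topspace X - K. cmod (g z) < \<epsilon>))}"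

definition vec_l2_norm :: "complex vec \<Rightarrow> real" where
  "vec_l2_norm v = sqrt (\<Sum>i<dim_vec v. (cmod (vec_index v i))\<^sup>2)"

definition mat_op_norm :: "complex mat \<Rightarrow> real" where
  "mat_op_norm M =
     (SUP v\<in>{v \<in> carrier_vec (dim_col M). vec_l2_norm v \<le> 1}. vec_l2_norm (M *\<^sub>v v))"

text \<open>Elements of \<open>M\<^sub>n(C\<^sub>0(Z))\<close> are represented as matrix-valued functions on \<open>Z\<close>. The \<open>0\<close> inserted
  into the supremum matters only for empty \<open>Z\<close>.\<close>

definition matrix_C0_algebra :: "nat \<Rightarrow> 'z metric \<Rightarrow> ('z \<Rightarrow> complex mat) cstar_struct" where
  "matrix_C0_algebra n Z =
     \<lparr>carrier = {f \<in> mspace Z \<rightarrow>\<^sub>E carrier_mat n n.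
        \<forall>j<n. \<forall>k<n. (\<lambda>z. f z $$ (j, k)) \<in> C0_functions (mtopology_of Z)},
      monoid.mult = (\<lambda>f g. \<lambda>z\<in>mspace Z. f z * g z),
      one = (\<lambda>z\<in>mspace Z. 1\<^sub>m n),
      zero = (\<lambda>z\<in>mspace Z. 0\<^sub>m n n),
      add = (\<lambda>f g. \<lambda>z\<in>mspace Z. f z + g z),
      module.smult = (\<lambda>c f. \<lambda>z\<in>mspace Z. c \<cdot>\<^sub>m f z),
      adj = (\<lambda>f. \<lambda>z\<in>mspace Z. mat_adjoint (f z)),
      alg_norm = (\<lambda>f. Sup (insert 0 ((\<lambda>z. mat_op_norm (f z)) ` mspace Z)))\<rparr>"

definition direct_sum_algebra ::
  "nat \<Rightarrow> (nat \<Rightarrow> ('b, 'm) cstar_struct_scheme) \<Rightarrow> (nat \<Rightarrow> 'b) cstar_struct" where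
  "direct_sum_algebra m B =
     \<lparr>carrier = (\<Pi>\<^sub>E i\<in>{..<m}. carrier (B i)),
      monoid.mult = (\<lambda>f g. \<lambda>i\<in>{..<m}. f i \<otimes>\<^bsub>B i\<^esub> g i),
      one = (\<lambda>i\<in>{..<m}. \<one>\<^bsub>B i\<^esub>),
      zero = (\<lambda>i\<in>{..<m}. \<zero>\<^bsub>B i\<^esub>),
      add = (\<lambda>f g. \<lambda>i\<in>{..<m}. f i \<oplus>\<^bsub>B i\<^esub> g i),
      module.smult = (\<lambda>c f. \<lambda>i\<in>{..<m}. c \<odot>\<^bsub>B i\<^esub> f i),
      adj = (\<lambda>f. \<lambda>i\<in>{..<m}. adj (B i) (f i)),
      alg_norm = (\<lambda>f. Max (insert 0 ((\<lambda>i. alg_norm (B i) (f i)) ` {..<m})))\<rparr>"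


section \<open>Covering dimension\<close>

text \<open>Every finite open cover has a finite open refinement in which any \<open>k + 1\<close> distinct members
  have empty intersection, i.e. the covering dimension is at most \<open>k - 1\<close>.\<close>

definition covering_order_le :: "'z topology \<Rightarrow> nat \<Rightarrow> bool" where
  "covering_order_le X k \<longleftrightarrow>
     (\<forall>\<U>. finite \<U> \<and> (\<forall>U\<in>\<U>. openin X U) \<and> \<Union>\<U> = topspace X \<longrightarrow>
        (\<exists>\<V>. finite \<V> \<and> (\<forall>V\<in>\<V>. openin X V) \<and> \<Union>\<V> = topspace X \<and>
             (\<forall>V\<in>\<V>. \<exists>U\<in>\<U>. V \<subseteq> U) \<and>
             (\<forall>\<W>\<subseteq>\<V>. card \<W> = Suc k \<longrightarrow> \<Inter>\<W> = {})))"

text \<open>The empty space has dimension \<open>-1\<close>; the infimum of the empty set is \<open>\<infinity>\<close>.\<close>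

definition covering_dim :: "'z topology \<Rightarrow> ereal" where
  "covering_dim X = (INF k\<in>{k. covering_order_le X k}. ereal (real k - 1))"


section \<open>Traces and tracially locally trivially homogeneous algebras\<close>

definition tracial_states :: "('a, 'm) cstar_struct_scheme \<Rightarrow> ('a \<Rightarrow> complex) set" where
  "tracial_states A = {\<tau> \<in> extensional (carrier A).
     (\<forall>x\<in>carrier A. \<forall>y\<in>carrier A. \<tau> (x \<oplus>\<^bsub>A\<^esub> y) = \<tau> x + \<tau> y) \<and>
     (\<forall>c. \<forall>x\<in>carrier A. \<tau> (c \<odot>\<^bsub>A\<^esub> x) = c * \<tau> x) \<and>
     (\<forall>x\<in>carrier A. \<tau> (adj A x \<otimes>\<^bsub>A\<^esub> x) \<in> \<real> \<and> 0 \<le> Re (\<tau> (adj A x \<otimes>\<^bsub>A\<^esub> x))) \<and>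
     bdd_above ((\<lambda>x. cmod (\<tau> x)) ` contractions A) \<and>
     (SUP x\<in>contractions A. cmod (\<tau> x)) = 1 \<and>
     (\<forall>x\<in>carrier A. \<forall>y\<in>carrier A. \<tau> (x \<otimes>\<^bsub>A\<^esub> y) = \<tau> (y \<otimes>\<^bsub>A\<^esub> x))}"

definition trace_norm2 ::
  "('a, 'm) cstar_struct_scheme \<Rightarrow> ('a \<Rightarrow> complex) \<Rightarrow> 'a \<Rightarrow> real" where
  "trace_norm2 A \<tau> a = sqrt (Re (\<tau> (adj A a \<otimes>\<^bsub>A\<^esub> a)))"

definition uniform_norm2 :: "('a, 'm) cstar_struct_scheme \<Rightarrow> 'a \<Rightarrow> real" where
  "uniform_norm2 A a = (SUP \<tau>\<in>tracial_states A. trace_norm2 A \<tau> a)"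

definition tracially_approximates ::
  "('a, 'm) cstar_struct_scheme \<Rightarrow> 'a set \<Rightarrow> 'a set \<Rightarrow> real \<Rightarrow> bool" where
  "tracially_approximates A C F \<epsilon> \<longleftrightarrow>
     (\<forall>a\<in>F. \<exists>c\<in>C. alg_norm A c \<le> 1 \<and> uniform_norm2 A (a \<ominus>\<^bsub>A\<^esub> c) < \<epsilon>)"

definition LTH_subalgebra ::
  "('a, 'm) cstar_struct_scheme \<Rightarrow> 'a set \<Rightarrow> nat \<Rightarrow> (nat \<Rightarrow> nat) \<Rightarrow> (nat \<Rightarrow> 'z metric) \<Rightarrow> bool" where
  "LTH_subalgebra A C m n Z \<longleftrightarrow>
     cstar_subalgebra C A \<and>
     (\<forall>i<m. 0 < n i \<and> locally_compact_space (mtopology_of (Z i))) \<and>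
     cstar_iso (A\<lparr>carrier := C\<rparr>) (direct_sum_algebra m (\<lambda>i. matrix_C0_algebra (n i) (Z i)))"

text \<open>
  HOL cannot quantify existentially over types, so the type whose subsets carry the spaces \<open>Z\<^sub>i\<close>
  is a parameter. A theorem assuming these properties for an arbitrary type parameter covers
  every choice of spaces, since the set-many spaces involved embed into one common type.
\<close>

definition tracially_LTH :: "'z itself \<Rightarrow> ('a, 'm) cstar_struct_scheme \<Rightarrow> bool" where
  "tracially_LTH (_ :: 'z itself) A \<longleftrightarrow>
     cstar_algebra A \<and> tracial_states A \<noteq> {} \<and>
     (\<forall>F \<epsilon>. finite F \<and> F \<subseteq> contractions A \<and> 0 < \<epsilon> \<longrightarrow>
        (\<exists>C m n (Z :: nat \<Rightarrow> 'z metric).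
           LTH_subalgebra A C m n Z \<and> tracially_approximates A C F \<epsilon>))"

definition locally_flat_dimension_growth ::
  "'z itself \<Rightarrow> ('a, 'm) cstar_struct_scheme \<Rightarrow> bool" where
  "locally_flat_dimension_growth (_ :: 'z itself) A \<longleftrightarrow>
     (\<forall>F \<epsilon>. finite F \<and> F \<subseteq> contractions A \<and> 0 < \<epsilon> \<longrightarrow>
        (\<exists>N::real. 0 < N \<and>
           (\<forall>k::nat. \<exists>C m n (Z :: nat \<Rightarrow> 'z metric).
              LTH_subalgebra A C m n Z \<and> tracially_approximates A C F \<epsilon> \<and>
              (\<forall>i<m. k \<le> n i \<and>
                 covering_dim (mtopology_of (Z i)) / ereal (real (n i)) < ereal N))))"


section \<open>The tracial ultrapower\<close>

definition nonprincipal_ultrafilter :: "nat filter \<Rightarrow> bool" where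
  "nonprincipal_ultrafilter U \<longleftrightarrow>
     U \<noteq> bot \<and> (\<forall>P. eventually P U \<or> eventually (\<lambda>n. \<not> P n) U) \<and>
     (\<forall>m. eventually (\<lambda>n. n \<noteq> m) U)"

definition bounded_sequences :: "('a, 'm) cstar_struct_scheme \<Rightarrow> (nat \<Rightarrow> 'a) cstar_struct" where
  "bounded_sequences A =
     \<lparr>carrier = {x. range x \<subseteq> carrier A \<and> bdd_above (range (\<lambda>n. alg_norm A (x n)))},
      monoid.mult = (\<lambda>x y n. x n \<otimes>\<^bsub>A\<^esub> y n),
      one = (\<lambda>n. \<one>\<^bsub>A\<^esub>),
      zero = (\<lambda>n. \<zero>\<^bsub>A\<^esub>),
      add = (\<lambda>x y n. x n \<oplus>\<^bsub>A\<^esub> y n),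
      module.smult = (\<lambda>c x n. c \<odot>\<^bsub>A\<^esub> x n),
      adj = (\<lambda>x n. adj A (x n)),
      alg_norm = (\<lambda>x. SUP n. alg_norm A (x n))\<rparr>"

definition trace_kernel_ideal ::
  "nat filter \<Rightarrow> ('a, 'm) cstar_struct_scheme \<Rightarrow> (nat \<Rightarrow> 'a) set" where
  "trace_kernel_ideal U A =
     {x \<in> carrier (bounded_sequences A). ((\<lambda>n. uniform_norm2 A (x n)) \<longlongrightarrow> 0) U}"

text \<open>The ring structure is that of the factor ring \<open>B Quot J\<close> of HOL-Algebra;
  the norm is the quotient norm.\<close>

definition quotient_algebra ::
  "('b, 'm) cstar_struct_scheme \<Rightarrow> 'b set \<Rightarrow> 'b set cstar_struct" where
  "quotient_algebra B J =
     \<lparr>carrier = carrier (B Quot J),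
      monoid.mult = monoid.mult (B Quot J),
      one = one (B Quot J),
      zero = zero (B Quot J),
      add = add (B Quot J),
      module.smult = (\<lambda>c X. \<Union>x\<in>X. J +>\<^bsub>B\<^esub> (c \<odot>\<^bsub>B\<^esub> x)),
      adj = (\<lambda>X. \<Union>x\<in>X. J +>\<^bsub>B\<^esub> adj B x),
      alg_norm = (\<lambda>X. INF x\<in>X. alg_norm B x)\<rparr>"

definition tracial_ultrapower ::
  "nat filter \<Rightarrow> ('a, 'm) cstar_struct_scheme \<Rightarrow> (nat \<Rightarrow> 'a) set cstar_struct" where
  "tracial_ultrapower U A = quotient_algebra (bounded_sequences A) (trace_kernel_ideal U A)"

end

theory Submission
  imports Defs "HOL-Analysis.Analysis"
begin

text \<open>
  Hermitian \<open>n \<times> n\<close> matrices of corank at least \<open>r\<close> have codimension \<open>r\<^sup>2\<close>. Hence a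
  Hermitian matrix-valued function on a space of dimension less than \<open>r\<^sup>2\<close> can be perturbed, by an
  arbitrarily small amount, to have corank less than \<open>r\<close> everywhere: replace it by a
  function with values in finitely many simplices and add a generic constant matrix. Under flat
  dimension growth the dimension is at most \<open>N * n\<close> while \<open>n\<close> is as large as we please, so
  \<open>r\<close> may be taken to be about \<open>\<theta> * n\<close> for any prescribed \<open>\<theta> > 0\<close>. Pushing the nonzero eigenvalues out of
  \<open>(-\<epsilon>, \<epsilon>)\<close> moves the function by at most \<open>\<epsilon>\<close> and leaves a self-adjoint \<open>b\<close> with a quasi-inverse
  \<open>c\<close> of norm at most \<open>1 / \<epsilon>\<close> such that \<open>1 - b c\<close> has rank less than \<open>r\<close> at every point, so its
  uniform trace norm is of order \<open>sqrt \<theta>\<close>. Since the bound \<open>1 / \<epsilon>\<close> does not depend on \<open>\<theta>\<close>, these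
  approximate inverses assemble to exact inverses in the tracial ultrapower.
\<close>

section \<open>Hermitian matrices and their functional calculus\<close>

text \<open>Several obstacles shape the argument. The subalgebra \<open>C\<close> need not contain
  the unit of \<open>A\<close>, and its functions vanish at infinity, so a constant shift must be
  cut off and control of the corank is lost where the cut-off acts. It is arranged to act only where
  a tracial approximate unit \<open>e\<close> of \<open>C\<close> is small. Then
  \<open>1 - b c = (1 - e) (1 - b c) + e (1 - b c)\<close>, where the first term is small in the
  uniform trace norm and the second has small normalized Hilbert-Schmidt norm at every point. Such
  pointwise bounds reach all traces without measures: a trace on matrix-valued functions sees only
  the pointwise matrix trace, so a square may be replaced by a scalar function. The codimension
  \<open>r\<^sup>2\<close> comes from counting, not from manifolds or measure: if every Hermitian
  matrix of a fine integer grid failed as a shift, the grid would embed into a set of codes that is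
  too small. Finally, the isomorphisms with matrix algebras are purely algebraic, so norm bounds in
  \<open>C\<close> are derived from explicit unitaries.\<close>

lemma homogeneous_system:
  fixes a :: "'i \<Rightarrow> 'k \<Rightarrow> complex"
  assumes "finite I" "finite K" "card I < card K"
  shows "\<exists>x. (\<exists>k\<in>K. x k \<noteq> 0) \<and> (\<forall>i\<in>I. (\<Sum>k\<in>K. a i k * x k) = 0)"
  using assms
proof (induction I arbitrary: K a rule: finite_induct)
  case empty
  then obtain k where "k \<in> K" by (metis card.empty card_gt_0_iff ex_in_conv)
  then show ?case by (intro exI[of _ "\<lambda>_. 1"]) auto
next
  case (insert r I)
  show ?case
  proof (cases "\<forall>k\<in>K. a r k = 0")
    case True
    have "card I < card K" using insert by simp
    from insert.IH[OF insert.prems(1) this, of a] True show ?thesis by auto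
  next
    case False
    then obtain k0 where k0: "k0 \<in> K" "a r k0 \<noteq> 0" by auto
    let ?K = "K - {k0}"
    \<comment> \<open>One step of Gaussian elimination with pivot \<open>a r k0\<close>: row
      \<open>r\<close> of \<open>b\<close> vanishes, and the unknown \<open>x k0\<close> is
      recovered from row \<open>r\<close> afterwards.\<close>
    define b where "b i k = a i k - a i k0 * a r k / a r k0" for i k
    have fK: "finite ?K" and cK: "card I < card ?K" using insert k0 by auto
    from insert.IH[OF fK cK, of b] obtain y where
      y: "\<exists>k\<in>?K. y k \<noteq> 0" "\<forall>i\<in>I. (\<Sum>k\<in>?K. b i k * y k) = 0" by auto
    define x where "x = y(k0 := - (\<Sum>k\<in>?K. a r k * y k) / a r k0)"
    have S: "(\<Sum>k\<in>K. a i k * x k) = a i k0 * x k0 + (\<Sum>k\<in>?K. a i k * y k)" for i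
      using k0 insert.prems(1) unfolding x_def
      by (simp add: sum.remove[of K k0])
    have S2: "(\<Sum>k\<in>K. a i k * x k) = (\<Sum>k\<in>?K. b i k * y k)" for i
    proof -
      have "(\<Sum>k\<in>?K. b i k * y k) = (\<Sum>k\<in>?K. a i k * y k) - (\<Sum>k\<in>?K. a i k0 / a r k0 * (a r k * y k))"
        by (simp add: b_def sum_subtractf[symmetric] algebra_simps)
      also have "\<dots> = (\<Sum>k\<in>?K. a i k * y k) - a i k0 / a r k0 * (\<Sum>k\<in>?K. a r k * y k)"
        by (simp add: sum_distrib_left)
      finally show ?thesis unfolding S by (simp add: x_def)
    qed
    have "b r k = 0" for k using k0 by (simp add: b_def)
    then have "(\<Sum>k\<in>K. a r k * x k) = 0" unfolding S2 by simp
    moreover have "\<forall>i\<in>I. (\<Sum>k\<in>K. a i k * x k) = 0" unfolding S2 using y by auto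
    moreover have "\<exists>k\<in>K. x k \<noteq> 0" using y(1) by (auto simp: x_def)
    ultimately show ?thesis by blast
  qed
qed

text \<open>Matrices are plain functions of two indices, meaningful below \<open>n\<close> only, so
  that sums, scalings and families over a space need no dimension bookkeeping.
  \<open>matrix_data\<close> later translates to the matrices in the definition of the
  algebra.\<close>

definition hermitian :: "nat \<Rightarrow> (nat \<Rightarrow> nat \<Rightarrow> complex) \<Rightarrow> bool" where
  "hermitian n M \<longleftrightarrow> (\<forall>i<n. \<forall>j<n. M j i = cnj (M i j))"

definition std_inner :: "nat \<Rightarrow> (nat \<Rightarrow> complex) \<Rightarrow> (nat \<Rightarrow> complex) \<Rightarrow> complex" where
  "std_inner n x y = (\<Sum>i<n. cnj (x i) * y i)"

definition mat_app :: "nat \<Rightarrow> (nat \<Rightarrow> nat \<Rightarrow> complex) \<Rightarrow> (nat \<Rightarrow> complex) \<Rightarrow> nat \<Rightarrow> complex" where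
  "mat_app n M v = (\<lambda>i. if i < n then \<Sum>j<n. M i j * v j else 0)"

lemma hermitianD: "hermitian n M \<Longrightarrow> i < n \<Longrightarrow> j < n \<Longrightarrow> cnj (M i j) = M j i"
  unfolding hermitian_def by metis

lemma std_inner_self: "std_inner n x x = of_real (\<Sum>i<n. (cmod (x i))\<^sup>2)"
  unfolding std_inner_def of_real_sum by (intro sum.cong refl) (metis complex_norm_square mult.commute)

lemma std_inner_hermitian:
  assumes "hermitian n M"
  shows "std_inner n x (mat_app n M y) = std_inner n (mat_app n M x) y"
proof -
  have "std_inner n x (mat_app n M y) = (\<Sum>i<n. \<Sum>j<n. cnj (x i) * (M i j * y j))"
    unfolding std_inner_def mat_app_def by (simp add: sum_distrib_left)
  also have "\<dots> = (\<Sum>j<n. \<Sum>i<n. cnj (x i) * (M i j * y j))" by (rule sum.swap)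
  also have "\<dots> = (\<Sum>j<n. \<Sum>i<n. cnj (M j i * x i) * y j)"
  proof (intro sum.cong refl)
    fix i j assume "j \<in> {..<n}" "i \<in> {..<n}"
    then have "cnj (M j i) = M i j" using hermitianD[OF assms] by simp
    then show "cnj (x i) * (M i j * y j) = cnj (M j i * x i) * y j" by simp
  qed
  also have "\<dots> = std_inner n (mat_app n M x) y"
    unfolding std_inner_def mat_app_def by (simp add: sum_distrib_right)
  finally show ?thesis .
qed

text \<open>The orthogonal complement of the eigenvectors found so far is invariant because
  \<open>M\<close> is Hermitian. For a nonzero \<open>v\<close> in it, take a nonzero polynomial
  \<open>p\<close> of least degree with \<open>p(M) v = 0\<close> and split off a root as
  \<open>p = (X - z) q\<close>; then \<open>q(M) v\<close> is an eigenvector for \<open>z\<close>,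
  and Hermitian symmetry makes \<open>z\<close> real.\<close>

lemma eigenvector_in_complement:
  assumes h: "hermitian n M" and "r < n"
    and orth: "\<And>k l. k < r \<Longrightarrow> l < r \<Longrightarrow> std_inner n (u k) (u l) = (if k = l then 1 else 0)"
    and eig: "\<And>l i. l < r \<Longrightarrow> i < n \<Longrightarrow> mat_app n M (u l) i = of_real (d l) * u l i"
  shows "\<exists>w e. std_inner n w w = 1 \<and> (\<forall>l<r. std_inner n (u l) w = 0) \<and> (\<forall>i<n. mat_app n M w i = of_real (e::real) * w i)"
proof -
  let ?T = "mat_app n M"
  obtain v1 where v1: "\<exists>k\<in>{..<n}. v1 k \<noteq> 0" "\<forall>l\<in>{..<r}. (\<Sum>i<n. cnj (u l i) * v1 i) = 0"
    using homogeneous_system[of "{..<r}" "{..<n}" "\<lambda>l i. cnj (u l i)"] \<open>r < n\<close> by auto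
  define v where "v i = (if i < n then v1 i else 0)" for i
  have v: "\<exists>k<n. v k \<noteq> 0" "\<And>i. \<not> i < n \<Longrightarrow> v i = 0" "\<And>l. l < r \<Longrightarrow> std_inner n (u l) v = 0"
    using v1 by (auto simp: v_def std_inner_def)
  have Tk0: "((?T ^^ k) v) i = 0" if "\<not> i < n" for k i
    using that v(2) by (cases k) (auto simp: mat_app_def)
  have Tk_orth: "std_inner n (u l) ((?T ^^ k) v) = 0" if "l < r" for k l
  proof (induction k)
    case 0 show ?case using v that by simp
  next
    case (Suc k)
    have "std_inner n (u l) ((?T ^^ Suc k) v) = std_inner n (?T (u l)) ((?T ^^ k) v)"
      using std_inner_hermitian[OF h] by simp
    also have "\<dots> = of_real (d l) * std_inner n (u l) ((?T ^^ k) v)"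
      unfolding std_inner_def using eig[OF that] by (simp add: sum_distrib_left mult.assoc)
    finally show ?case using Suc by simp
  qed
  \<comment> \<open>This is the vector \<open>p(M) v\<close>.\<close>
  define pact where "pact p i = (\<Sum>k\<le>degree p. coeff p k * ((?T ^^ k) v) i)" for p :: "complex poly" and i
  have pact_ge: "pact p i = (\<Sum>k\<le>N. coeff p k * ((?T ^^ k) v) i)" if "degree p \<le> N" for p i N
    unfolding pact_def
    by (rule sum.mono_neutral_left) (use that coeff_eq_0 in \<open>auto simp: coeff_eq_0\<close>)
  have pact_fac: "pact ([:- z, 1:] * q) i = ?T (pact q) i - z * pact q i" if "i < n" for z q i
  proof -
    let ?N = "Suc (degree q)"
    have dg: "degree ([:- z, 1:] * q) \<le> ?N"
      by (rule order.trans[OF degree_mult_le]) simp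
    have "pact ([:- z, 1:] * q) i = (\<Sum>k\<le>?N. coeff ([:- z, 1:] * q) k * ((?T ^^ k) v) i)"
      by (rule pact_ge[OF dg])
    also have "\<dots> = (\<Sum>k\<le>?N. coeff (pCons 0 q) k * ((?T ^^ k) v) i) - z * (\<Sum>k\<le>?N. coeff q k * ((?T ^^ k) v) i)"
    proof -
      have c: "coeff ([:- z, 1:] * q) k = coeff (pCons 0 q) k - z * coeff q k" for k by simp
      show ?thesis unfolding c left_diff_distrib sum_subtractf sum_distrib_left mult.assoc ..
    qed
    also have "(\<Sum>k\<le>?N. coeff q k * ((?T ^^ k) v) i) = pact q i"
      by (rule pact_ge[symmetric]) simp
    also have "(\<Sum>k\<le>?N. coeff (pCons 0 q) k * ((?T ^^ k) v) i)
       = (\<Sum>k\<le>degree q. coeff q k * ((?T ^^ Suc k) v) i)"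
      by (subst sum.atMost_Suc_shift) simp
    also have "\<dots> = (\<Sum>k\<le>degree q. \<Sum>j<n. coeff q k * (M i j * ((?T ^^ k) v) j))"
      using that by (simp add: mat_app_def sum_distrib_left)
    also have "\<dots> = (\<Sum>j<n. \<Sum>k\<le>degree q. coeff q k * (M i j * ((?T ^^ k) v) j))"
      by (rule sum.swap)
    also have "\<dots> = ?T (pact q) i"
      using that by (simp add: mat_app_def pact_def sum_distrib_left mult.left_commute)
    finally show ?thesis .
  qed
  let ?P = "\<lambda>p. p \<noteq> 0 \<and> (\<forall>i<n. pact p i = 0)"
  have "\<exists>p. ?P p"
  proof -
    \<comment> \<open>The \<open>n + 1\<close> vectors \<open>v\<close>, \<open>M v\<close>, ...,
      \<open>M^n v\<close> in dimension \<open>n\<close> are linearly dependent.\<close>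
    obtain a where a: "\<exists>k\<in>{..n}. a k \<noteq> 0" "\<forall>i\<in>{..<n}. (\<Sum>k\<le>n. ((?T ^^ k) v) i * a k) = 0"
      using homogeneous_system[of "{..<n}" "{..n}" "\<lambda>i k. ((?T ^^ k) v) i"] by auto
    define p where "p = Poly (map a [0..<Suc n])"
    have c: "coeff p k = (if k \<le> n then a k else 0)" for k
      unfolding p_def by (simp add: nth_default_def del: upt_Suc)
    then have "p \<noteq> 0" using a(1) by (metis atMost_iff coeff_0)
    moreover have "degree p \<le> n" using c by (intro degree_le) auto
    then have "pact p i = (\<Sum>k\<le>n. a k * ((?T ^^ k) v) i)" for i
      by (subst pact_ge) (auto simp: c)
    ultimately show ?thesis using a(2) by (auto simp: mult.commute)
  qed
  then obtain p where p: "?P p" and pmin: "\<And>q. ?P q \<Longrightarrow> degree p \<le> degree q"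
    using ex_has_least_nat[of ?P _ degree] by metis
  have "degree p \<noteq> 0"
  proof
    assume "degree p = 0"
    then have "pact p i = coeff p 0 * v i" for i unfolding pact_def by simp
    moreover have "coeff p 0 \<noteq> 0" using p \<open>degree p = 0\<close> by (metis leading_coeff_0_iff)
    ultimately show False using p v(1) by auto
  qed
  then obtain z where z: "poly p z = 0"
    using fundamental_theorem_of_algebra[of p] by (auto simp: constant_degree)
  then obtain q where q: "p = [:- z, 1:] * q" by (metis poly_eq_0_iff_dvd dvdE)
  have q0: "q \<noteq> 0" using p q by auto
  have "degree q < degree p" unfolding q using q0 by (subst degree_mult_eq) auto
  \<comment> \<open>Since \<open>q\<close> has smaller degree than the minimal \<open>p\<close>, the
    vector \<open>q(M) v\<close> is not zero.\<close>
  then obtain i0 where i0: "i0 < n" "pact q i0 \<noteq> 0" using pmin[of q] q0 by force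
  define w0 where "w0 = pact q"
  have ew0: "?T w0 i = z * w0 i" if "i < n" for i
    using pact_fac[OF that, of z q] p that unfolding q[symmetric] w0_def by simp
  have ow0: "std_inner n (u l) w0 = 0" if "l < r" for l
  proof -
    have "std_inner n (u l) w0 = (\<Sum>i<n. \<Sum>k\<le>degree q. coeff q k * (cnj (u l i) * ((?T ^^ k) v) i))"
      unfolding std_inner_def w0_def pact_def by (simp add: sum_distrib_left mult.left_commute)
    also have "\<dots> = (\<Sum>k\<le>degree q. \<Sum>i<n. coeff q k * (cnj (u l i) * ((?T ^^ k) v) i))"
      by (rule sum.swap)
    also have "\<dots> = (\<Sum>k\<le>degree q. coeff q k * std_inner n (u l) ((?T ^^ k) v))"
      unfolding std_inner_def by (simp add: sum_distrib_left)
    finally show ?thesis using Tk_orth[OF that] by simp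
  qed
  define s where "s = (\<Sum>i<n. (cmod (w0 i))\<^sup>2)"
  have "s > 0"
    unfolding s_def using i0 by (intro sum_pos2[of _ i0]) (auto simp: w0_def)
  have ss: "std_inner n w0 w0 = of_real s" unfolding std_inner_self s_def ..
  have "std_inner n w0 (?T w0) = z * of_real s"
    unfolding ss[symmetric] unfolding std_inner_def using ew0 by (simp add: sum_distrib_left mult.left_commute)
  moreover have "std_inner n (?T w0) w0 = cnj z * of_real s"
    unfolding ss[symmetric] unfolding std_inner_def using ew0 by (simp add: sum_distrib_left mult.left_commute mult.assoc)
  ultimately have "z = cnj z" using std_inner_hermitian[OF h, of w0 w0] \<open>s > 0\<close> by simp
  then have zr: "z = of_real (Re z)" by (simp add: complex_eq_iff)
  define w where "w i = w0 i / of_real (sqrt s)" for i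
  have "complex_of_real (sqrt s) * complex_of_real (sqrt s) = of_real s"
    using \<open>s > 0\<close> by (simp flip: of_real_mult)
  then have "std_inner n w w = std_inner n w0 w0 / of_real s"
    unfolding std_inner_def w_def by (simp add: sum_divide_distrib)
  then have "std_inner n w w = 1" using ss \<open>s > 0\<close> by simp
  moreover have "std_inner n (u l) w = 0" if "l < r" for l
    using ow0[OF that] unfolding std_inner_def w_def by (simp add: sum_divide_distrib[symmetric])
  moreover have "?T w i = of_real (Re z) * w i" if "i < n" for i
    using ew0[OF that] that zr unfolding w_def mat_app_def by (simp add: sum_divide_distrib[symmetric])
  ultimately show ?thesis by blast
qed

text \<open>A relation, because eigenbases are not unique: counts of small eigenvalues are stated
  for every eigenbasis and then applied to the one selected by
  \<open>spectral_choice\<close>.\<close>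

definition spectral :: "nat \<Rightarrow> (nat \<Rightarrow> nat \<Rightarrow> complex) \<Rightarrow> (nat \<Rightarrow> nat \<Rightarrow> complex) \<Rightarrow> (nat \<Rightarrow> real) \<Rightarrow> bool" where
  "spectral n M u d \<longleftrightarrow>
     (\<forall>k<n. \<forall>l<n. std_inner n (u k) (u l) = (if k = l then 1 else 0)) \<and>
     (\<forall>l<n. \<forall>i<n. mat_app n M (u l) i = of_real (d l) * u l i)"

lemma spectral_exists:
  assumes "hermitian n M"
  shows "\<exists>u d. spectral n M u d"
proof -
  have "\<exists>u d. (\<forall>k<r. \<forall>l<r. std_inner n (u k) (u l) = (if k = l then 1 else 0)) \<and>
     (\<forall>l<r. \<forall>i<n. mat_app n M (u l) i = of_real (d l :: real) * u l i)" if "r \<le> n" for r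
    using that
  proof (induction r)
    case 0 then show ?case by auto
  next
    case (Suc r)
    then obtain u and d :: "nat \<Rightarrow> real" where ud: "\<forall>k<r. \<forall>l<r. std_inner n (u k) (u l) = (if k = l then 1 else 0)"
      "\<forall>l<r. \<forall>i<n. mat_app n M (u l) i = of_real (d l) * u l i" by auto
    from eigenvector_in_complement[OF assms, of r u d] ud Suc
    obtain w e where w: "std_inner n w w = 1" "\<forall>l<r. std_inner n (u l) w = 0" "\<forall>i<n. mat_app n M w i = of_real (e::real) * w i"
      by auto
    have w': "std_inner n w (u l) = 0" if "l < r" for l
    proof -
      have "std_inner n w (u l) = cnj (std_inner n (u l) w)" unfolding std_inner_def by (simp add: mult.commute)
      then show ?thesis using w that by simp
    qed
    show ?case
      by (rule exI[of _ "u(r := w)"], rule exI[of _ "d(r := e)"]) (use ud w w' in \<open>auto simp: less_Suc_eq\<close>)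
  qed
  from this[of n] show ?thesis unfolding spectral_def by auto
qed

text \<open>Orthonormality says that a square matrix has a left inverse; that it is also a right
  inverse is the resolution of the identity.\<close>

lemma spectral_complete:
  assumes "spectral n M u d" "i < n" "j < n"
  shows "(\<Sum>l<n. u l i * cnj (u l j)) = (if i = j then 1 else 0)"
proof -
  define V where "V = mat n n (\<lambda>(l, i). cnj (u l i))"
  define W where "W = mat n n (\<lambda>(i, l). u l i)"
  have V: "V \<in> carrier_mat n n" and W: "W \<in> carrier_mat n n" unfolding V_def W_def by auto
  have "V * W = 1\<^sub>m n"
  proof (rule eq_matI)
    fix k l assume "k < dim_row (1\<^sub>m n :: complex mat)" "l < dim_col (1\<^sub>m n :: complex mat)"
    then have kl: "k < n" "l < n" by auto
    then have "(V * W) $$ (k, l) = std_inner n (u k) (u l)"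
      by (simp add: V_def W_def times_mat_def scalar_prod_def std_inner_def lessThan_atLeast0)
    then show "(V * W) $$ (k, l) = 1\<^sub>m n $$ (k, l)" using kl assms unfolding spectral_def by auto
  qed (auto simp: V_def W_def)
  then have "W * V = 1\<^sub>m n" using mat_mult_left_right_inverse[OF V W] by simp
  then have "(W * V) $$ (i, j) = (if i = j then 1 else 0)" using assms by simp
  then show ?thesis using assms
    by (simp add: V_def W_def times_mat_def scalar_prod_def lessThan_atLeast0)
qed

section \<open>Functional calculus in an eigenbasis\<close>

definition mat_prod :: "nat \<Rightarrow> (nat \<Rightarrow> nat \<Rightarrow> complex) \<Rightarrow> (nat \<Rightarrow> nat \<Rightarrow> complex) \<Rightarrow> nat \<Rightarrow> nat \<Rightarrow> complex" where
  "mat_prod n A B = (\<lambda>i j. \<Sum>k<n. A i k * B k j)"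

definition spectral_fun :: "nat \<Rightarrow> (nat \<Rightarrow> nat \<Rightarrow> complex) \<Rightarrow> (nat \<Rightarrow> real) \<Rightarrow> (real \<Rightarrow> real) \<Rightarrow> nat \<Rightarrow> nat \<Rightarrow> complex" where
  "spectral_fun n u d G = (\<lambda>i j. \<Sum>l<n. of_real (G (d l)) * (u l i * cnj (u l j)))"

lemma spectral_fun_id:
  assumes "spectral n M u d" "i < n" "j < n"
  shows "spectral_fun n u d (\<lambda>x. x) i j = M i j"
proof -
  have "M i j = (\<Sum>k<n. M i k * (if k = j then 1 else 0))"
    using assms by (simp add: if_distrib cong: if_cong)
  also have "\<dots> = (\<Sum>k<n. M i k * (\<Sum>l<n. u l k * cnj (u l j)))"
    using assms by (intro sum.cong refl) (simp add: spectral_complete)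
  also have "\<dots> = (\<Sum>k<n. \<Sum>l<n. M i k * u l k * cnj (u l j))"
    by (simp add: sum_distrib_left mult.assoc)
  also have "\<dots> = (\<Sum>l<n. \<Sum>k<n. M i k * u l k * cnj (u l j))" by (rule sum.swap)
  also have "\<dots> = (\<Sum>l<n. mat_app n M (u l) i * cnj (u l j))"
    using assms by (simp add: mat_app_def sum_distrib_right)
  also have "\<dots> = spectral_fun n u d (\<lambda>x. x) i j"
    unfolding spectral_fun_def using assms unfolding spectral_def by (simp add: mult.assoc)
  finally show ?thesis ..
qed

lemma spectral_fun_one:
  assumes "spectral n M u d" "i < n" "j < n"
  shows "spectral_fun n u d (\<lambda>x. 1) i j = (if i = j then 1 else 0)"
  unfolding spectral_fun_def using spectral_complete[OF assms] by simp

lemma spectral_fun_hermitian: "hermitian n (spectral_fun n u d G)"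
  unfolding hermitian_def spectral_fun_def by (simp add: mult.commute mult.left_commute)

lemma spectral_fun_row:
  assumes "spectral n M u d"
  shows "(\<Sum>k<n. x k * spectral_fun n u d G k j) = (\<Sum>l<n. of_real (G (d l)) * (\<Sum>k<n. x k * u l k) * cnj (u l j))"
proof -
  have "(\<Sum>k<n. x k * spectral_fun n u d G k j) = (\<Sum>k<n. \<Sum>l<n. of_real (G (d l)) * (x k * u l k) * cnj (u l j))"
    unfolding spectral_fun_def by (simp add: sum_distrib_left algebra_simps)
  also have "\<dots> = (\<Sum>l<n. \<Sum>k<n. of_real (G (d l)) * (x k * u l k) * cnj (u l j))" by (rule sum.swap)
  finally show ?thesis by (simp add: sum_distrib_left sum_distrib_right)
qed

lemma spectral_orth: "spectral n M u d \<Longrightarrow> k < n \<Longrightarrow> l < n \<Longrightarrow> (\<Sum>i<n. cnj (u k i) * u l i) = (if k = l then 1 else 0)"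
  unfolding spectral_def std_inner_def by auto

lemma spectral_fun_mult:
  assumes "spectral n M u d" "i < n" "j < n"
  shows "mat_prod n (spectral_fun n u d G) (spectral_fun n u d H) i j = spectral_fun n u d (\<lambda>x. G x * H x) i j"
proof -
  have in1: "(\<Sum>k<n. spectral_fun n u d G i k * u l k) = of_real (G (d l)) * u l i" if l: "l < n" for l
  proof -
    have "(\<Sum>k<n. spectral_fun n u d G i k * u l k) = (\<Sum>k<n. \<Sum>l'<n. of_real (G (d l')) * u l' i * (cnj (u l' k) * u l k))"
      unfolding spectral_fun_def sum_distrib_right by (intro sum.cong refl) (simp add: mult_ac)
    also have "\<dots> = (\<Sum>l'<n. \<Sum>k<n. of_real (G (d l')) * u l' i * (cnj (u l' k) * u l k))" by (rule sum.swap)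
    also have "\<dots> = (\<Sum>l'<n. of_real (G (d l')) * u l' i * (if l' = l then 1 else 0))"
      using l by (intro sum.cong refl) (simp add: sum_distrib_left[symmetric] spectral_orth[OF assms(1)])
    also have "\<dots> = of_real (G (d l)) * u l i" using l by (simp add: if_distrib cong: if_cong)
    finally show ?thesis .
  qed
  show ?thesis unfolding mat_prod_def spectral_fun_row[OF assms(1)]
    unfolding spectral_fun_def[of _ _ _ "\<lambda>x. G x * H x"]
    by (intro sum.cong refl) (simp add: in1)
qed

section \<open>Operator bounds and Hilbert-Schmidt norms\<close>

definition l2_sq :: "nat \<Rightarrow> (nat \<Rightarrow> complex) \<Rightarrow> real" where
  "l2_sq n x = (\<Sum>k<n. (cmod (x k))\<^sup>2)"

text \<open>The bound concerns the action on row vectors, so that multiplication by \<open>Y\<close>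
  from the right can be estimated row by row in \<open>hs_sq_mat_prod_right\<close>.\<close>

definition op_bound :: "nat \<Rightarrow> (nat \<Rightarrow> nat \<Rightarrow> complex) \<Rightarrow> real \<Rightarrow> bool" where
  "op_bound n Y R \<longleftrightarrow> 0 \<le> R \<and> (\<forall>x. l2_sq n (\<lambda>j. \<Sum>k<n. x k * Y k j) \<le> R\<^sup>2 * l2_sq n x)"

definition hs_sq :: "nat \<Rightarrow> (nat \<Rightarrow> nat \<Rightarrow> complex) \<Rightarrow> real" where
  "hs_sq n Y = (\<Sum>i<n. l2_sq n (Y i))"

lemma l2_sq_orth_sum:
  assumes "spectral n M u d"
  shows "l2_sq n (\<lambda>j. \<Sum>l<n. c l * cnj (u l j)) = l2_sq n c"
proof -
  have "complex_of_real (l2_sq n (\<lambda>j. \<Sum>l<n. c l * cnj (u l j)))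
     = (\<Sum>j<n. (\<Sum>l<n. c l * cnj (u l j)) * cnj (\<Sum>k<n. c k * cnj (u k j)))"
    unfolding l2_sq_def by (simp only: of_real_sum complex_norm_square)
  also have "\<dots> = (\<Sum>j<n. \<Sum>l<n. \<Sum>k<n. c l * cnj (c k) * (cnj (u l j) * u k j))"
    by (simp add: sum_product algebra_simps)
  also have "\<dots> = (\<Sum>l<n. \<Sum>k<n. \<Sum>j<n. c l * cnj (c k) * (cnj (u l j) * u k j))"
    by (subst sum.swap, rule sum.cong[OF refl], rule sum.swap)
  also have "\<dots> = (\<Sum>l<n. \<Sum>k<n. c l * cnj (c k) * (if l = k then 1 else 0))"
    by (intro sum.cong refl) (simp add: sum_distrib_left[symmetric] spectral_orth[OF assms])
  also have "\<dots> = (\<Sum>l<n. c l * cnj (c l))" by (simp add: if_distrib cong: if_cong)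
  also have "\<dots> = complex_of_real (l2_sq n c)"
    unfolding l2_sq_def by (simp only: of_real_sum complex_norm_square)
  finally show ?thesis using of_real_eq_iff by blast
qed

lemma l2_sq_spectral_fun:
  assumes "spectral n M u d"
  shows "l2_sq n (\<lambda>j. \<Sum>k<n. x k * spectral_fun n u d G k j) = (\<Sum>l<n. (G (d l))\<^sup>2 * (cmod (\<Sum>k<n. x k * u l k))\<^sup>2)"
  unfolding spectral_fun_row[OF assms] l2_sq_orth_sum[OF assms, of "\<lambda>l. of_real (G (d l)) * (\<Sum>k<n. x k * u l k)"]
  by (simp add: l2_sq_def norm_mult power_mult_distrib)

lemma parseval:
  assumes "spectral n M u d"
  shows "(\<Sum>l<n. (cmod (\<Sum>k<n. x k * u l k))\<^sup>2) = l2_sq n x"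
proof -
  have "l2_sq n (\<lambda>j. \<Sum>k<n. x k * spectral_fun n u d (\<lambda>x. 1) k j) = l2_sq n x"
    unfolding l2_sq_def[of n x] unfolding l2_sq_def
    by (intro sum.cong refl) (simp add: spectral_fun_one[OF assms] if_distrib cong: if_cong)
  then show ?thesis unfolding l2_sq_spectral_fun[OF assms] by simp
qed

lemma op_bound_spectral_fun:
  assumes "spectral n M u d" "\<And>l. l < n \<Longrightarrow> \<bar>G (d l)\<bar> \<le> R" "0 \<le> R"
  shows "op_bound n (spectral_fun n u d G) R"
  unfolding op_bound_def l2_sq_spectral_fun[OF assms(1)]
proof (intro conjI allI)
  fix x :: "nat \<Rightarrow> complex"
  have "(\<Sum>l<n. (G (d l))\<^sup>2 * (cmod (\<Sum>k<n. x k * u l k))\<^sup>2) \<le> (\<Sum>l<n. R\<^sup>2 * (cmod (\<Sum>k<n. x k * u l k))\<^sup>2)"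
    using assms by (intro sum_mono mult_right_mono) (auto simp: abs_le_square_iff[symmetric])
  then show "(\<Sum>l<n. (G (d l))\<^sup>2 * (cmod (\<Sum>k<n. x k * u l k))\<^sup>2) \<le> R\<^sup>2 * l2_sq n x"
    by (simp add: sum_distrib_left[symmetric] parseval[OF assms(1)])
qed fact

lemma op_bound_cong: "(\<And>i j. i < n \<Longrightarrow> j < n \<Longrightarrow> X i j = Y i j) \<Longrightarrow> op_bound n X R = op_bound n Y R"
  unfolding op_bound_def l2_sq_def by simp

lemma op_bound_eigenvalue:
  assumes "spectral n M u d" "op_bound n M R" "l < n"
  shows "\<bar>d l\<bar> \<le> R"
proof -
  \<comment> \<open>Rows are acted on from the right, so the eigenvector has to be conjugated to
    serve as a test vector.\<close>
  define x where "x k = cnj (u l k)" for k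
  have "l2_sq n (\<lambda>j. \<Sum>k<n. x k * M k j) = l2_sq n (\<lambda>j. \<Sum>k<n. x k * spectral_fun n u d (\<lambda>x. x) k j)"
    unfolding l2_sq_def using spectral_fun_id[OF assms(1)] by simp
  also have "\<dots> = (\<Sum>l'<n. (d l')\<^sup>2 * (cmod (\<Sum>k<n. x k * u l' k))\<^sup>2)" by (rule l2_sq_spectral_fun[OF assms(1)])
  also have "\<dots> = (\<Sum>l'<n. (d l')\<^sup>2 * (if l = l' then 1 else 0))"
    by (intro sum.cong refl) (use assms(3) in \<open>simp add: x_def spectral_orth[OF assms(1)]\<close>)
  also have "\<dots> = (d l)\<^sup>2" using assms(3) by (simp add: if_distrib cong: if_cong)
  finally have 1: "l2_sq n (\<lambda>j. \<Sum>k<n. x k * M k j) = (d l)\<^sup>2" .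
  have "complex_of_real (l2_sq n x) = (\<Sum>k<n. cnj (u l k) * u l k)"
    unfolding l2_sq_def x_def of_real_sum complex_mod_cnj
    by (intro sum.cong refl) (metis complex_norm_square mult.commute)
  also have "\<dots> = of_real 1" using assms(3) by (simp add: spectral_orth[OF assms(1)])
  finally have "l2_sq n x = 1" using of_real_eq_iff by blast
  with 1 assms(2) have "(d l)\<^sup>2 \<le> R\<^sup>2" "0 \<le> R" unfolding op_bound_def by (metis mult.right_neutral)+
  then show ?thesis by (simp add: abs_le_square_iff[symmetric])
qed

lemma hs_sq_cong: "(\<And>i j. i < n \<Longrightarrow> j < n \<Longrightarrow> X i j = Y i j) \<Longrightarrow> hs_sq n X = hs_sq n Y"
  unfolding hs_sq_def l2_sq_def by simp

lemma hs_sq_mat_prod_right: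
  assumes "op_bound n Y R"
  shows "hs_sq n (mat_prod n X Y) \<le> R\<^sup>2 * hs_sq n X"
  unfolding hs_sq_def mat_prod_def sum_distrib_left
  using assms unfolding op_bound_def by (intro sum_mono) blast

lemma hs_sq_adj: "hs_sq n (\<lambda>i j. cnj (X j i)) = hs_sq n X"
  unfolding hs_sq_def l2_sq_def complex_mod_cnj by (rule sum.swap)

text \<open>Adjoints preserve the Hilbert-Schmidt norm and reverse products, which reduces this to
  multiplication from the right.\<close>

lemma hs_sq_mat_prod_left:
  assumes "op_bound n X R" "hermitian n X" "hermitian n Y"
  shows "hs_sq n (mat_prod n X Y) \<le> R\<^sup>2 * hs_sq n Y"
proof -
  have "hs_sq n (mat_prod n X Y) = hs_sq n (\<lambda>i j. cnj (mat_prod n X Y j i))" by (simp add: hs_sq_adj)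
  also have "\<dots> = hs_sq n (mat_prod n Y X)"
    by (rule hs_sq_cong) (auto simp: mat_prod_def hermitianD[OF assms(2)] hermitianD[OF assms(3)] mult.commute intro!: sum.cong)
  finally show ?thesis using hs_sq_mat_prod_right[OF assms(1)] by simp
qed

lemma hs_sq_spectral_fun:
  assumes "spectral n M u d"
  shows "hs_sq n (spectral_fun n u d G) = (\<Sum>l<n. (G (d l))\<^sup>2)"
proof -
  have "l2_sq n (spectral_fun n u d G i) = (\<Sum>l<n. (G (d l))\<^sup>2 * (cmod (u l i))\<^sup>2)" for i
    using l2_sq_orth_sum[OF assms, of "\<lambda>l. of_real (G (d l)) * u l i"]
    by (simp add: spectral_fun_def l2_sq_def norm_mult power_mult_distrib mult.assoc)
  then have "hs_sq n (spectral_fun n u d G) = (\<Sum>i<n. \<Sum>l<n. (G (d l))\<^sup>2 * (cmod (u l i))\<^sup>2)" by (simp add: hs_sq_def)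
  also have "\<dots> = (\<Sum>l<n. (G (d l))\<^sup>2 * (\<Sum>i<n. (cmod (u l i))\<^sup>2))"
    by (subst sum.swap) (simp add: sum_distrib_left)
  also have "\<dots> = (\<Sum>l<n. (G (d l))\<^sup>2)"
  proof (intro sum.cong refl)
    fix l assume "l \<in> {..<n}"
    then have "std_inner n (u l) (u l) = 1" using assms unfolding spectral_def by auto
    then have "(\<Sum>i<n. (cmod (u l i))\<^sup>2) = 1" unfolding std_inner_self using of_real_eq_1_iff by blast
    then show "(G (d l))\<^sup>2 * (\<Sum>i<n. (cmod (u l i))\<^sup>2) = (G (d l))\<^sup>2" by simp
  qed
  finally show ?thesis .
qed

lemma cmod_entry_orth:
  assumes "spectral n M u d" "l < n" "i < n"
  shows "cmod (u l i) \<le> 1"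
proof -
  have "std_inner n (u l) (u l) = 1" using assms unfolding spectral_def by auto
  then have "(\<Sum>i<n. (cmod (u l i))\<^sup>2) = 1" unfolding std_inner_self using of_real_eq_1_iff by blast
  moreover have "(cmod (u l i))\<^sup>2 \<le> (\<Sum>i<n. (cmod (u l i))\<^sup>2)"
    using assms by (intro member_le_sum) auto
  ultimately show ?thesis by (simp add: power_le_one_iff abs_square_le_1)
qed

lemma spectral_fun_diff_bound:
  assumes "spectral n M u d" "\<And>l. l < n \<Longrightarrow> \<bar>G (d l) - H (d l)\<bar> \<le> e" "i < n" "j < n"
  shows "cmod (spectral_fun n u d G i j - spectral_fun n u d H i j) \<le> n * e"
proof -
  have "spectral_fun n u d G i j - spectral_fun n u d H i j = (\<Sum>l<n. of_real (G (d l) - H (d l)) * (u l i * cnj (u l j)))"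
    unfolding spectral_fun_def by (simp add: sum_subtractf[symmetric] algebra_simps)
  also have "cmod \<dots> \<le> (\<Sum>l<n. e)"
  proof (rule sum_norm_le)
    fix l assume "l \<in> {..<n}"
    then have l: "l < n" by simp
    have "cmod (of_real (G (d l) - H (d l)) * (u l i * cnj (u l j))) = \<bar>G (d l) - H (d l)\<bar> * (cmod (u l i) * cmod (u l j))"
      by (simp only: norm_mult norm_of_real complex_mod_cnj)
    also have "\<dots> \<le> e * (1 * 1)"
      using assms(2)[OF l] cmod_entry_orth[OF assms(1) l] assms(3,4) order.trans[OF abs_ge_zero assms(2)[OF l]]
      by (intro mult_mono) auto
    finally show "cmod (of_real (G (d l) - H (d l)) * (u l i * cnj (u l j))) \<le> e" by simp
  qed
  finally show ?thesis by simp
qed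

text \<open>Cauchy-Schwarz in every column. The crude factor \<open>n\<close> costs nothing when
  small errors are concerned: \<open>n\<close> is fixed before the entrywise error is
  chosen.\<close>

lemma op_bound_entries:
  assumes "\<And>i j. i < n \<Longrightarrow> j < n \<Longrightarrow> cmod (M i j) \<le> e" "0 \<le> e"
  shows "op_bound n M (n * e)"
  unfolding op_bound_def
proof (intro conjI allI)
  show "0 \<le> real n * e" using assms by simp
  fix x :: "nat \<Rightarrow> complex"
  have "l2_sq n (\<lambda>j. \<Sum>k<n. x k * M k j) \<le> (\<Sum>j<n. n * e\<^sup>2 * l2_sq n x)"
    unfolding l2_sq_def[of n "\<lambda>j. \<Sum>k<n. x k * M k j"]
  proof (rule sum_mono)
    fix j assume j: "j \<in> {..<n}"
    have "cmod (\<Sum>k<n. x k * M k j) \<le> (\<Sum>k<n. cmod (x k) * e)"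
      using j assms by (intro sum_norm_le) (auto simp: norm_mult intro!: mult_left_mono)
    then have "(cmod (\<Sum>k<n. x k * M k j))\<^sup>2 \<le> (\<Sum>k<n. cmod (x k) * e)\<^sup>2" by (intro power_mono) auto
    also have "\<dots> = (\<Sum>k<n. cmod (x k))\<^sup>2 * e\<^sup>2" by (simp add: sum_distrib_right[symmetric] power_mult_distrib)
    also have "\<dots> \<le> (n * l2_sq n x) * e\<^sup>2"
      using sum_squared_le_sum_of_squares[of "\<lambda>k. cmod (x k)" "{..<n}"] unfolding l2_sq_def
      by (intro mult_right_mono) (auto simp: mult.commute)
    finally show "(cmod (\<Sum>k<n. x k * M k j))\<^sup>2 \<le> n * e\<^sup>2 * l2_sq n x" by (simp add: mult_ac)
  qed
  then show "l2_sq n (\<lambda>j. \<Sum>k<n. x k * M k j) \<le> (n * e)\<^sup>2 * l2_sq n x"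
    by (simp add: power_mult_distrib power2_eq_square mult_ac)
qed

text \<open>A reduced echelon basis of an \<open>r\<close>-dimensional subspace of the span of the
  \<open>u l\<close> with \<open>l \<in> S\<close>, with pivot set \<open>J\<close>. Complete
  pivoting gives entries at most 1 for a new vector, and clearing its pivot from the old ones at
  most doubles theirs, whence \<open>2 ^ r\<close>. A bound depending on \<open>r\<close> alone is
  what later allows the entries to be rounded to finitely many values.\<close>

lemma reduced_kernel_basis:
  assumes sp: "spectral n M u d" and S: "S \<subseteq> {..<n}" "\<And>l. l \<in> S \<Longrightarrow> \<bar>d l\<bar> \<le> e"
    and "r \<le> card S" "0 \<le> e"
  shows "\<exists>J v. J \<subseteq> {..<n} \<and> card J = r \<and>
     (\<forall>a\<in>J. \<forall>b\<in>J. v a b = (if a = b then 1 else 0)) \<and>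
     (\<forall>a\<in>J. \<forall>i<n. cmod (v a i) \<le> 2 ^ r) \<and>
     (\<forall>a\<in>J. \<exists>c. \<forall>i<n. v a i = (\<Sum>l\<in>S. c l * u l i))"
  using assms(4)
proof (induction r)
  case 0
  show ?case by (rule exI[of _ "{}"]) auto
next
  case (Suc r)
  then obtain J v where J: "J \<subseteq> {..<n}" "card J = r"
    and vJ: "\<forall>a\<in>J. \<forall>b\<in>J. v a b = (if a = b then 1 else 0)"
    and vb: "\<forall>a\<in>J. \<forall>i<n. cmod (v a i) \<le> 2 ^ r"
    and vS: "\<forall>a\<in>J. \<exists>c. \<forall>i<n. v a i = (\<Sum>l\<in>S. c l * u l i)" by auto
  have fin: "finite J" "finite S" using J S finite_subset by blast+
  \<comment> \<open>Vanishing on \<open>J\<close> imposes \<open>r\<close> conditions on at least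
    \<open>r + 1\<close> coefficients.\<close>
  obtain x where x: "\<exists>k\<in>S. x k \<noteq> 0" "\<forall>i\<in>J. (\<Sum>k\<in>S. u k i * x k) = 0"
    using homogeneous_system[OF fin, of "\<lambda>i k. u k i"] J Suc by auto
  define w0 where "w0 i = (\<Sum>k\<in>S. x k * u k i)" for i
  have w0J: "w0 i = 0" if "i \<in> J" for i using x that by (simp add: w0_def mult.commute)
  have "\<exists>i<n. w0 i \<noteq> 0"
  proof (rule ccontr)
    assume no: "\<not> ?thesis"
    obtain k where k: "k \<in> S" "x k \<noteq> 0" using x by auto
    have "std_inner n (u k) w0 = (\<Sum>i<n. \<Sum>l\<in>S. x l * (cnj (u k i) * u l i))"
      unfolding std_inner_def w0_def by (simp add: sum_distrib_left mult.left_commute)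
    also have "\<dots> = (\<Sum>l\<in>S. x l * (\<Sum>i<n. cnj (u k i) * u l i))"
      by (subst sum.swap) (simp add: sum_distrib_left)
    also have "\<dots> = (\<Sum>l\<in>S. x l * (if k = l then 1 else 0))"
      using S k by (intro sum.cong refl) (simp add: subset_iff spectral_orth[OF sp])
    also have "\<dots> = x k" using k fin by (simp add: if_distrib cong: if_cong)
    finally show False using k no by (simp add: std_inner_def)
  qed
  then obtain i0 where i0: "i0 < n" "w0 i0 \<noteq> 0" by auto
  \<comment> \<open>The new pivot is the position of a largest entry, so that dividing by it leaves
    all entries bounded by 1.\<close>
  have "Max ((\<lambda>i. cmod (w0 i)) ` {..<n}) \<in> (\<lambda>i. cmod (w0 i)) ` {..<n}"
    using i0 by (intro Max_in) auto
  then obtain j where jn: "j < n" and "cmod (w0 j) = Max ((\<lambda>i. cmod (w0 i)) ` {..<n})" by auto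
  then have jmax: "\<And>i. i < n \<Longrightarrow> cmod (w0 i) \<le> cmod (w0 j)" by simp
  have wj: "w0 j \<noteq> 0" using jmax[OF i0(1)] i0 by auto
  then have jJ: "j \<notin> J" using w0J by auto
  define w where "w i = w0 i / w0 j" for i
  have w: "w j = 1" "\<And>i. i \<in> J \<Longrightarrow> w i = 0" "\<And>i. i < n \<Longrightarrow> cmod (w i) \<le> 1"
    using wj w0J jmax by (auto simp: w_def norm_divide)
  have wS: "\<forall>i<n. w i = (\<Sum>l\<in>S. (x l / w0 j) * u l i)"
    unfolding w_def w0_def[of i for i] by (simp add: sum_divide_distrib)
  define v' where "v' a = (if a = j then w else (\<lambda>i. v a i - v a j * w i))" for a
  show ?case
  proof (intro exI[of _ "insert j J"] exI[of _ v'] conjI)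
    show "insert j J \<subseteq> {..<n}" using J jn by auto
    show "card (insert j J) = Suc r" using J fin jJ by simp
    show "\<forall>a\<in>insert j J. \<forall>b\<in>insert j J. v' a b = (if a = b then 1 else 0)"
      using vJ w jJ by (auto simp: v'_def)
    show "\<forall>a\<in>insert j J. \<forall>i<n. cmod (v' a i) \<le> 2 ^ Suc r"
    proof (intro ballI allI impI)
      fix a i assume a: "a \<in> insert j J" and i: "i < n"
      show "cmod (v' a i) \<le> 2 ^ Suc r"
      proof (cases "a = j")
        case True
        then have "cmod (v' a i) \<le> 1" using w i by (simp add: v'_def)
        also have "(1::real) \<le> 2 ^ Suc r" by (rule one_le_power) simp
        finally show ?thesis .
      next
        case False
        then have aJ: "a \<in> J" using a by auto
        have "cmod (v' a i) \<le> cmod (v a i) + cmod (v a j) * cmod (w i)"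
          using False norm_triangle_ineq4[of "v a i" "v a j * w i"] by (simp add: v'_def norm_mult)
        also have "\<dots> \<le> 2 ^ r + 2 ^ r * 1"
          using vb aJ i jn w(3)[OF i] by (intro add_mono mult_mono) auto
        finally show ?thesis by simp
      qed
    qed
    show "\<forall>a\<in>insert j J. \<exists>c. \<forall>i<n. v' a i = (\<Sum>l\<in>S. c l * u l i)"
    proof
      fix a assume a: "a \<in> insert j J"
      show "\<exists>c. \<forall>i<n. v' a i = (\<Sum>l\<in>S. c l * u l i)"
      proof (cases "a = j")
        case True
        then have "v' a = w" by (simp add: v'_def)
        then show ?thesis using wS by (intro exI[of _ "\<lambda>l. x l / w0 j"]) (simp only:)
      next
        case False
        then obtain c where c: "\<forall>i<n. v a i = (\<Sum>l\<in>S. c l * u l i)" using a vS by auto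
        have "v' a i = (\<Sum>l\<in>S. (c l - v a j * (x l / w0 j)) * u l i)" if i: "i < n" for i
        proof -
          have "v' a i = (\<Sum>l\<in>S. c l * u l i) - v a j * (\<Sum>l\<in>S. x l / w0 j * u l i)"
            unfolding v'_def if_not_P[OF False] c[rule_format, OF i] wS[rule_format, OF i] ..
          also have "\<dots> = (\<Sum>l\<in>S. (c l - v a j * (x l / w0 j)) * u l i)"
            unfolding sum_distrib_left sum_subtractf[symmetric] left_diff_distrib mult.assoc ..
          finally show ?thesis .
        qed
        then show ?thesis by (intro exI[of _ "\<lambda>l. c l - v a j * (x l / w0 j)"] allI impI)
      qed
    qed
  qed
qed

text \<open>The reduced basis vectors \<open>v a\<close> lie in the span of the eigenvectors with
  small eigenvalue, so \<open>M\<close> almost annihilates them. As \<open>v a\<close> is the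
  identity on \<open>J\<close>, this says that column \<open>a\<close> is nearly a combination, with
  bounded coefficients \<open>x\<close>, of the columns outside \<open>J\<close>.\<close>

lemma small_eigenvalues_columns:
  assumes sp: "spectral n M u d" and r: "r \<le> card {l. l < n \<and> \<bar>d l\<bar> \<le> e}" and "0 \<le> e"
  shows "\<exists>J x. J \<subseteq> {..<n} \<and> card J = r \<and>
     (\<forall>a\<in>J. \<forall>i\<in>{..<n} - J. cmod (x i a) \<le> 2 ^ r) \<and>
     (\<forall>a\<in>J. \<forall>i<n. cmod (M i a + (\<Sum>k\<in>{..<n} - J. M i k * x k a)) \<le> e * (n * 2 ^ r))"
proof -
  let ?S = "{l. l < n \<and> \<bar>d l\<bar> \<le> e}"
  obtain J v where J: "J \<subseteq> {..<n}" "card J = r"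
    and vJ: "\<forall>a\<in>J. \<forall>b\<in>J. v a b = (if a = b then 1 else 0)"
    and vb: "\<forall>a\<in>J. \<forall>i<n. cmod (v a i) \<le> 2 ^ r"
    and vS: "\<forall>a\<in>J. \<exists>c. \<forall>i<n. v a i = (\<Sum>l\<in>?S. c l * u l i)"
  proof -
    have "\<exists>J v. J \<subseteq> {..<n} \<and> card J = r \<and>
       (\<forall>a\<in>J. \<forall>b\<in>J. v a b = (if a = b then 1 else 0)) \<and>
       (\<forall>a\<in>J. \<forall>i<n. cmod (v a i) \<le> 2 ^ r) \<and>
       (\<forall>a\<in>J. \<exists>c. \<forall>i<n. v a i = (\<Sum>l\<in>?S. c l * u l i))"
      by (rule reduced_kernel_basis[OF sp _ _ r \<open>0 \<le> e\<close>]) auto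
    then show thesis by (elim exE conjE) (rule that)
  qed
  show ?thesis
  proof (intro exI[of _ J] exI[of _ "\<lambda>i a. v a i"] conjI ballI allI impI)
    fix a i assume a: "a \<in> J" and i: "i < n"
    have an: "a < n" using a J by auto
    obtain c where c: "\<forall>i<n. v a i = (\<Sum>l\<in>?S. c l * u l i)" using a vS by auto
    have fin: "finite J" using J finite_subset by blast
    have "(\<Sum>k<n. M i k * v a k) = (\<Sum>k\<in>J. M i k * v a k) + (\<Sum>k\<in>{..<n} - J. M i k * v a k)"
      using J by (metis add.commute finite_lessThan sum.subset_diff)
    also have "(\<Sum>k\<in>J. M i k * v a k) = (\<Sum>k\<in>J. M i k * (if a = k then 1 else 0))"
      using vJ a by (intro sum.cong refl) auto
    also have "\<dots> = M i a" using a fin by (simp add: if_distrib cong: if_cong)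
    finally have 1: "M i a + (\<Sum>k\<in>{..<n} - J. M i k * v a k) = (\<Sum>k<n. M i k * v a k)" by simp
    define f where "f j = (\<Sum>k<n. M j k * v a k)" for j
    have fS: "f j = (\<Sum>l\<in>?S. of_real (d l) * c l * u l j)" if "j < n" for j
    proof -
      have "f j = (\<Sum>k<n. \<Sum>l\<in>?S. c l * (M j k * u l k))"
        unfolding f_def using c by (simp add: sum_distrib_left mult.left_commute)
      also have "\<dots> = (\<Sum>l\<in>?S. c l * mat_app n M (u l) j)"
        using that by (subst sum.swap) (simp add: mat_app_def sum_distrib_left)
      also have "\<dots> = (\<Sum>l\<in>?S. of_real (d l) * c l * u l j)"
        using sp that unfolding spectral_def by (intro sum.cong refl) auto
      finally show ?thesis .
    qed
    \<comment> \<open>\<open>l2_sq_orth_sum\<close> speaks of the conjugated basis and of sums over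
      all indices, hence the conjugated coefficients extended by 0.\<close>
    have nsqS: "l2_sq n (\<lambda>j. \<Sum>l\<in>?S. b l * u l j) = (\<Sum>l\<in>?S. (cmod (b l))\<^sup>2)" for b
    proof -
      have "l2_sq n (\<lambda>j. \<Sum>l\<in>?S. b l * u l j) = l2_sq n (\<lambda>j. \<Sum>l<n. (if l \<in> ?S then cnj (b l) else 0) * cnj (u l j))"
        unfolding l2_sq_def
      proof (intro sum.cong refl)
        fix j
        have "(\<Sum>l<n. (if l \<in> ?S then cnj (b l) else 0) * cnj (u l j)) = (\<Sum>l\<in>?S. cnj (b l) * cnj (u l j))"
          by (rule sum.mono_neutral_cong_right) auto
        also have "\<dots> = cnj (\<Sum>l\<in>?S. b l * u l j)" by simp
        finally show "(cmod (\<Sum>l\<in>?S. b l * u l j))\<^sup>2 = (cmod (\<Sum>l<n. (if l \<in> ?S then cnj (b l) else 0) * cnj (u l j)))\<^sup>2"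
          by (simp only: complex_mod_cnj)
      qed
      also have "\<dots> = l2_sq n (\<lambda>l. if l \<in> ?S then cnj (b l) else 0)" by (rule l2_sq_orth_sum[OF sp])
      also have "\<dots> = (\<Sum>l\<in>?S. (cmod (b l))\<^sup>2)"
        unfolding l2_sq_def by (rule sum.mono_neutral_cong_right) auto
      finally show ?thesis .
    qed
    have "l2_sq n f = (\<Sum>l\<in>?S. (cmod (of_real (d l) * c l))\<^sup>2)"
      unfolding nsqS[symmetric] using fS by (simp add: l2_sq_def)
    also have "\<dots> \<le> (\<Sum>l\<in>?S. e\<^sup>2 * (cmod (c l))\<^sup>2)"
      using \<open>0 \<le> e\<close> by (intro sum_mono) (auto simp: norm_mult power_mult_distrib abs_le_square_iff[symmetric] intro!: mult_right_mono)
    also have "\<dots> = e\<^sup>2 * l2_sq n (v a)"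
      unfolding sum_distrib_left[symmetric] nsqS[symmetric] using c by (simp add: l2_sq_def)
    also have "\<dots> \<le> e\<^sup>2 * (\<Sum>k<n. (2 ^ r)\<^sup>2)"
      unfolding l2_sq_def using vb a by (intro mult_left_mono sum_mono power_mono) auto
    also have "(\<Sum>k<n. (2 ^ r)\<^sup>2) = real n * (2 ^ r)\<^sup>2" by simp
    also have "e\<^sup>2 * (real n * (2 ^ r)\<^sup>2) \<le> e\<^sup>2 * ((real n)\<^sup>2 * (2 ^ r)\<^sup>2)"
    proof (intro mult_left_mono mult_right_mono)
      have "n \<le> n\<^sup>2" by (simp add: power2_eq_square)
      then show "real n \<le> (real n)\<^sup>2" by (metis of_nat_le_iff of_nat_power)
    qed auto
    also have "\<dots> = e\<^sup>2 * (n * 2 ^ r)\<^sup>2" by (simp add: power_mult_distrib)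
    finally have "l2_sq n f \<le> (e * (n * 2 ^ r))\<^sup>2" by (simp add: power_mult_distrib)
    moreover have "(cmod (f i))\<^sup>2 \<le> l2_sq n f" unfolding l2_sq_def using i by (intro member_le_sum) auto
    ultimately have "(cmod (f i))\<^sup>2 \<le> (e * (n * 2 ^ r))\<^sup>2" by simp
    then have "cmod (f i) \<le> e * (n * 2 ^ r)"
      using \<open>0 \<le> e\<close> by (subst (asm) abs_le_square_iff[symmetric]) auto
    then show "cmod (M i a + (\<Sum>k\<in>{..<n} - J. M i k * v a k)) \<le> e * (n * 2 ^ r)"
      unfolding 1 f_def .
  qed (use J vb in auto)
qed

section \<open>Hermitian matrices in general position\<close>

text \<open>Subtract the two approximate column relations: the difference of the entries at
  \<open>(i, a)\<close> is then controlled by the differences of the entries in row \<open>i\<close>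
  over \<open>K\<close> and of the coefficients.\<close>

lemma column_step:
  fixes M M' :: "nat \<Rightarrow> nat \<Rightarrow> complex" and x x' :: "nat \<Rightarrow> nat \<Rightarrow> complex"
  assumes K: "finite K" "card K \<le> n" and pos: "0 \<le> c" "0 \<le> B" "0 \<le> R" "0 \<le> \<delta>"
    and R: "\<And>k. k \<in> K \<Longrightarrow> cmod (M' i k) \<le> R"
    and x: "\<And>k. k \<in> K \<Longrightarrow> cmod (x k a) \<le> B"
    and xx: "\<And>k. k \<in> K \<Longrightarrow> cmod (x k a - x' k a) \<le> 2 * \<delta>"
    and MM: "\<And>k. k \<in> K \<Longrightarrow> cmod (M i k - M' i k) \<le> c * \<delta>"
    and m: "cmod (M i a + (\<Sum>k\<in>K. M i k * x k a)) \<le> \<delta>"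
    and m': "cmod (M' i a + (\<Sum>k\<in>K. M' i k * x' k a)) \<le> \<delta>"
  shows "cmod (M i a - M' i a) \<le> (2 + n * (c * B + 2 * R)) * \<delta>"
proof -
  have eq: "M i a - M' i a = (M i a + (\<Sum>k\<in>K. M i k * x k a)) - (M' i a + (\<Sum>k\<in>K. M' i k * x' k a))
      - (\<Sum>k\<in>K. (M i k - M' i k) * x k a + M' i k * (x k a - x' k a))"
    by (simp add: left_diff_distrib right_diff_distrib sum_subtractf sum.distrib)
  have "cmod (\<Sum>k\<in>K. (M i k - M' i k) * x k a + M' i k * (x k a - x' k a)) \<le> (\<Sum>k\<in>K. (c * \<delta>) * B + R * (2 * \<delta>))"
  proof (rule sum_norm_le)
    fix k assume k: "k \<in> K"
    have "cmod ((M i k - M' i k) * x k a + M' i k * (x k a - x' k a))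
      \<le> cmod (M i k - M' i k) * cmod (x k a) + cmod (M' i k) * cmod (x k a - x' k a)"
      by (metis norm_mult norm_triangle_ineq)
    also have "\<dots> \<le> (c * \<delta>) * B + R * (2 * \<delta>)"
      using MM[OF k] x[OF k] R[OF k] xx[OF k] pos by (intro add_mono mult_mono) auto
    finally show "cmod ((M i k - M' i k) * x k a + M' i k * (x k a - x' k a)) \<le> (c * \<delta>) * B + R * (2 * \<delta>)" .
  qed
  also have "\<dots> = card K * ((c * \<delta>) * B + R * (2 * \<delta>))" by simp
  also have "\<dots> \<le> n * ((c * \<delta>) * B + R * (2 * \<delta>))" using K pos by (intro mult_right_mono) auto
  finally have 3: "cmod (\<Sum>k\<in>K. (M i k - M' i k) * x k a + M' i k * (x k a - x' k a)) \<le> n * ((c * \<delta>) * B + R * (2 * \<delta>))" .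
  have "cmod (M i a - M' i a) \<le> \<delta> + \<delta> + n * ((c * \<delta>) * B + R * (2 * \<delta>))"
    unfolding eq by (rule order.trans[OF norm_triangle_ineq4 add_mono[OF order.trans[OF norm_triangle_ineq4 add_mono[OF m m']] 3]])
  also have "\<dots> = (2 + n * (c * B + 2 * R)) * \<delta>" by (simp add: algebra_simps)
  finally show ?thesis .
qed

text \<open>The block outside \<open>J\<close> is given. One column step yields the entries with row
  outside \<open>J\<close> and column in \<open>J\<close>, Hermitian symmetry yields their
  transposes, and a second column step yields the block on \<open>J\<close>. The free data are that
  block of \<open>(n - r)\<^sup>2\<close> real parameters and \<open>(n - r) r\<close> complex
  coefficients, which is \<open>r\<^sup>2\<close> real parameters fewer than a Hermitian matrix
  has.\<close>

lemma columns_determine: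
  fixes M M' :: "nat \<Rightarrow> nat \<Rightarrow> complex" and x x' :: "nat \<Rightarrow> nat \<Rightarrow> complex"
  assumes h: "hermitian n M" "hermitian n M'" and J: "J \<subseteq> {..<n}"
    and pos: "0 \<le> c" "0 \<le> B" "0 \<le> R" "0 \<le> \<delta>"
    and R: "\<And>i k. i < n \<Longrightarrow> k < n \<Longrightarrow> cmod (M' i k) \<le> R"
    and x: "\<And>a k. a \<in> J \<Longrightarrow> k \<in> {..<n} - J \<Longrightarrow> cmod (x k a) \<le> B"
    and xx: "\<And>a k. a \<in> J \<Longrightarrow> k \<in> {..<n} - J \<Longrightarrow> cmod (x k a - x' k a) \<le> 2 * \<delta>"
    and MM: "\<And>i k. i \<in> {..<n} - J \<Longrightarrow> k \<in> {..<n} - J \<Longrightarrow> cmod (M i k - M' i k) \<le> c * \<delta>"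
    and m: "\<And>a i. a \<in> J \<Longrightarrow> i < n \<Longrightarrow> cmod (M i a + (\<Sum>k\<in>{..<n} - J. M i k * x k a)) \<le> \<delta>"
    and m': "\<And>a i. a \<in> J \<Longrightarrow> i < n \<Longrightarrow> cmod (M' i a + (\<Sum>k\<in>{..<n} - J. M' i k * x' k a)) \<le> \<delta>"
    and ij: "i < n" "j < n"
  shows "cmod (M i j - M' i j) \<le> (c + (2 + n * (c * B + 2 * R)) + (2 + n * ((2 + n * (c * B + 2 * R)) * B + 2 * R))) * \<delta>"
proof -
  let ?K = "{..<n} - J"
  let ?c1 = "2 + n * (c * B + 2 * R)"
  let ?c2 = "2 + n * (?c1 * B + 2 * R)"
  have K: "finite ?K" "card ?K \<le> n"
    using card_mono[of "{..<n}" ?K] by auto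
  have c1: "0 \<le> ?c1" using pos by auto
  have c2: "0 \<le> ?c2" using pos c1 by (intro add_nonneg_nonneg mult_nonneg_nonneg) auto
  have s1: "cmod (M i a - M' i a) \<le> ?c1 * \<delta>" if "i \<in> ?K" "a \<in> J" for i a
    by (rule column_step[OF K pos R x xx MM m m']) (use that in auto)
  have s1': "cmod (M a i - M' a i) \<le> ?c1 * \<delta>" if "i \<in> ?K" "a \<in> J" for i a
  proof -
    have "M a i - M' a i = cnj (M i a - M' i a)"
      using hermitianD[OF h(1), of i a] hermitianD[OF h(2), of i a] that J by auto
    then show ?thesis using s1[OF that] by (simp only: complex_mod_cnj)
  qed
  have s2: "cmod (M b a - M' b a) \<le> ?c2 * \<delta>" if "b \<in> J" "a \<in> J" for a b
    by (rule column_step[OF K c1 pos(2-4) R x xx s1' m m']) (use that J in auto)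
  have a: "c * \<delta> \<le> (c + ?c1 + ?c2) * \<delta>" "?c1 * \<delta> \<le> (c + ?c1 + ?c2) * \<delta>" "?c2 * \<delta> \<le> (c + ?c1 + ?c2) * \<delta>"
    using pos c1 c2 by (intro mult_right_mono; linarith)+
  show ?thesis
    using MM[of i j] s1[of i j] s1'[of j i] s2[of i j] a ij by (cases "i \<in> J"; cases "j \<in> J") (auto intro: order.trans)
qed

text \<open>An entry above the diagonal has real part \<open>p (i, j)\<close> and imaginary part \<open>p (j, i)\<close>, so Hermitian
  matrices are parametrized by \<open>n\<^sup>2\<close> independent integers.\<close>

definition grid_matrix :: "real \<Rightarrow> (nat \<times> nat \<Rightarrow> nat) \<Rightarrow> nat \<Rightarrow> nat \<Rightarrow> complex" where
  "grid_matrix h p i j = of_real h *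
     (if i = j then of_nat (p (i, i)) else if i < j then Complex (p (i, j)) (p (j, i))
      else Complex (p (j, i)) (- real (p (i, j))))"

lemma grid_matrix_hermitian: "hermitian n (grid_matrix h p)"
  unfolding hermitian_def grid_matrix_def by (auto simp: complex_eq_iff)

lemma grid_matrix_bound:
  assumes "0 \<le> h" "\<And>i j. i < n \<Longrightarrow> j < n \<Longrightarrow> real (p (i, j)) \<le> L" "i < n" "j < n"
  shows "cmod (grid_matrix h p i j) \<le> 2 * h * L"
proof -
  have b: "real (p (i, j)) \<le> L" "real (p (j, i)) \<le> L" "real (p (i, i)) \<le> L" using assms by auto
  have "cmod (if i = j then of_nat (p (i, i)) else if i < j then Complex (p (i, j)) (p (j, i))
      else Complex (p (j, i)) (- real (p (i, j)))) \<le> 2 * L"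
    using b cmod_le[of "Complex (p (i, j)) (p (j, i))"] cmod_le[of "Complex (p (j, i)) (- real (p (i, j)))"]
    by auto
  then have "h * cmod (if i = j then of_nat (p (i, i)) else if i < j then Complex (p (i, j)) (p (j, i))
      else Complex (p (j, i)) (- real (p (i, j)))) \<le> h * (2 * L)" using assms(1) by (rule mult_left_mono)
  then show ?thesis unfolding grid_matrix_def using assms(1) by (simp add: norm_mult mult_ac)
qed

lemma grid_matrix_diff:
  assumes "0 < h" "cmod (grid_matrix h p i j - grid_matrix h q i j) \<le> h * D"
    "cmod (grid_matrix h p j i - grid_matrix h q j i) \<le> h * D"
  shows "\<bar>real (p (i, j)) - real (q (i, j))\<bar> \<le> D"
proof -
  let ?g = "\<lambda>p i j. (if i = j then of_nat (p (i, i)) else if i < j then Complex (p (i, j)) (p (j, i))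
      else Complex (p (j, i)) (- real (p (i, j))))"
  have "cmod (?g p i j - ?g q i j) \<le> D"
  proof -
    have "h * cmod (?g p i j - ?g q i j) \<le> h * D"
      using assms(1,2) unfolding grid_matrix_def right_diff_distrib[symmetric] norm_mult by simp
    then show ?thesis using assms(1) by simp
  qed
  moreover have "\<bar>real (p (i, j)) - real (q (i, j))\<bar> \<le> cmod (?g p i j - ?g q i j)"
  proof -
    consider "i = j" | "i < j" | "j < i" by linarith
    then show ?thesis
    proof cases
      case 1
      then show ?thesis using abs_Re_le_cmod[of "?g p i j - ?g q i j"] by simp
    next
      case 2
      then show ?thesis using abs_Re_le_cmod[of "?g p i j - ?g q i j"] by simp
    next
      case 3
      then show ?thesis using abs_Im_le_cmod[of "?g p i j - ?g q i j"] by simp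
    qed
  qed
  ultimately show ?thesis by linarith
qed

lemma floor_eq_diff:
  fixes a b L :: real
  assumes "\<lfloor>L * a\<rfloor> = \<lfloor>L * b\<rfloor>" "0 < L"
  shows "\<bar>a - b\<bar> \<le> 1 / L"
proof -
  have "\<bar>L * a - L * b\<bar> \<le> 1" using assms(1) by linarith
  then have "L * \<bar>a - b\<bar> \<le> 1" using assms(2) by (simp add: abs_mult right_diff_distrib[symmetric])
  then show ?thesis using assms(2) by (simp add: field_simps)
qed

text \<open>Counting: if every \<open>P\<close> on a grid of \<open>L\<^bsup>n * n\<^esup>\<close> Hermitian matrices were bad, the rounded coefficients
  \<open>t\<close>, the rounded \<open>x\<close> and the block of \<open>P\<close> outside \<open>J\<close> would determine \<open>P\<close> up to bounded ambiguity, but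
  only about \<open>L\<^bsup>k + 2 * (n - r) * r + (n - r) * (n - r)\<^esup>\<close> such codes exist, and the exponent is
  \<open>k + n\<^sup>2 - r\<^sup>2 < n\<^sup>2\<close>.\<close>

lemma generic_shift_columns:
  fixes F :: "'f \<Rightarrow> nat \<Rightarrow> nat \<Rightarrow> complex"
  assumes S0: "finite S0" "\<forall>s\<in>S0. hermitian n (F s)" and r: "r \<le> n" "k < r\<^sup>2" and "0 < \<epsilon>" "0 \<le> B"
  shows "\<exists>P \<eta>. hermitian n P \<and> (\<forall>i<n. \<forall>j<n. cmod (P i j) \<le> \<epsilon>) \<and> 0 < \<eta> \<and>
    (\<forall>\<tau> t J x. (\<forall>l<k. \<tau> l \<in> S0) \<longrightarrow> (\<forall>l<k. 0 \<le> t l \<and> t l \<le> 1) \<longrightarrow> J \<subseteq> {..<n} \<longrightarrow> card J = r \<longrightarrow>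
       (\<forall>a\<in>J. \<forall>i\<in>{..<n} - J. cmod (x i a) \<le> B) \<longrightarrow>
       \<not> (\<forall>a\<in>J. \<forall>i<n. cmod (((\<Sum>l<k. of_real (t l) * F (\<tau> l) i a) + P i a) +
             (\<Sum>m\<in>{..<n} - J. ((\<Sum>l<k. of_real (t l) * F (\<tau> l) i m) + P i m) * x m a)) \<le> \<eta>))"
proof (rule ccontr)
  let ?Goal = ?thesis
  assume neg: "\<not> ?Goal"
  define R where "R = (\<Sum>s\<in>S0. \<Sum>i<n. \<Sum>j<n. cmod (F s i j))"
  have R0: "0 \<le> R" unfolding R_def by (intro sum_nonneg) auto
  have FR: "cmod (F s i j) \<le> R" if "s \<in> S0" "i < n" "j < n" for s i j
  proof -
    have "cmod (F s i j) \<le> (\<Sum>j<n. cmod (F s i j))" using that by (intro member_le_sum) auto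
    also have "\<dots> \<le> (\<Sum>i<n. \<Sum>j<n. cmod (F s i j))"
      using that by (intro member_le_sum[of i _ "\<lambda>i. \<Sum>j<n. cmod (F s i j)"] sum_nonneg) auto
    also have "\<dots> \<le> R" unfolding R_def
      using that S0 by (intro member_le_sum[of s _ "\<lambda>s. \<Sum>i<n. \<Sum>j<n. cmod (F s i j)"] sum_nonneg) auto
    finally show ?thesis .
  qed
  \<comment> \<open>\<open>c * \<delta>\<close> bounds the change of an entry of the combination of
    the \<open>F s\<close> when every coefficient moves by at most \<open>\<delta>\<close>, and
    \<open>R1\<close> bounds the entries of the shifted combination.\<close>
  define c where "c = k * R"
  define R1 where "R1 = k * R + \<epsilon>"
  \<comment> \<open>\<open>C - c\<close> is the constant of \<open>columns_determine\<close>. The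
    last \<open>c\<close> pays for passing from the shifted combinations back to the shifts.\<close>
  define C where "C = c + (2 + n * (c * B + 2 * R1)) + (2 + n * ((2 + n * (c * B + 2 * R1)) * B + 2 * R1)) + c"
  have c0: "0 \<le> c" and R10: "0 \<le> R1" using R0 \<open>0 < \<epsilon>\<close> by (auto simp: c_def R1_def)
  \<comment> \<open>Shifts with the same code will differ by at most
    \<open>C * \<delta> = h * (2 * C / \<epsilon>)\<close>, hence by at most \<open>D\<close> grid
    steps. The mesh \<open>h\<close> and the rounding error \<open>\<delta>\<close> are both
    proportional to \<open>1 / L\<close>, so \<open>D\<close> does not depend on
    \<open>L\<close>.\<close>
  define D where "D = nat \<lceil>2 * C / \<epsilon>\<rceil>"
  have DC: "2 * C / \<epsilon> \<le> D" unfolding D_def by linarith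
  define Bn where "Bn = nat \<lceil>B\<rceil>"
  have BBn: "B \<le> Bn" unfolding Bn_def by linarith
  define s where "s = card S0"
  \<comment> \<open>\<open>K\<close> collects the factors in the number of codes that are
    independent of \<open>L\<close>: the choices of \<open>J\<close> and \<open>\<tau>\<close>, the
    constants lost in rounding, and the residues modulo \<open>D + 1\<close>. Taking
    \<open>L = K + 1\<close> then contradicts the count.\<close>
  define K where "K = 2 ^ n * (s ^ k * (2 ^ k * ((2 * Bn + 1) ^ (2 * ((n - r) * r)) * Suc D ^ (n * n))))"
  define L where "L = Suc K"
  \<comment> \<open>With this mesh \<open>grid_matrix_bound\<close> gives entries of size at most
    \<open>2 * h * L = \<epsilon>\<close>.\<close>
  define h where "h = \<epsilon> / (2 * L)"
  define \<delta> where "\<delta> = 1 / real L"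
  have L0: "0 < real L" and h0: "0 < h" and \<delta>0: "0 < \<delta>" using \<open>0 < \<epsilon>\<close> by (auto simp: L_def h_def \<delta>_def)
  define I where "I = {..<n} \<times> {..<n}"
  define grid where "grid = I \<rightarrow>\<^sub>E {..<L}"
  define M where "M \<tau> t p i j = (\<Sum>l<k. complex_of_real (t l) * F (\<tau> l) i j) + grid_matrix h p i j" for \<tau> t p i j
  define bad where "bad p \<tau> t J x \<longleftrightarrow> (\<forall>l<k. \<tau> l \<in> S0) \<and> (\<forall>l<k. 0 \<le> t l \<and> t l \<le> 1) \<and> J \<subseteq> {..<n} \<and> card J = r \<and>
       (\<forall>a\<in>J. \<forall>i\<in>{..<n} - J. cmod (x i a) \<le> B) \<and>
       (\<forall>a\<in>J. \<forall>i<n. cmod (M \<tau> t p i a + (\<Sum>m\<in>{..<n} - J. M \<tau> t p i m * x m a)) \<le> \<delta>)" for p \<tau> t J x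
  have gb: "cmod (grid_matrix h p i j) \<le> \<epsilon>" if "p \<in> grid" "i < n" "j < n" for p i j
  proof -
    have pL: "real (p (i, j)) \<le> L" if "i < n" "j < n" for i j
    proof -
      have "p (i, j) \<in> {..<L}" using \<open>p \<in> grid\<close> that unfolding grid_def I_def by (auto simp: PiE_iff)
      then show ?thesis by simp
    qed
    have "cmod (grid_matrix h p i j) \<le> 2 * h * L"
      using that h0 by (intro grid_matrix_bound pL) auto
    also have "\<dots> = \<epsilon>" using L0 by (simp add: h_def)
    finally show ?thesis .
  qed
  have "\<exists>\<tau> t J x. bad p \<tau> t J x" if p: "p \<in> grid" for p
  proof (rule ccontr)
    assume nb: "\<nexists>\<tau> t J x. bad p \<tau> t J x"
    have ?Goal
    proof (rule exI[of _ "grid_matrix h p"], rule exI[of _ \<delta>], intro conjI)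
      show "hermitian n (grid_matrix h p)" by (rule grid_matrix_hermitian)
      show "\<forall>i<n. \<forall>j<n. cmod (grid_matrix h p i j) \<le> \<epsilon>" using gb[OF p] by blast
      show "0 < \<delta>" by (rule \<delta>0)
    qed (intro allI impI notI, rule notE[OF nb], unfold bad_def M_def, intro exI conjI, assumption+)
    with neg show False by contradiction
  qed
  then have "\<forall>p. \<exists>\<tau> t J x. p \<in> grid \<longrightarrow> bad p \<tau> t J x" by blast
  then have "\<exists>\<tau> t J x. \<forall>p. p \<in> grid \<longrightarrow> bad p (\<tau> p) (t p) (J p) (x p)"
    unfolding choice_iff .
  then obtain \<tau> t J x where bad: "\<And>p. p \<in> grid \<Longrightarrow> bad p (\<tau> p) (t p) (J p) (x p)"
    by blast
  \<comment> \<open>The first five components determine every entry of \<open>p\<close> up to an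
    error of \<open>D\<close>; the residues modulo \<open>D + 1\<close> remove this
    ambiguity.\<close>
  define code where "code p = (J p, restrict (\<tau> p) {..<k}, restrict (\<lambda>l. \<lfloor>real L * t p l\<rfloor>) {..<k},
     restrict (\<lambda>(i, a). (\<lfloor>real L * Re (x p i a)\<rfloor>, \<lfloor>real L * Im (x p i a)\<rfloor>)) (({..<n} - J p) \<times> J p),
     restrict p (({..<n} - J p) \<times> ({..<n} - J p)),
     restrict (\<lambda>ij. p ij mod Suc D) I)" for p
  define XI where "XI = {- int (Bn * L)..int (Bn * L)} \<times> {- int (Bn * L)..int (Bn * L)}"
  define JS where "JS = {J. J \<subseteq> {..<n} \<and> card J = r}"
  define W where "W J = ({..<k} \<rightarrow>\<^sub>E S0) \<times> ({..<k} \<rightarrow>\<^sub>E {0..int L}) \<times>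
      ((({..<n} - J) \<times> J) \<rightarrow>\<^sub>E XI) \<times> ((({..<n} - J) \<times> ({..<n} - J)) \<rightarrow>\<^sub>E {..<L}) \<times> (I \<rightarrow>\<^sub>E {..D})" for J
  have finJ: "finite J" if "J \<in> JS" for J using that finite_subset unfolding JS_def by blast
  have JSsub: "JS \<subseteq> Pow {..<n}" unfolding JS_def by auto
  then have finJS: "finite JS" and cardJS: "card JS \<le> 2 ^ n"
    using finite_subset card_mono[OF _ JSsub] by (auto simp: card_Pow)
  have floor_x: "\<lfloor>real L * y\<rfloor> \<in> {- int (Bn * L)..int (Bn * L)}" if "\<bar>y\<bar> \<le> B" for y
  proof -
    have "\<bar>y\<bar> \<le> real Bn" using that BBn by linarith
    then have "\<bar>real L * y\<bar> \<le> real L * real Bn" using L0 by (simp add: abs_mult)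
    then have "- real (Bn * L) \<le> real L * y" "real L * y \<le> real (Bn * L)"
      by (auto simp: mult.commute abs_le_iff)
    then show ?thesis by (simp add: le_floor_iff floor_le_iff)
  qed
  have code_in: "code ` grid \<subseteq> (SIGMA J:JS. W J)"
  proof
    fix y assume "y \<in> code ` grid"
    then obtain p where p: "p \<in> grid" "y = code p" by auto
    note b = bad[OF p(1), unfolded bad_def]
    have xb: "\<bar>Re (x p i a)\<bar> \<le> B" "\<bar>Im (x p i a)\<bar> \<le> B" if "a \<in> J p" "i < n" "i \<notin> J p" for i a
    proof -
      have "cmod (x p i a) \<le> B" using b that by auto
      then show "\<bar>Re (x p i a)\<bar> \<le> B" "\<bar>Im (x p i a)\<bar> \<le> B"
        using abs_Re_le_cmod[of "x p i a"] abs_Im_le_cmod[of "x p i a"] by linarith+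
    qed
    have "J p \<in> JS" using b by (auto simp: JS_def)
    moreover have "restrict (\<tau> p) {..<k} \<in> {..<k} \<rightarrow>\<^sub>E S0" using b by (auto simp: PiE_iff)
    moreover have "restrict (\<lambda>l. \<lfloor>real L * t p l\<rfloor>) {..<k} \<in> {..<k} \<rightarrow>\<^sub>E {0..int L}"
    proof -
      have "\<lfloor>real L * t p l\<rfloor> \<in> {0..int L}" if "l < k" for l
      proof -
        have "0 \<le> t p l" "t p l \<le> 1" using b that by auto
        then have "0 \<le> real L * t p l" "real L * t p l \<le> real L" using L0 by (auto simp: mult_left_le)
        then show ?thesis by (simp add: le_floor_iff floor_le_iff)
      qed
      then show ?thesis by (auto simp: PiE_iff simp del: atLeastAtMost_iff)
    qed
    moreover have "restrict (\<lambda>(i, a). (\<lfloor>real L * Re (x p i a)\<rfloor>, \<lfloor>real L * Im (x p i a)\<rfloor>)) (({..<n} - J p) \<times> J p)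
        \<in> (({..<n} - J p) \<times> J p) \<rightarrow>\<^sub>E XI"
      using xb floor_x by (auto simp: PiE_iff XI_def simp del: atLeastAtMost_iff)
    moreover have "restrict p (({..<n} - J p) \<times> ({..<n} - J p)) \<in> (({..<n} - J p) \<times> ({..<n} - J p)) \<rightarrow>\<^sub>E {..<L}"
      using p(1) unfolding grid_def I_def by (auto simp: PiE_iff)
    moreover have "restrict (\<lambda>ij. p ij mod Suc D) I \<in> I \<rightarrow>\<^sub>E {..D}"
      using mod_less_divisor[of "Suc D"] by (auto simp: PiE_iff less_Suc_eq_le)
    ultimately show "y \<in> (SIGMA J:JS. W J)" unfolding p(2) code_def W_def by auto
  qed
  have inj: "inj_on code grid"
  proof (rule inj_onI)
    fix p q assume p: "p \<in> grid" and q: "q \<in> grid" and eq: "code p = code q"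
    note bp = bad[OF p, unfolded bad_def] and bq = bad[OF q, unfolded bad_def]
    have J: "J q = J p"
      and e\<tau>: "restrict (\<tau> p) {..<k} = restrict (\<tau> q) {..<k}"
      and et: "restrict (\<lambda>l. \<lfloor>real L * t p l\<rfloor>) {..<k} = restrict (\<lambda>l. \<lfloor>real L * t q l\<rfloor>) {..<k}"
      using eq unfolding code_def by auto
    have ex: "restrict (\<lambda>(i, a). (\<lfloor>real L * Re (x p i a)\<rfloor>, \<lfloor>real L * Im (x p i a)\<rfloor>)) (({..<n} - J p) \<times> J p)
       = restrict (\<lambda>(i, a). (\<lfloor>real L * Re (x q i a)\<rfloor>, \<lfloor>real L * Im (x q i a)\<rfloor>)) (({..<n} - J p) \<times> J p)"
      and ep: "restrict p (({..<n} - J p) \<times> ({..<n} - J p)) = restrict q (({..<n} - J p) \<times> ({..<n} - J p))"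
      and em: "restrict (\<lambda>ij. p ij mod Suc D) I = restrict (\<lambda>ij. q ij mod Suc D) I"
      using eq unfolding code_def J by auto
    have \<tau>: "\<tau> p l = \<tau> q l" if "l < k" for l using fun_cong[OF e\<tau>, of l] that by simp
    have t: "\<bar>t p l - t q l\<bar> \<le> \<delta>" if "l < k" for l
      unfolding \<delta>_def by (rule floor_eq_diff[OF _ L0]) (use fun_cong[OF et, of l] that in simp)
    have xx: "cmod (x p i a - x q i a) \<le> 2 * \<delta>" if "a \<in> J p" "i \<in> {..<n} - J p" for a i
    proof -
      have "\<bar>Re (x p i a) - Re (x q i a)\<bar> \<le> \<delta>" "\<bar>Im (x p i a) - Im (x q i a)\<bar> \<le> \<delta>"
        using fun_cong[OF ex, of "(i, a)"] that unfolding \<delta>_def by (auto intro!: floor_eq_diff[OF _ L0])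
      then show ?thesis using cmod_le[of "x p i a - x q i a"] by simp
    qed
    have pq: "p (i, j) = q (i, j)" if "i \<in> {..<n} - J p" "j \<in> {..<n} - J p" for i j
      using fun_cong[OF ep, of "(i, j)"] that by simp
    have Gd: "cmod ((\<Sum>l<k. complex_of_real (t p l) * F (\<tau> p l) i j) - (\<Sum>l<k. complex_of_real (t q l) * F (\<tau> q l) i j)) \<le> c * \<delta>"
      if "i < n" "j < n" for i j
    proof -
      have "(\<Sum>l<k. complex_of_real (t p l) * F (\<tau> p l) i j) - (\<Sum>l<k. complex_of_real (t q l) * F (\<tau> q l) i j)
         = (\<Sum>l<k. complex_of_real (t p l - t q l) * F (\<tau> p l) i j)"
        by (simp add: sum_subtractf[symmetric] left_diff_distrib \<tau>)
      also have "cmod \<dots> \<le> (\<Sum>l<k. \<delta> * R)"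
      proof (rule sum_norm_le)
        fix l assume "l \<in> {..<k}"
        then have "\<tau> p l \<in> S0" "\<bar>t p l - t q l\<bar> \<le> \<delta>" using bp t by auto
        then show "cmod (complex_of_real (t p l - t q l) * F (\<tau> p l) i j) \<le> \<delta> * R"
          unfolding norm_mult norm_of_real using FR[OF _ that] \<delta>0 by (intro mult_mono) auto
      qed
      also have "\<dots> = c * \<delta>" by (simp add: c_def)
      finally show ?thesis .
    qed
    have Mh: "hermitian n (M (\<tau> p) (t p) p)" if "p \<in> grid" for p
      unfolding hermitian_def
    proof (intro allI impI)
      fix i j assume ij: "i < n" "j < n"
      have "cnj (F (\<tau> p l) i j) = F (\<tau> p l) j i" if "l < k" for l
        using bad[OF \<open>p \<in> grid\<close>, unfolded bad_def] that by (intro hermitianD[OF S0(2)[rule_format]] ij) auto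
      then have "cnj (\<Sum>l<k. complex_of_real (t p l) * F (\<tau> p l) i j) = (\<Sum>l<k. complex_of_real (t p l) * F (\<tau> p l) j i)"
        by simp
      then show "M (\<tau> p) (t p) p j i = cnj (M (\<tau> p) (t p) p i j)"
        unfolding M_def complex_cnj_add using hermitianD[OF grid_matrix_hermitian ij] by simp
    qed
    have Mb: "cmod (M (\<tau> q) (t q) q i j) \<le> R1" if "i < n" "j < n" for i j
    proof -
      have "cmod (\<Sum>l<k. complex_of_real (t q l) * F (\<tau> q l) i j) \<le> (\<Sum>l<k. 1 * R)"
      proof (rule sum_norm_le)
        fix l assume "l \<in> {..<k}"
        then have "\<tau> q l \<in> S0" "\<bar>t q l\<bar> \<le> 1" using bq by auto
        then show "cmod (complex_of_real (t q l) * F (\<tau> q l) i j) \<le> 1 * R"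
          unfolding norm_mult norm_of_real using FR[OF _ that] by (intro mult_mono) auto
      qed
      then show ?thesis unfolding M_def R1_def
        using gb[OF q that] norm_triangle_ineq[of "\<Sum>l<k. complex_of_real (t q l) * F (\<tau> q l) i j" "grid_matrix h q i j"]
        by simp
    qed
    have Md: "cmod (M (\<tau> p) (t p) p i j - M (\<tau> q) (t q) q i j) \<le> (C - c) * \<delta>" if "i < n" "j < n" for i j
      unfolding C_def add_diff_cancel_right'
    proof (rule columns_determine[OF Mh[OF p] Mh[OF q] _ c0 \<open>0 \<le> B\<close> R10 less_imp_le[OF \<delta>0] Mb _ xx _ _ _ that])
      show "J p \<subseteq> {..<n}" using bp by auto
      fix a i assume "a \<in> J p"
      then show "i \<in> {..<n} - J p \<Longrightarrow> cmod (x p i a) \<le> B"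
        and "i < n \<Longrightarrow> cmod (M (\<tau> p) (t p) p i a + (\<Sum>k\<in>{..<n} - J p. M (\<tau> p) (t p) p i k * x p k a)) \<le> \<delta>"
        and "i < n \<Longrightarrow> cmod (M (\<tau> q) (t q) q i a + (\<Sum>k\<in>{..<n} - J p. M (\<tau> q) (t q) q i k * x q k a)) \<le> \<delta>"
        using bp bq[unfolded J] by blast+
    next
      fix i j assume i: "i \<in> {..<n} - J p" and j: "j \<in> {..<n} - J p"
      have "grid_matrix h p i j = grid_matrix h q i j"
        unfolding grid_matrix_def using pq i j by auto
      then show "cmod (M (\<tau> p) (t p) p i j - M (\<tau> q) (t q) q i j) \<le> c * \<delta>"
        unfolding M_def using Gd[of i j] i j by simp
    qed
    have gd: "cmod (grid_matrix h p i j - grid_matrix h q i j) \<le> h * D" if "i < n" "j < n" for i j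
    proof -
      have "cmod (grid_matrix h p i j - grid_matrix h q i j) \<le> (C - c) * \<delta> + c * \<delta>"
        using norm_triangle_ineq4[of "M (\<tau> p) (t p) p i j - M (\<tau> q) (t q) q i j"
          "(\<Sum>l<k. complex_of_real (t p l) * F (\<tau> p l) i j) - (\<Sum>l<k. complex_of_real (t q l) * F (\<tau> q l) i j)"]
          Md[OF that] Gd[OF that] unfolding M_def by (simp add: algebra_simps)
      also have "\<dots> = h * (2 * C / \<epsilon>)" using \<open>0 < \<epsilon>\<close> L0 by (simp add: h_def \<delta>_def field_simps)
      also have "\<dots> \<le> h * D" using DC h0 by (intro mult_left_mono) auto
      finally show ?thesis .
    qed
    have "p ij = q ij" for ij
    proof (cases "ij \<in> I")
      case True
      then obtain i j where ij: "ij = (i, j)" "i < n" "j < n" unfolding I_def by auto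
      have d: "\<bar>real (p (i, j)) - real (q (i, j))\<bar> \<le> real D"
        by (rule grid_matrix_diff[OF h0 gd[OF ij(2,3)] gd[OF ij(3,2)]])
      have m: "p ij mod Suc D = q ij mod Suc D" using fun_cong[OF em, of ij] True by simp
      have "int (Suc D) dvd (int (p ij) - int (q ij))"
        using m by (metis mod_eq_dvd_iff of_nat_mod)
      moreover have "\<bar>int (p ij) - int (q ij)\<bar> < int (Suc D)"
      proof -
        have "real_of_int \<bar>int (p ij) - int (q ij)\<bar> \<le> real_of_int (int D)"
          using d unfolding ij(1) by simp
        then have "\<bar>int (p ij) - int (q ij)\<bar> \<le> int D" by (simp only: of_int_le_iff)
        then show ?thesis by simp
      qed
      ultimately have "int (p ij) - int (q ij) = 0"
        using dvd_imp_le_int[of "int (p ij) - int (q ij)" "int (Suc D)"] by linarith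
      then show ?thesis by simp
    next
      case False
      then show ?thesis using PiE_arb[OF p[unfolded grid_def]] PiE_arb[OF q[unfolded grid_def]] by simp
    qed
    then show "p = q" by blast
  qed
  have finS: "finite (SIGMA J:JS. W J)"
    using finJS finJ S0 by (auto simp: W_def I_def XI_def intro!: finite_SigmaI finite_cartesian_product finite_PiE)
  have cardW: "card (W J) = s ^ k * ((L + 1) ^ k * (((2 * Bn * L + 1) * (2 * Bn * L + 1)) ^ ((n - r) * r) * (L ^ ((n - r) * (n - r)) * Suc D ^ (n * n))))"
    if "J \<in> JS" for J
  proof -
    have "card ({..<n} - J) = n - r" "card J = r" using that finJ[OF that] by (auto simp: JS_def card_Diff_subset)
    moreover have "nat (1 + int Bn * int L + int Bn * int L) = Suc (2 * Bn * L)" by (simp add: nat_eq_iff algebra_simps)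
    moreover have "nat (1 + int L) = Suc L" by simp
    ultimately show ?thesis unfolding W_def I_def XI_def s_def
      using finJ[OF that] by (simp add: card_PiE card_cartesian_product add.commute)
  qed
  have "L ^ (n * n) = card grid" unfolding grid_def I_def by (simp add: card_PiE card_cartesian_product)
  also have "\<dots> = card (code ` grid)" using inj by (simp add: card_image)
  also have "\<dots> \<le> card (SIGMA J:JS. W J)" by (rule card_mono[OF finS code_in])
  also have "\<dots> = (\<Sum>J\<in>JS. card (W J))"
    using finJS finJ S0 by (intro card_SigmaI) (auto simp: W_def I_def XI_def intro!: finite_cartesian_product finite_PiE)
  also have "\<dots> = card JS * (s ^ k * ((L + 1) ^ k * (((2 * Bn * L + 1) * (2 * Bn * L + 1)) ^ ((n - r) * r) * (L ^ ((n - r) * (n - r)) * Suc D ^ (n * n)))))"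
    using cardW by simp
  \<comment> \<open>\<open>L + 1\<close> and \<open>2 * Bn * L + 1\<close> are replaced by multiples
    of \<open>L\<close>, which is possible because \<open>L\<close> is at least 1, so that a pure
    power of \<open>L\<close> can be split off.\<close>
  also have "\<dots> \<le> 2 ^ n * (s ^ k * ((2 * L) ^ k * ((((2 * Bn + 1) * L) * ((2 * Bn + 1) * L)) ^ ((n - r) * r) * (L ^ ((n - r) * (n - r)) * Suc D ^ (n * n)))))"
    using cardJS by (intro mult_le_mono power_mono order.refl) (auto simp: L_def)
  also have "\<dots> = K * L ^ (k + 2 * ((n - r) * r) + (n - r) * (n - r))"
  proof -
    have sq: "((X * L) * (X * L)) ^ p = X ^ (2 * p) * L ^ (2 * p)" for X p :: nat
      by (simp add: power_mult_distrib mult_2 power_add)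
    show ?thesis unfolding K_def sq power_add power_mult_distrib[of 2 L] by (simp only: mult_ac)
  qed
  finally have *: "L ^ (n * n) \<le> K * L ^ (k + 2 * ((n - r) * r) + (n - r) * (n - r))" .
  obtain m where m: "n = r + m" using r(1) le_Suc_ex by blast
  have "Suc (k + 2 * ((n - r) * r) + (n - r) * (n - r)) \<le> n * n"
    using r(2) unfolding m by (simp add: power2_eq_square algebra_simps)
  then have "L * L ^ (k + 2 * ((n - r) * r) + (n - r) * (n - r)) \<le> L ^ (n * n)"
    by (metis L_def power_Suc power_increasing Suc_le_eq zero_less_Suc One_nat_def)
  with * have "L * L ^ (k + 2 * ((n - r) * r) + (n - r) * (n - r)) \<le> K * L ^ (k + 2 * ((n - r) * r) + (n - r) * (n - r))"
    by linarith
  then have "L \<le> K" by (simp add: L_def)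
  then show False by (simp add: L_def)
qed

text \<open>The contrapositive of \<open>small_eigenvalues_columns\<close>: \<open>r\<close>
  eigenvalues of modulus at most \<open>\<eta>\<close> would produce the column relations that
  \<open>generic_shift_columns\<close> excludes, for the coefficient bound
  \<open>2 ^ r\<close>.\<close>

lemma generic_shift:
  fixes F :: "'f \<Rightarrow> nat \<Rightarrow> nat \<Rightarrow> complex"
  assumes S0: "finite S0" "\<forall>s\<in>S0. hermitian n (F s)" and r: "r \<le> n" "k < r\<^sup>2" and "0 < \<epsilon>"
  shows "\<exists>P \<eta>. hermitian n P \<and> (\<forall>i<n. \<forall>j<n. cmod (P i j) \<le> \<epsilon>) \<and> 0 < \<eta> \<and>
    (\<forall>\<tau> t u d. (\<forall>l<k. \<tau> l \<in> S0) \<longrightarrow> (\<forall>l<k. 0 \<le> t l \<and> t l \<le> 1) \<longrightarrow>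
       spectral n (\<lambda>i j. (\<Sum>l<k. of_real (t l) * F (\<tau> l) i j) + P i j) u d \<longrightarrow>
       card {l. l < n \<and> \<bar>d l\<bar> \<le> \<eta>} < r)"
proof -
  obtain P \<eta> where P: "hermitian n P" "\<forall>i<n. \<forall>j<n. cmod (P i j) \<le> \<epsilon>" "0 < \<eta>" and
    no: "\<And>\<tau> t J x. (\<forall>l<k. \<tau> l \<in> S0) \<Longrightarrow> (\<forall>l<k. 0 \<le> t l \<and> t l \<le> 1) \<Longrightarrow> J \<subseteq> {..<n} \<Longrightarrow> card J = r \<Longrightarrow>
       (\<forall>a\<in>J. \<forall>i\<in>{..<n} - J. cmod (x i a) \<le> 2 ^ r) \<Longrightarrow>
       \<not> (\<forall>a\<in>J. \<forall>i<n. cmod (((\<Sum>l<k. of_real (t l) * F (\<tau> l) i a) + P i a) +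
             (\<Sum>m\<in>{..<n} - J. ((\<Sum>l<k. of_real (t l) * F (\<tau> l) i m) + P i m) * x m a)) \<le> \<eta>)"
    using generic_shift_columns[OF S0 r \<open>0 < \<epsilon>\<close>
      zero_le_power[of "2::real" r, OF zero_le_numeral]]
    by (elim exE conjE) (rule that, auto)
  \<comment> \<open>The threshold is shrunk by the factor that the passage from eigenvalues to
    columns loses; the summand 1 keeps the denominator positive for \<open>n = 0\<close>.\<close>
  define \<eta>' where "\<eta>' = \<eta> / (n * 2 ^ r + 1)"
  have den: "0 < real n * 2 ^ r + 1" by (simp add: add_nonneg_pos)
  have \<eta>': "0 < \<eta>'" using P(3) den by (simp add: \<eta>'_def)
  have \<eta>'\<eta>: "\<eta>' * (n * 2 ^ r) \<le> \<eta>"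
  proof -
    have "\<eta>' * (n * 2 ^ r) \<le> \<eta>' * (n * 2 ^ r + 1)" using \<eta>' by simp
    also have "\<dots> = \<eta>" using den by (simp add: \<eta>'_def)
    finally show ?thesis .
  qed
  show ?thesis
  proof (intro exI[of _ P] exI[of _ \<eta>'] conjI allI impI)
    fix \<tau> t u d assume a: "\<forall>l<k. \<tau> l \<in> S0" "\<forall>l<k. 0 \<le> t l \<and> t l \<le> 1"
      "spectral n (\<lambda>i j. (\<Sum>l<k. complex_of_real (t l) * F (\<tau> l) i j) + P i j) u d"
    show "card {l. l < n \<and> \<bar>d l\<bar> \<le> \<eta>'} < r"
    proof (rule ccontr)
      assume "\<not> ?thesis"
      then have "r \<le> card {l. l < n \<and> \<bar>d l\<bar> \<le> \<eta>'}" by simp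
      from small_eigenvalues_columns[OF a(3) this less_imp_le[OF \<eta>']]
      show False
      proof (elim exE conjE)
        fix J x
        assume J: "J \<subseteq> {..<n}" "card J = r" "\<forall>a\<in>J. \<forall>i\<in>{..<n} - J. cmod (x i a) \<le> 2 ^ r"
          and m: "\<forall>a\<in>J. \<forall>i<n. cmod ((\<Sum>l<k. complex_of_real (t l) * F (\<tau> l) i a) + P i a +
            (\<Sum>m\<in>{..<n} - J. ((\<Sum>l<k. complex_of_real (t l) * F (\<tau> l) i m) + P i m) * x m a)) \<le> \<eta>' * (n * 2 ^ r)"
        from no[OF a(1,2) J] m \<eta>'\<eta> show False by (meson order.trans)
      qed
    qed
  qed (use P \<eta>' in auto)
qed

section \<open>Perturbing functions on spaces of finite covering dimension\<close>

lemma C0_continuous: "g \<in> C0_functions X \<Longrightarrow> continuous_map X euclidean g"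
  unfolding C0_functions_def by auto

lemma C0_vanish:
  assumes "g \<in> C0_functions X" "0 < e"
  obtains K where "compactin X K" "\<And>z. z \<in> topspace X \<Longrightarrow> z \<notin> K \<Longrightarrow> cmod (g z) < e"
  using assms unfolding C0_functions_def by auto

lemma C0_I:
  assumes "continuous_map X euclidean g"
    and "\<And>e. 0 < e \<Longrightarrow> \<exists>K. compactin X K \<and> (\<forall>z\<in>topspace X - K. cmod (g z) < e)"
  shows "g \<in> C0_functions X"
  using assms unfolding C0_functions_def by auto

lemma C0_cong:
  assumes "\<And>z. z \<in> topspace X \<Longrightarrow> g z = h z" "g \<in> C0_functions X"
  shows "h \<in> C0_functions X"
proof (rule C0_I)
  show "continuous_map X euclidean h"
    by (rule continuous_map_eq[OF C0_continuous[OF assms(2)]]) (use assms(1) in auto)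
  fix e :: real assume "0 < e"
  then obtain K where "compactin X K" "\<And>z. z \<in> topspace X \<Longrightarrow> z \<notin> K \<Longrightarrow> cmod (g z) < e"
    using C0_vanish[OF assms(2)] by blast
  then show "\<exists>K. compactin X K \<and> (\<forall>z\<in>topspace X - K. cmod (h z) < e)"
    using assms(1) by (intro exI[of _ K]) auto
qed

lemma C0_comp:
  assumes g: "g \<in> C0_functions X" and k: "continuous_on UNIV k" "k 0 = 0"
  shows "(\<lambda>z. k (g z)) \<in> C0_functions X"
proof (rule C0_I)
  have "continuous_map euclidean euclidean k" using k(1) by simp
  from continuous_map_compose[OF C0_continuous[OF g] this]
  show "continuous_map X euclidean (\<lambda>z. k (g z))" by (simp add: o_def)
  fix e :: real assume "0 < e"
  then obtain d where d: "0 < d" "\<And>w. cmod w < d \<Longrightarrow> cmod (k w) < e"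
    using k unfolding continuous_on_iff by (metis UNIV_I dist_0_norm dist_commute)
  obtain K where "compactin X K" "\<And>z. z \<in> topspace X \<Longrightarrow> z \<notin> K \<Longrightarrow> cmod (g z) < d"
    using C0_vanish[OF g d(1)] by blast
  then show "\<exists>K. compactin X K \<and> (\<forall>z\<in>topspace X - K. cmod (k (g z)) < e)"
    using d(2) by (intro exI[of _ K]) auto
qed

lemma C0_zero: "(\<lambda>z. 0) \<in> C0_functions X"
  by (rule C0_I) (auto intro!: exI[of _ "{}"])

lemma C0_cmult: "g \<in> C0_functions X \<Longrightarrow> (\<lambda>z. c * g z) \<in> C0_functions X"
  by (rule C0_comp[where k = "\<lambda>w. c * w"]) (auto intro!: continuous_intros)

lemma C0_cnj: "g \<in> C0_functions X \<Longrightarrow> (\<lambda>z. cnj (g z)) \<in> C0_functions X"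
  by (rule C0_comp[where k = cnj]) (auto intro!: continuous_intros)

lemma C0_add:
  assumes g: "g \<in> C0_functions X" and h: "h \<in> C0_functions X"
  shows "(\<lambda>z. g z + h z) \<in> C0_functions X"
proof (rule C0_I)
  show "continuous_map X euclidean (\<lambda>z. g z + h z)"
    by (intro continuous_map_add C0_continuous g h)
  fix e :: real assume "0 < e"
  then have e2: "0 < e / 2" by simp
  obtain K where K: "compactin X K" "\<And>z. z \<in> topspace X \<Longrightarrow> z \<notin> K \<Longrightarrow> cmod (g z) < e / 2"
    using C0_vanish[OF g e2] by blast
  obtain L where L: "compactin X L" "\<And>z. z \<in> topspace X \<Longrightarrow> z \<notin> L \<Longrightarrow> cmod (h z) < e / 2"
    using C0_vanish[OF h e2] by blast
  have "cmod (g z + h z) < e" if "z \<in> topspace X - (K \<union> L)" for z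
    using K(2)[of z] L(2)[of z] that norm_triangle_ineq[of "g z" "h z"] by auto
  then show "\<exists>K. compactin X K \<and> (\<forall>z\<in>topspace X - K. cmod (g z + h z) < e)"
    using compactin_Un[OF K(1) L(1)] by blast
qed

lemma C0_sum:
  assumes "finite I" "\<And>i. i \<in> I \<Longrightarrow> g i \<in> C0_functions X"
  shows "(\<lambda>z. \<Sum>i\<in>I. g i z) \<in> C0_functions X"
  using assms by (induction I rule: finite_induct) (auto intro: C0_zero C0_add)

lemma C0_bounded:
  assumes g: "g \<in> C0_functions X"
  obtains b where "0 < b" "\<And>z. z \<in> topspace X \<Longrightarrow> cmod (g z) \<le> b"
proof -
  obtain K where K: "compactin X K" "\<And>z. z \<in> topspace X \<Longrightarrow> z \<notin> K \<Longrightarrow> cmod (g z) < 1"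
    using C0_vanish[OF g, of 1] by auto
  have "compact (g ` K)" using image_compactin[OF K(1) C0_continuous[OF g]] by simp
  then obtain b where b: "\<And>w. w \<in> g ` K \<Longrightarrow> cmod w \<le> b"
    using compact_imp_bounded bounded_iff by metis
  show thesis
  proof (rule that[of "max b 1"])
    fix z assume "z \<in> topspace X"
    then show "cmod (g z) \<le> max b 1" using b[of "g z"] K(2)[of z] by (cases "z \<in> K") auto
  qed auto
qed

lemma C0_mult_bounded:
  assumes g: "g \<in> C0_functions X" and h: "continuous_map X euclidean h"
    and b: "\<And>z. z \<in> topspace X \<Longrightarrow> cmod (h z) \<le> b"
  shows "(\<lambda>z. g z * h z) \<in> C0_functions X"
proof (rule C0_I)
  show "continuous_map X euclidean (\<lambda>z. g z * h z)"
    using C0_continuous[OF g] h by (simp add: continuous_map_atin tendsto_mult)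
  fix e :: real assume e: "0 < e"
  let ?b = "max b 1"
  have "0 < e / ?b" using e by simp
  then obtain K where K: "compactin X K" "\<And>z. z \<in> topspace X \<Longrightarrow> z \<notin> K \<Longrightarrow> cmod (g z) < e / ?b"
    using C0_vanish[OF g] by blast
  have "cmod (g z * h z) < e" if "z \<in> topspace X - K" for z
  proof -
    have "cmod (g z) * cmod (h z) \<le> cmod (g z) * ?b"
      using b[of z] that by (intro mult_left_mono) auto
    also have "\<dots> < e / ?b * ?b" using K(2)[of z] that by (intro mult_strict_right_mono) auto
    finally show ?thesis by (simp add: norm_mult)
  qed
  then show "\<exists>K. compactin X K \<and> (\<forall>z\<in>topspace X - K. cmod (g z * h z) < e)" using K by blast
qed

lemma C0_mult:
  assumes g: "g \<in> C0_functions X" and h: "h \<in> C0_functions X"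
  shows "(\<lambda>z. g z * h z) \<in> C0_functions X"
proof -
  obtain b where "\<And>z. z \<in> topspace X \<Longrightarrow> cmod (h z) \<le> b" using C0_bounded[OF h] by blast
  then show ?thesis by (rule C0_mult_bounded[OF g C0_continuous[OF h]])
qed

lemma C0_uniform_limit:
  assumes "\<And>e. 0 < e \<Longrightarrow> \<exists>h\<in>C0_functions X. \<forall>z\<in>topspace X. cmod (g z - h z) \<le> e"
  shows "g \<in> C0_functions X"
proof (rule C0_I)
  have "\<exists>U. openin X U \<and> z \<in> U \<and> (\<forall>w\<in>U. g w \<in> Met_TC.mball (g z) e)" if z: "z \<in> topspace X" and e: "0 < e" for z e
  proof -
    obtain h where h: "h \<in> C0_functions X" "\<forall>z\<in>topspace X. cmod (g z - h z) \<le> e / 4"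
      using assms[of "e / 4"] e by auto
    have "\<exists>U. openin X U \<and> z \<in> U \<and> (\<forall>w\<in>U. h w \<in> Met_TC.mball (h z) (e / 4))"
    proof -
      have "continuous_map X Met_TC.mtopology h" using C0_continuous[OF h(1)] by simp
      moreover have "0 < e / 4" using e by simp
      ultimately show ?thesis unfolding Met_TC.continuous_map_to_metric using z by blast
    qed
    then obtain U where U: "openin X U" "z \<in> U" "\<And>w. w \<in> U \<Longrightarrow> dist (h z) (h w) < e / 4"
      by (auto simp: Met_TC.mball_def)
    have "dist (g z) (g w) < e" if w: "w \<in> U" for w
    proof -
      have wX: "w \<in> topspace X" using U(1) w openin_subset by blast
      have "dist (g z) (h z) \<le> e / 4" "dist (h w) (g w) \<le> e / 4"
        using h(2) z wX by (auto simp: dist_norm norm_minus_commute)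
      then show ?thesis using U(3)[OF w] dist_triangle[of "g z" "g w" "h z"] dist_triangle[of "h z" "g w" "h w"] e
        by linarith
    qed
    then show ?thesis using U by (intro exI[of _ U]) (auto simp: Met_TC.mball_def)
  qed
  then have "continuous_map X Met_TC.mtopology g" unfolding Met_TC.continuous_map_to_metric by blast
  then show "continuous_map X euclidean g" by simp
  fix e :: real assume e: "0 < e"
  obtain h where h: "h \<in> C0_functions X" "\<forall>z\<in>topspace X. cmod (g z - h z) \<le> e / 2"
    using assms[of "e / 2"] e by auto
  have e2: "0 < e / 2" using e by simp
  obtain K where K: "compactin X K" "\<And>z. z \<in> topspace X \<Longrightarrow> z \<notin> K \<Longrightarrow> cmod (h z) < e / 2"
    using C0_vanish[OF h(1) e2] by blast
  have "cmod (g z) < e" if "z \<in> topspace X - K" for z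
    using K(2)[of z] h(2) that norm_triangle_ineq[of "g z - h z" "h z"] by fastforce
  then show "\<exists>K. compactin X K \<and> (\<forall>z\<in>topspace X - K. cmod (g z) < e)" using K by blast
qed

text \<open>An arbitrary selection. Nothing is claimed about how the eigenbasis depends on
  \<open>M\<close>; only \<open>herm_fun\<close> varies continuously, as \<open>C0_herm_fun\<close>
  shows.\<close>

definition spectral_choice :: "nat \<Rightarrow> (nat \<Rightarrow> nat \<Rightarrow> complex) \<Rightarrow> (nat \<Rightarrow> nat \<Rightarrow> complex) \<times> (nat \<Rightarrow> real)" where
  "spectral_choice n M = (SOME ud. spectral n M (fst ud) (snd ud))"

definition herm_fun :: "nat \<Rightarrow> (real \<Rightarrow> real) \<Rightarrow> (nat \<Rightarrow> nat \<Rightarrow> complex) \<Rightarrow> nat \<Rightarrow> nat \<Rightarrow> complex" where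
  "herm_fun n G M = spectral_fun n (fst (spectral_choice n M)) (snd (spectral_choice n M)) G"

lemma spectral_choice:
  "hermitian n M \<Longrightarrow> spectral n M (fst (spectral_choice n M)) (snd (spectral_choice n M))"
  unfolding spectral_choice_def
  using spectral_exists[of n M] someI_ex[of "\<lambda>ud. spectral n M (fst ud) (snd ud)"] by fastforce

lemma spectral_fun_sum: "spectral_fun n u d (\<lambda>x. \<Sum>i\<in>I. a i * G i x) i' j = (\<Sum>i\<in>I. of_real (a i) * spectral_fun n u d (G i) i' j)"
proof -
  have "spectral_fun n u d (\<lambda>x. \<Sum>i\<in>I. a i * G i x) i' j
     = (\<Sum>l<n. \<Sum>i\<in>I. of_real (a i) * (of_real (G i (d l)) * (u l i' * cnj (u l j))))"
    unfolding spectral_fun_def of_real_sum sum_distrib_right by (intro sum.cong refl) (simp add: mult_ac)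
  then show ?thesis unfolding spectral_fun_def by (subst (asm) sum.swap) (simp add: sum_distrib_left)
qed

text \<open>For a polynomial without constant term the entries are sums of products of entries of
  \<open>f\<close>, hence in \<open>C0_functions\<close>. Since \<open>f\<close> is bounded, all
  eigenvalues lie in one compact interval, on which \<open>G\<close> is a uniform limit of such
  polynomials; \<open>G 0 = 0\<close> allows the constant term to be dropped.\<close>

lemma C0_herm_fun:
  assumes h: "\<And>z. z \<in> topspace X \<Longrightarrow> hermitian n (f z)"
    and f: "\<And>i j. i < n \<Longrightarrow> j < n \<Longrightarrow> (\<lambda>z. f z i j) \<in> C0_functions X"
    and G: "continuous_on UNIV G" "G 0 = 0" and ij: "i < n" "j < n"
  shows "(\<lambda>z. herm_fun n G (f z) i j) \<in> C0_functions X"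
proof (rule C0_uniform_limit)
  fix e :: real assume e: "0 < e"
  have pow: "(\<lambda>z. herm_fun n (\<lambda>x. x ^ Suc m) (f z) i j) \<in> C0_functions X" if "i < n" "j < n" for m i j
    using that
  proof (induction m arbitrary: i j)
    case 0
    then show ?case by (intro C0_cong[OF _ f[OF 0]]) (simp add: herm_fun_def spectral_fun_id[OF spectral_choice[OF h]])
  next
    case (Suc m)
    have "(\<lambda>z. \<Sum>k<n. f z i k * herm_fun n (\<lambda>x. x ^ Suc m) (f z) k j) \<in> C0_functions X"
      using Suc by (intro C0_sum C0_mult f) auto
    then show ?case
    proof (rule C0_cong[rotated])
      fix z assume z: "z \<in> topspace X"
      note sp = spectral_choice[OF h[OF z]]
      have "herm_fun n (\<lambda>x. x ^ Suc (Suc m)) (f z) i j = herm_fun n (\<lambda>x. x * x ^ Suc m) (f z) i j" by simp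
      also have "\<dots> = mat_prod n (herm_fun n (\<lambda>x. x) (f z)) (herm_fun n (\<lambda>x. x ^ Suc m) (f z)) i j"
        unfolding herm_fun_def by (rule spectral_fun_mult[OF sp Suc.prems, symmetric])
      also have "\<dots> = (\<Sum>k<n. f z i k * herm_fun n (\<lambda>x. x ^ Suc m) (f z) k j)"
        unfolding mat_prod_def using Suc.prems by (intro sum.cong refl) (simp add: herm_fun_def spectral_fun_id[OF sp])
      finally show "(\<Sum>k<n. f z i k * herm_fun n (\<lambda>x. x ^ Suc m) (f z) k j) = herm_fun n (\<lambda>x. x ^ Suc (Suc m)) (f z) i j" ..
    qed
  qed
  have "\<forall>i j. \<exists>b. i < n \<longrightarrow> j < n \<longrightarrow> 0 < b \<and> (\<forall>z\<in>topspace X. cmod (f z i j) \<le> b)"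
    using C0_bounded[OF f] by metis
  then obtain b where b: "\<And>i j. i < n \<Longrightarrow> j < n \<Longrightarrow> 0 < b i j \<and> (\<forall>z\<in>topspace X. cmod (f z i j) \<le> b i j)"
    by metis
  define B where "B = (\<Sum>i<n. \<Sum>j<n. b i j)"
  have B0: "0 \<le> B" unfolding B_def using b by (intro sum_nonneg) (auto simp: less_imp_le)
  have fB: "cmod (f z i j) \<le> B" if "i < n" "j < n" "z \<in> topspace X" for i j z
  proof -
    have "cmod (f z i j) \<le> b i j" using b that by blast
    also have "\<dots> \<le> (\<Sum>j<n. b i j)" using b that by (intro member_le_sum) (auto simp: less_imp_le)
    also have "\<dots> \<le> B" unfolding B_def using b that
      by (intro member_le_sum[of i _ "\<lambda>i. \<Sum>j<n. b i j"] sum_nonneg) (auto simp: less_imp_le)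
    finally show ?thesis .
  qed
  let ?R = "n * B"
  \<comment> \<open>The factor 2 pays for dropping the constant term of the approximating
    polynomial, and \<open>n\<close> is the loss in \<open>spectral_fun_diff_bound\<close>.\<close>
  define e' where "e' = e / (2 * (real n + 1))"
  have e': "0 < e'" using e by (simp add: e'_def)
  have "compact {- ?R..?R}" by simp
  then obtain g where g: "real_polynomial_function g" "\<And>x. x \<in> {- ?R..?R} \<Longrightarrow> \<bar>G x - g x\<bar> < e'"
    using Stone_Weierstrass_real_polynomial_function[OF _ continuous_on_subset[OF G(1) subset_UNIV] e'] by metis
  then obtain a N where gs: "g = (\<lambda>x. \<Sum>i\<le>N. a i * x ^ i)" using real_polynomial_function_iff_sum by blast
  define q where "q = (\<lambda>x. \<Sum>i<N. a (Suc i) * x ^ Suc i)"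
  have q: "q x = g x - g 0" for x
  proof -
    have "g x = a 0 + q x" for x unfolding gs q_def by (simp add: sum.atMost_shift)
    from this[of x] this[of 0] show ?thesis by (simp add: q_def)
  qed
  have Gq: "\<bar>G x - q x\<bar> \<le> 2 * e'" if "\<bar>x\<bar> \<le> ?R" for x
  proof -
    have "\<bar>G x - g x\<bar> < e'" "\<bar>G 0 - g 0\<bar> < e'" using g(2)[of x] g(2)[of 0] that by (auto simp: abs_le_iff)
    then show ?thesis using q[of x] G(2) by linarith
  qed
  have "(\<lambda>z. herm_fun n q (f z) i j) \<in> C0_functions X"
    unfolding q_def herm_fun_def spectral_fun_sum
    by (intro C0_sum C0_cmult finite_lessThan) (rule pow[OF ij, unfolded herm_fun_def])
  moreover have "cmod (herm_fun n G (f z) i j - herm_fun n q (f z) i j) \<le> e" if z: "z \<in> topspace X" for z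
  proof -
    note sp = spectral_choice[OF h[OF z]]
    have "cmod (herm_fun n G (f z) i j - herm_fun n q (f z) i j) \<le> n * (2 * e')"
      unfolding herm_fun_def
    proof (rule spectral_fun_diff_bound[OF sp _ ij])
      fix l assume "l < n"
      then show "\<bar>G (snd (spectral_choice n (f z)) l) - q (snd (spectral_choice n (f z)) l)\<bar> \<le> 2 * e'"
        using op_bound_eigenvalue[OF sp op_bound_entries[OF fB B0]] z by (intro Gq) auto
    qed
    also have "\<dots> \<le> (real n + 1) * (2 * e')" using e' by (intro mult_right_mono) auto
    also have "\<dots> = e" by (simp add: e'_def field_simps)
    finally show ?thesis .
  qed
  ultimately show "\<exists>h\<in>C0_functions X. \<forall>z\<in>topspace X. cmod (herm_fun n G (f z) i j - h z) \<le> e"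
    by (intro bexI[of _ "\<lambda>z. herm_fun n q (f z) i j"]) auto
qed

text \<open>In a metric space the distances to the complements of the members of the cover, divided
  by their sum, form a subordinate partition of unity.\<close>

lemma subordinate_partition:
  fixes Z :: "'z metric"
  assumes fin: "finite \<V>" and "\<forall>V\<in>\<V>. openin (mtopology_of Z) V" and cov: "\<Union>\<V> = mspace Z"
  shows "\<exists>lam. (\<forall>V\<in>\<V>. continuous_map (mtopology_of Z) euclideanreal (lam V)) \<and>
     (\<forall>V\<in>\<V>. \<forall>z\<in>mspace Z. 0 \<le> lam V z \<and> (lam V z \<noteq> 0 \<longrightarrow> z \<in> V)) \<and>
     (\<forall>z\<in>mspace Z. (\<Sum>V\<in>\<V>. lam V z) = 1)"
proof -
  note op = assms(2)[rule_format]
  interpret Metric_space "mspace Z" "mdist Z" by (rule Metric_space_mspace_mdist)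
  have top: "mtopology_of Z = mtopology" by (simp add: mtopology_of_def)
  \<comment> \<open>If \<open>V\<close> is the whole space, its complement is empty and the infimum
    would carry no information, so the constant 1 is used instead.\<close>
  define D where "D V z = (if V = mspace Z then 1 else Inf (mdist Z z ` (mspace Z - V)))" for V z
  have ne: "mspace Z - V \<noteq> {}" if "V \<in> \<V>" "V \<noteq> mspace Z" for V using cov that by auto
  have bdd: "bdd_below (mdist Z z ` S)" for z S by (rule bdd_belowI[of _ 0]) auto
  have D0: "0 \<le> D V z" if "V \<in> \<V>" for V z
    using ne[OF that] unfolding D_def by (auto intro!: cINF_greatest)
  have Dpos: "0 < D V z" if V: "V \<in> \<V>" and z: "z \<in> V" for V z
  proof (cases "V = mspace Z")
    case True then show ?thesis by (simp add: D_def)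
  next
    case False
    obtain r where r: "0 < r" "mball z r \<subseteq> V"
      using op[OF V] z unfolding top openin_mtopology by blast
    have zM: "z \<in> mspace Z" using z V cov by auto
    have "r \<le> Inf (mdist Z z ` (mspace Z - V))"
    proof (rule cINF_greatest[OF ne[OF V False]])
      fix y assume "y \<in> mspace Z - V"
      then have "y \<notin> mball z r" using r by auto
      then show "r \<le> mdist Z z y" using \<open>y \<in> mspace Z - V\<close> zM by simp
    qed
    then show ?thesis using r False by (simp add: D_def)
  qed
  have Dzero: "z \<in> V" if V: "V \<in> \<V>" and z: "z \<in> mspace Z" and "D V z \<noteq> 0" for V z
  proof (rule ccontr)
    assume "z \<notin> V"
    then have "V \<noteq> mspace Z" using z by auto
    moreover have "Inf (mdist Z z ` (mspace Z - V)) \<le> mdist Z z z"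
      using z \<open>z \<notin> V\<close> by (intro cINF_lower bdd) auto
    ultimately have "D V z \<le> 0" using z by (simp add: D_def)
    then show False using D0[OF V, of z] that by simp
  qed
  have Dlip: "D V z \<le> D V w + mdist Z z w" if V: "V \<in> \<V>" and zw: "z \<in> mspace Z" "w \<in> mspace Z" for V z w
  proof (cases "V = mspace Z")
    case True then show ?thesis by (simp add: D_def)
  next
    case False
    have "D V z - mdist Z z w \<le> Inf (mdist Z w ` (mspace Z - V))"
    proof (rule cINF_greatest[OF ne[OF V False]])
      fix y assume y: "y \<in> mspace Z - V"
      have "D V z \<le> mdist Z z y" using False y by (auto simp: D_def intro!: cINF_lower bdd)
      also have "\<dots> \<le> mdist Z z w + mdist Z w y" using zw y by (intro triangle) auto
      finally show "D V z - mdist Z z w \<le> mdist Z w y" by simp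
    qed
    then show ?thesis using False by (simp add: D_def)
  qed
  have Dcont: "continuous_map (mtopology_of Z) euclideanreal (D V)" if V: "V \<in> \<V>" for V
  proof -
    have "\<exists>U. openin mtopology U \<and> z \<in> U \<and> (\<forall>w\<in>U. D V w \<in> Met_TC.mball (D V z) e)" if z: "z \<in> mspace Z" and e: "0 < e" for z e
    proof (intro exI[of _ "mball z e"] conjI ballI)
      fix w assume w: "w \<in> mball z e"
      then have "\<bar>D V z - D V w\<bar> \<le> mdist Z z w"
        using Dlip[OF V z, of w] Dlip[OF V, of w z] z commute[of z w] by auto
      then show "D V w \<in> Met_TC.mball (D V z) e" using w by (simp add: Met_TC.mball_def dist_real_def)
    qed (use z e in auto)
    then have "continuous_map mtopology Met_TC.mtopology (D V)"
      unfolding Met_TC.continuous_map_to_metric by simp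
    then show ?thesis unfolding top by simp
  qed
  define T where "T z = (\<Sum>V\<in>\<V>. D V z)" for z
  have Tpos: "0 < T z" if z: "z \<in> mspace Z" for z
  proof -
    obtain V where "V \<in> \<V>" "z \<in> V" using cov z by auto
    then show ?thesis unfolding T_def using D0 Dpos fin by (intro sum_pos2[of _ V]) auto
  qed
  have Tcont: "continuous_map (mtopology_of Z) euclideanreal T"
    unfolding T_def using fin Dcont by (intro continuous_map_sum) auto
  show ?thesis
  proof (intro exI[of _ "\<lambda>V z. D V z / T z"] conjI ballI impI)
    fix V assume V: "V \<in> \<V>"
    show "continuous_map (mtopology_of Z) euclideanreal (\<lambda>z. D V z / T z)"
      using Tpos by (intro continuous_map_real_divide Dcont Tcont V) fastforce
    fix z assume z: "z \<in> mspace Z"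
    show "0 \<le> D V z / T z" using D0[OF V, of z] Tpos[OF z] by simp
    show "D V z / T z \<noteq> 0 \<Longrightarrow> z \<in> V" using Dzero[OF V z] by auto
  next
    fix z assume z: "z \<in> mspace Z"
    show "(\<Sum>V\<in>\<V>. D V z / T z) = 1"
      using Tpos[OF z] by (simp add: sum_divide_distrib[symmetric] T_def[symmetric])
  qed
qed

lemma C0_hs_sq:
  assumes "\<And>i j. i < n \<Longrightarrow> j < n \<Longrightarrow> (\<lambda>z. f z i j) \<in> C0_functions X"
  shows "(\<lambda>z. complex_of_real (hs_sq n (f z))) \<in> C0_functions X"
  unfolding hs_sq_def l2_sq_def of_real_sum complex_norm_square
  using assms by (intro C0_sum C0_mult C0_cnj) auto

lemma cmod_entry_hs_sq:
  assumes "i < n" "j < n"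
  shows "(cmod (M i j))\<^sup>2 \<le> hs_sq n M"
proof -
  have "(cmod (M i j))\<^sup>2 \<le> l2_sq n (M i)" unfolding l2_sq_def using assms by (intro member_le_sum) auto
  also have "\<dots> \<le> hs_sq n M" unfolding hs_sq_def using assms
    by (intro member_le_sum[of i _ "\<lambda>i. l2_sq n (M i)"]) (auto simp: l2_sq_def intro!: sum_nonneg)
  finally show ?thesis .
qed

lemma hs_sq_nonneg: "0 \<le> hs_sq n M"
  unfolding hs_sq_def l2_sq_def by (intro sum_nonneg) auto

text \<open>Outside a compact set \<open>f\<close> is small, so finitely many values of
  \<open>f\<close> together with the zero matrix approximate \<open>f\<close> everywhere, although
  the space need not be compact. Refine the resulting finite open cover and average the chosen
  matrices with a partition of unity: at most \<open>k\<close> terms are nonzero at each point. Here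
  \<open>k\<close> counts vertices, so the corresponding dimension is \<open>k - 1\<close>.\<close>

lemma simplicial_approximation:
  fixes Z :: "'z metric"
  assumes k: "covering_order_le (mtopology_of Z) k"
    and hermitian: "\<forall>z\<in>mspace Z. hermitian n (f z)"
    and C0: "\<forall>i<n. \<forall>j<n. (\<lambda>z. f z i j) \<in> C0_functions (mtopology_of Z)"
    and e: "0 < e"
  shows "\<exists>S f0. finite S \<and> (\<forall>s\<in>S. hermitian n s) \<and>
    (\<forall>i<n. \<forall>j<n. continuous_map (mtopology_of Z) euclidean (\<lambda>z. f0 z i j)) \<and>
    (\<forall>z\<in>mspace Z. \<forall>i<n. \<forall>j<n. cmod (f0 z i j - f z i j) \<le> e) \<and>
    (\<forall>z\<in>mspace Z. \<exists>\<tau> t. (\<forall>l<k. \<tau> l \<in> S) \<and> (\<forall>l<k. 0 \<le> t l \<and> t l \<le> (1::real)) \<and>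
        (\<forall>i j. f0 z i j = (\<Sum>l<k. of_real (t l) * \<tau> l i j)))"
proof -
  let ?X = "mtopology_of Z"
  note h = hermitian[rule_format] and f = C0[rule_format]
  define dif where "dif s z = hs_sq n (\<lambda>i j. f z i j - s i j)" for s z
  define U where "U s = {z \<in> topspace ?X. dif s z < e\<^sup>2}" for s
  have Uo: "openin ?X (U s)" for s
  proof -
    have "continuous_map ?X euclideanreal (dif s)"
      unfolding dif_def hs_sq_def l2_sq_def
      by (intro continuous_map_sum continuous_map_real_pow continuous_map_norm
          continuous_map_diff[OF C0_continuous[OF f] continuous_map_canonical_const]) auto
    then have "openin ?X {z \<in> topspace ?X. dif s z \<in> {..<e\<^sup>2}}"
      by (rule openin_continuous_map_preimage) auto
    then show ?thesis by (simp add: U_def)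
  qed
  have Ue: "cmod (s i j - f z i j) \<le> e" if "z \<in> U s" "i < n" "j < n" for s z i j
  proof -
    have "(cmod (f z i j - s i j))\<^sup>2 \<le> dif s z"
      unfolding dif_def using cmod_entry_hs_sq[OF that(2,3), of "\<lambda>i j. f z i j - s i j"] by simp
    also have "\<dots> < e\<^sup>2" using that by (simp add: U_def)
    finally have "cmod (f z i j - s i j) \<le> e" using e by (metis power2_less_imp_less less_imp_le)
    then show ?thesis by (simp add: norm_minus_commute)
  qed
  obtain K where K: "compactin ?X K" "\<And>z. z \<in> topspace ?X \<Longrightarrow> z \<notin> K \<Longrightarrow> cmod (complex_of_real (hs_sq n (f z))) < e\<^sup>2"
  proof -
    have "(\<lambda>z. complex_of_real (hs_sq n (f z))) \<in> C0_functions ?X" by (intro C0_hs_sq f)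
    from C0_vanish[OF this, of "e\<^sup>2"] that e show thesis by auto
  qed
  have KX: "K \<subseteq> topspace ?X" using K(1) compactin_subset_topspace by blast
  have "K \<subseteq> \<Union>((\<lambda>w. U (f w)) ` K)"
  proof
    fix z assume "z \<in> K"
    then have "z \<in> U (f z)" using KX e by (auto simp: U_def dif_def hs_sq_def l2_sq_def)
    then show "z \<in> \<Union>((\<lambda>w. U (f w)) ` K)" using \<open>z \<in> K\<close> by blast
  qed
  then obtain \<F> where \<F>: "finite \<F>" "\<F> \<subseteq> (\<lambda>w. U (f w)) ` K" "K \<subseteq> \<Union>\<F>"
  proof -
    have op: "\<forall>V\<in>(\<lambda>w. U (f w)) ` K. openin ?X V" using Uo by blast
    have "\<exists>\<F>. finite \<F> \<and> \<F> \<subseteq> (\<lambda>w. U (f w)) ` K \<and> K \<subseteq> \<Union>\<F>"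
      by (rule conjunct2[OF K(1)[unfolded compactin_def], rule_format])
        (use op \<open>K \<subseteq> \<Union>((\<lambda>w. U (f w)) ` K)\<close> in auto)
    then show thesis using that by blast
  qed
  then obtain W where W: "W \<subseteq> K" "finite W" "\<F> = (\<lambda>w. U (f w)) ` W"
    by (metis finite_subset_image)
  \<comment> \<open>The zero matrix serves the complement of the compact set
    \<open>K\<close>.\<close>
  define S where "S = insert (\<lambda>i j. 0) (f ` W)"
  have finS: "finite S" using W by (simp add: S_def)
  have hS: "hermitian n s" if "s \<in> S" for s
    using that h W(1) KX by (auto simp: S_def hermitian_def[of n "\<lambda>i j. 0"])
  have covU: "\<Union>(U ` S) = topspace ?X"
  proof
    show "\<Union>(U ` S) \<subseteq> topspace ?X" by (auto simp: U_def)
    show "topspace ?X \<subseteq> \<Union>(U ` S)"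
    proof
      fix z assume z: "z \<in> topspace ?X"
      show "z \<in> \<Union>(U ` S)"
      proof (cases "z \<in> K")
        case True then show ?thesis using \<F>(3) W by (auto simp: S_def)
      next
        case False
        then have "hs_sq n (f z) < e\<^sup>2" using K(2)[OF z] hs_sq_nonneg[of n "f z"] by simp
        then have "z \<in> U (\<lambda>i j. 0)" using z by (simp add: U_def dif_def)
        then show ?thesis by (auto simp: S_def)
      qed
    qed
  qed
  obtain \<V> where \<V>: "finite \<V>" "\<forall>V\<in>\<V>. openin ?X V" "\<Union>\<V> = topspace ?X"
    "\<forall>V\<in>\<V>. \<exists>U'\<in>U ` S. V \<subseteq> U'" "\<forall>\<W>\<subseteq>\<V>. card \<W> = Suc k \<longrightarrow> \<Inter>\<W> = {}"
  proof -
    have fUS: "finite (U ` S) \<and> (\<forall>V\<in>U ` S. openin ?X V) \<and> \<Union>(U ` S) = topspace ?X"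
      using finS Uo covU by blast
    show thesis
      using k[unfolded covering_order_le_def, rule_format, OF fUS] by (elim exE conjE) (rule that)
  qed
  have "\<forall>V\<in>\<V>. \<exists>s. s \<in> S \<and> V \<subseteq> U s" using \<V>(4) by blast
  then have "\<exists>F. \<forall>V\<in>\<V>. F V \<in> S \<and> V \<subseteq> U (F V)" by (rule bchoice)
  then obtain F where F: "\<And>V. V \<in> \<V> \<Longrightarrow> F V \<in> S \<and> V \<subseteq> U (F V)" by blast
  obtain lam where lam: "\<And>V. V \<in> \<V> \<Longrightarrow> continuous_map ?X euclideanreal (lam V)"
    "\<And>V z. V \<in> \<V> \<Longrightarrow> z \<in> mspace Z \<Longrightarrow> 0 \<le> lam V z \<and> (lam V z \<noteq> 0 \<longrightarrow> z \<in> V)"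
    "\<And>z. z \<in> mspace Z \<Longrightarrow> (\<Sum>V\<in>\<V>. lam V z) = 1"
  proof -
    have c: "\<Union>\<V> = mspace Z" using \<V>(3) by simp
    obtain l where l: "\<forall>V\<in>\<V>. continuous_map ?X euclideanreal (l V)"
      "\<forall>V\<in>\<V>. \<forall>z\<in>mspace Z. 0 \<le> l V z \<and> (l V z \<noteq> 0 \<longrightarrow> z \<in> V)"
      "\<forall>z\<in>mspace Z. (\<Sum>V\<in>\<V>. l V z) = 1"
      using subordinate_partition[OF \<V>(1,2) c] by (elim exE conjE) (rule that)
    show thesis by (rule that[of l]) (use l in blast)+
  qed
  define f0 where "f0 z i j = (\<Sum>V\<in>\<V>. of_real (lam V z) * F V i j)" for z i j
  have lam1: "lam V z \<le> 1" if "V \<in> \<V>" "z \<in> mspace Z" for V z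
  proof -
    have "lam V z \<le> (\<Sum>V\<in>\<V>. lam V z)" using that lam(2) \<V>(1) by (intro member_le_sum) auto
    then show ?thesis using lam(3)[OF that(2)] by simp
  qed
  have "continuous_map ?X euclidean (\<lambda>z. f0 z i j)" for i j
  proof -
    have "continuous_map ?X euclidean (\<lambda>z. complex_of_real (lam V z) * F V i j)" if V: "V \<in> \<V>" for V
    proof -
      have "continuous_map euclideanreal euclidean (\<lambda>x. complex_of_real x * F V i j)"
        by (auto intro!: continuous_intros)
      from continuous_map_compose[OF lam(1)[OF V] this] show ?thesis by (simp add: o_def)
    qed
    then show ?thesis unfolding f0_def using \<V>(1) by (intro continuous_map_sum) auto
  qed
  moreover have "cmod (f0 z i j - f z i j) \<le> e" if z: "z \<in> mspace Z" and ij: "i < n" "j < n" for z i j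
  proof -
    \<comment> \<open>As the weights sum to 1, \<open>f z\<close> is the same weighted average of
      copies of itself, so the terms can be compared one by one.\<close>
    have "f0 z i j - f z i j = f0 z i j - of_real (\<Sum>V\<in>\<V>. lam V z) * f z i j" using lam(3)[OF z] by simp
    also have "\<dots> = (\<Sum>V\<in>\<V>. of_real (lam V z) * (F V i j - f z i j))"
      unfolding f0_def by (simp add: sum_distrib_right sum_subtractf[symmetric] right_diff_distrib)
    also have "cmod \<dots> \<le> (\<Sum>V\<in>\<V>. lam V z * e)"
    proof (rule sum_norm_le)
      fix V assume V: "V \<in> \<V>"
      show "cmod (of_real (lam V z) * (F V i j - f z i j)) \<le> lam V z * e"
      proof (cases "lam V z = 0")
        case False
        then have "z \<in> U (F V)" using lam(2)[OF V z] F[OF V] by auto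
        from Ue[OF this ij] lam(2)[OF V z] show ?thesis by (auto simp: norm_mult intro!: mult_left_mono)
      qed simp
    qed
    also have "\<dots> = e" using lam(3)[OF z] by (simp add: sum_distrib_right[symmetric])
    finally show ?thesis .
  qed
  moreover have "\<exists>\<tau> t. (\<forall>l<k. \<tau> l \<in> S) \<and> (\<forall>l<k. 0 \<le> t l \<and> t l \<le> (1::real)) \<and>
        (\<forall>i j. f0 z i j = (\<Sum>l<k. of_real (t l) * \<tau> l i j))" if z: "z \<in> mspace Z" for z
  proof -
    define N where "N = {V \<in> \<V>. z \<in> V}"
    have finN: "finite N" using \<V>(1) by (simp add: N_def)
    have cN: "card N \<le> k"
    proof (rule ccontr)
      assume "\<not> card N \<le> k"
      then obtain \<W> where "\<W> \<subseteq> N" "card \<W> = Suc k"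
        by (metis not_less_eq_eq obtain_subset_with_card_n)
      then have "\<Inter>\<W> = {}" "z \<in> \<Inter>\<W>" using \<V>(5) by (auto simp: N_def subset_iff)
      then show False by auto
    qed
    obtain g where g: "bij_betw g {..<card N} N"
      using ex_bij_betw_nat_finite[OF finN] by (auto simp: atLeast0LessThan)
    \<comment> \<open>Fewer than \<open>k\<close> terms are padded with coefficient 0 and the zero
      matrix, which belongs to \<open>S\<close>.\<close>
    define t where "t l = (if l < card N then lam (g l) z else 0)" for l
    define \<tau> where "\<tau> l = (if l < card N then F (g l) else (\<lambda>i j. 0))" for l
    have gN: "g l \<in> \<V>" if "l < card N" for l using g that unfolding bij_betw_def N_def by blast
    have "f0 z i j = (\<Sum>l<k. of_real (t l) * \<tau> l i j)" for i j
    proof -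
      have "f0 z i j = (\<Sum>V\<in>N. of_real (lam V z) * F V i j)"
        unfolding f0_def using lam(2)[OF _ z] \<V>(1) by (intro sum.mono_neutral_right) (auto simp: N_def)
      also have "\<dots> = (\<Sum>l<card N. of_real (lam (g l) z) * F (g l) i j)"
        by (rule sum.reindex_bij_betw[OF g, symmetric])
      also have "\<dots> = (\<Sum>l<card N. of_real (t l) * \<tau> l i j)" by (simp add: t_def \<tau>_def)
      also have "\<dots> = (\<Sum>l<k. of_real (t l) * \<tau> l i j)"
        using cN by (intro sum.mono_neutral_left) (auto simp: t_def)
      finally show ?thesis .
    qed
    moreover have "\<tau> l \<in> S" for l using F gN by (auto simp: \<tau>_def S_def)
    moreover have "0 \<le> t l \<and> t l \<le> 1" for l using lam(2)[OF gN z] lam1[OF gN z] by (auto simp: t_def)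
    ultimately show ?thesis by blast
  qed
  ultimately show ?thesis using finS hS by (intro exI[of _ S] exI[of _ f0] conjI ballI allI impI) simp_all
qed

text \<open>The shifted function \<open>f0 + P\<close> need not vanish at infinity and is multiplied
  by a cut-off \<open>\<theta>\<close>. The cut-off differs from 1 only where \<open>f\<close> and
  \<open>g\<close> are both small: there smallness of \<open>f\<close> keeps \<open>b\<close> close
  to \<open>f\<close>, and smallness of \<open>g\<close> is the second alternative of the
  conclusion. Elsewhere \<open>b = f0 + P\<close> inherits the corank bound of
  \<open>generic_shift\<close>.\<close>

lemma generic_perturbation:
  fixes Z :: "'z metric"
  assumes k: "covering_order_le (mtopology_of Z) k"
    and hermitian: "\<forall>z\<in>mspace Z. hermitian n (f z)"
    and C0: "\<forall>i<n. \<forall>j<n. (\<lambda>z. f z i j) \<in> C0_functions (mtopology_of Z)"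
    and C0': "\<forall>i<n. \<forall>j<n. (\<lambda>z. g z i j) \<in> C0_functions (mtopology_of Z)"
    and e: "0 < e" and \<kappa>: "0 < \<kappa>" and r: "r \<le> n" "k < r\<^sup>2"
  shows "\<exists>b \<eta>. 0 < \<eta> \<and> (\<forall>z\<in>mspace Z. hermitian n (b z)) \<and>
    (\<forall>i<n. \<forall>j<n. (\<lambda>z. b z i j) \<in> C0_functions (mtopology_of Z)) \<and>
    (\<forall>z\<in>mspace Z. \<forall>i<n. \<forall>j<n. cmod (b z i j - f z i j) \<le> e) \<and>
    (\<forall>z\<in>mspace Z. (\<forall>u d. spectral n (b z) u d \<longrightarrow> card {l. l < n \<and> \<bar>d l\<bar> \<le> \<eta>} < r) \<or> hs_sq n (g z) \<le> \<kappa>)"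
proof -
  let ?X = "mtopology_of Z"
  note h = hermitian[rule_format] and f = C0[rule_format] and g = C0'[rule_format]
  have e4: "0 < e / 4" using e by simp
  obtain S f0 where S: "finite S" "\<forall>s\<in>S. hermitian n s"
    and f0c: "\<forall>i<n. \<forall>j<n. continuous_map ?X euclidean (\<lambda>z. f0 z i j)"
    and f0f: "\<forall>z\<in>mspace Z. \<forall>i<n. \<forall>j<n. cmod (f0 z i j - f z i j) \<le> e / 4"
    and f0s: "\<forall>z\<in>mspace Z. \<exists>\<tau> t. (\<forall>l<k. \<tau> l \<in> S) \<and> (\<forall>l<k. 0 \<le> t l \<and> t l \<le> (1::real)) \<and>
        (\<forall>i j. f0 z i j = (\<Sum>l<k. of_real (t l) * \<tau> l i j))"
    using simplicial_approximation[OF k hermitian C0 e4] by (elim exE conjE) (rule that)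
  have "\<exists>P \<eta>. hermitian n P \<and> (\<forall>i<n. \<forall>j<n. cmod (P i j) \<le> e / 4) \<and> 0 < \<eta> \<and>
    (\<forall>\<tau> t u d. (\<forall>l<k. \<tau> l \<in> S) \<longrightarrow> (\<forall>l<k. 0 \<le> t l \<and> t l \<le> 1) \<longrightarrow>
       spectral n (\<lambda>i j. (\<Sum>l<k. of_real (t l) * \<tau> l i j) + P i j) u d \<longrightarrow>
       card {l. l < n \<and> \<bar>d l\<bar> \<le> \<eta>} < r)"
    using generic_shift[of S n "\<lambda>s. s" r k "e / 4"] S r e4 by auto
  then obtain P \<eta> where P: "hermitian n P" "\<forall>i<n. \<forall>j<n. cmod (P i j) \<le> e / 4" "0 < \<eta>"
    and Pg: "\<forall>\<tau> t u d. (\<forall>l<k. \<tau> l \<in> S) \<longrightarrow> (\<forall>l<k. 0 \<le> t l \<and> t l \<le> 1) \<longrightarrow>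
       spectral n (\<lambda>i j. (\<Sum>l<k. of_real (t l) * \<tau> l i j) + P i j) u d \<longrightarrow>
       card {l. l < n \<and> \<bar>d l\<bar> \<le> \<eta>} < r" by (elim exE conjE) (rule that)
  define \<psi> where "\<psi> z = hs_sq n (f z) + hs_sq n (g z)" for z
  \<comment> \<open>One bound keeps \<open>hs_sq n (g z)\<close> below \<open>\<kappa>\<close>, the
    other keeps the entries of \<open>f z\<close> below \<open>e / 4\<close> wherever the cut-off
    acts.\<close>
  define \<kappa>' where "\<kappa>' = min \<kappa> ((e / 4)\<^sup>2)"
  have \<kappa>': "0 < \<kappa>'" using \<kappa> e by (simp add: \<kappa>'_def)
  have \<psi>0: "0 \<le> \<psi> z" for z by (simp add: \<psi>_def hs_sq_nonneg)
  define \<theta> where "\<theta> z = min 1 (\<psi> z / \<kappa>')" for z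
  have \<theta>: "0 \<le> \<theta> z" "\<theta> z \<le> 1" for z using \<psi>0[of z] \<kappa>' by (auto simp: \<theta>_def)
  have \<theta>C0: "(\<lambda>z. complex_of_real (\<theta> z)) \<in> C0_functions ?X"
  proof -
    have "(\<lambda>z. complex_of_real (\<psi> z)) \<in> C0_functions ?X"
      unfolding \<psi>_def of_real_add by (intro C0_add C0_hs_sq f g)
    then have "(\<lambda>z. complex_of_real (min 1 (cmod (complex_of_real (\<psi> z)) / \<kappa>'))) \<in> C0_functions ?X"
      by (rule C0_comp[where k = "\<lambda>w. complex_of_real (min 1 (cmod w / \<kappa>'))"]) (use \<kappa>' in \<open>auto intro!: continuous_intros\<close>)
    then show ?thesis using \<psi>0 by (simp add: \<theta>_def)
  qed
  define b where "b z i j = complex_of_real (\<theta> z) * (f0 z i j + P i j)" for z i j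
  have "hermitian n (b z)" if z: "z \<in> mspace Z" for z
    unfolding hermitian_def
  proof (intro allI impI)
    fix i j assume ij: "i < n" "j < n"
    obtain \<tau> t where \<tau>: "\<forall>l<k. \<tau> l \<in> S" and eq: "\<forall>i j. f0 z i j = (\<Sum>l<k. of_real (t l :: real) * \<tau> l i j)"
      using f0s z by blast
    have "cnj (\<tau> l i j) = \<tau> l j i" if "l < k" for l
      using S(2) \<tau> that by (intro hermitianD[OF _ ij]) auto
    then have "cnj (f0 z i j) = f0 z j i" using eq by simp
    then show "b z j i = cnj (b z i j)" unfolding b_def using hermitianD[OF P(1) ij] by simp
  qed
  moreover have "(\<lambda>z. b z i j) \<in> C0_functions ?X" if ij: "i < n" "j < n" for i j
  proof -
    obtain c where c: "\<And>z. z \<in> topspace ?X \<Longrightarrow> cmod (f z i j) \<le> c" using C0_bounded[OF f[OF ij]] by blast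
    show ?thesis unfolding b_def
    proof (rule C0_mult_bounded[OF \<theta>C0, where b = "c + e / 4 + e / 4"])
      show "continuous_map ?X euclidean (\<lambda>z. f0 z i j + P i j)"
        using f0c ij by (intro continuous_map_add) auto
      fix z assume z: "z \<in> topspace ?X"
      have "cmod (f0 z i j - f z i j) \<le> e / 4" "cmod (P i j) \<le> e / 4" using f0f P(2) z ij by auto
      then show "cmod (f0 z i j + P i j) \<le> c + e / 4 + e / 4"
        using c[OF z] norm_triangle_ineq[of "f0 z i j" "P i j"] norm_triangle_ineq[of "f0 z i j - f z i j" "f z i j"] by simp
    qed
  qed
  moreover have "cmod (b z i j - f z i j) \<le> e" if z: "z \<in> mspace Z" and ij: "i < n" "j < n" for z i j
  proof -
    have 1: "cmod (f0 z i j - f z i j) \<le> e / 4" "cmod (P i j) \<le> e / 4" using f0f P(2) z ij by auto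
    show ?thesis
    proof (cases "\<psi> z < \<kappa>'")
      case True
      have "(cmod (f z i j))\<^sup>2 \<le> \<psi> z" unfolding \<psi>_def using cmod_entry_hs_sq[OF ij, of "f z"] hs_sq_nonneg[of n "g z"] by linarith
      also have "\<dots> \<le> (e / 4)\<^sup>2" using True by (simp add: \<kappa>'_def)
      finally have 2: "cmod (f z i j) \<le> e / 4" by (rule power2_le_imp_le) (use e in simp)
      have "cmod (b z i j) \<le> cmod (f0 z i j + P i j)"
        unfolding b_def norm_mult using \<theta>[of z] by (simp add: mult_left_le_one_le)
      then show ?thesis
        using 1 2 norm_triangle_ineq[of "f0 z i j" "P i j"] norm_triangle_ineq[of "f0 z i j - f z i j" "f z i j"]
          norm_triangle_ineq4[of "b z i j" "f z i j"] by simp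
    next
      case False
      then have "\<theta> z = 1" using \<kappa>' by (simp add: \<theta>_def)
      then have eq: "b z i j - f z i j = (f0 z i j - f z i j) + P i j" by (simp add: b_def)
      show ?thesis unfolding eq using 1 norm_triangle_ineq[of "f0 z i j - f z i j" "P i j"] e by linarith
    qed
  qed
  moreover have "(\<forall>u d. spectral n (b z) u d \<longrightarrow> card {l. l < n \<and> \<bar>d l\<bar> \<le> \<eta>} < r) \<or> hs_sq n (g z) \<le> \<kappa>"
    if z: "z \<in> mspace Z" for z
  proof (cases "\<psi> z < \<kappa>'")
    case True
    then show ?thesis using hs_sq_nonneg[of n "f z"] by (simp add: \<psi>_def \<kappa>'_def)
  next
    case False
    then have "\<theta> z = 1" using \<kappa>' by (simp add: \<theta>_def)
    obtain \<tau> t where \<tau>: "\<forall>l<k. \<tau> l \<in> S" "\<forall>l<k. 0 \<le> t l \<and> t l \<le> (1::real)"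
      and eq: "\<forall>i j. f0 z i j = (\<Sum>l<k. of_real (t l) * \<tau> l i j)"
      using f0s z by blast
    have "b z = (\<lambda>i j. (\<Sum>l<k. of_real (t l) * \<tau> l i j) + P i j)"
      using \<open>\<theta> z = 1\<close> eq by (simp add: b_def fun_eq_iff)
    then show ?thesis using Pg \<tau> by auto
  qed
  ultimately show ?thesis using P(3) by (intro exI[of _ b] exI[of _ \<eta>] conjI ballI allI impI) simp_all
qed

section \<open>Trace norms\<close>

text \<open>If \<open>x\<close> exceeded \<open>y\<close>, the ratio of the powers would be
  unbounded in \<open>k\<close>; constant factors therefore disappear on taking roots.\<close>

lemma doubling_powers_le:
  fixes x y \<beta> C :: real
  assumes le: "\<And>k. \<beta> * x ^ (2 ^ k) \<le> C * y ^ (2 ^ k)" and \<beta>: "0 < \<beta>" and xy: "0 \<le> x" "0 \<le> y"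
  shows "x \<le> y"
proof (rule ccontr)
  assume "\<not> x \<le> y"
  then have yx: "y < x" by simp
  have "0 < y"
  proof (rule ccontr)
    assume "\<not> 0 < y"
    then have "y = 0" using xy by simp
    then have "\<beta> * x \<le> 0" using le[of 0] by simp
    then show False using \<beta> yx \<open>y = 0\<close> by (simp add: mult_le_0_iff)
  qed
  have "1 < x / y" using yx \<open>0 < y\<close> by simp
  then obtain k where k: "C / \<beta> < (x / y) ^ k" using real_arch_pow by blast
  also have "\<dots> \<le> (x / y) ^ (2 ^ k)"
    using \<open>1 < x / y\<close> by (intro power_increasing less_imp_le[OF less_exp]) auto
  finally have "C / \<beta> < x ^ (2 ^ k) / y ^ (2 ^ k)" by (simp add: power_divide)
  then have "C * y ^ (2 ^ k) < \<beta> * x ^ (2 ^ k)"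
    using \<beta> \<open>0 < y\<close> by (simp add: field_simps)
  then show False using le[of k] by simp
qed

text \<open>Reality at \<open>l = 1\<close> and \<open>l = \<i>\<close> gives the symmetry. For the
  inequality put \<open>l = - s b\<close>: the best \<open>s\<close> is \<open>1 / Re c\<close>, and
  for \<open>Re c = 0\<close> a large \<open>s\<close> forces \<open>b = 0\<close>.\<close>

lemma nonneg_quadratic_form:
  fixes a b b' c :: complex
  assumes pos: "\<And>l :: complex. a + cnj l * b + l * b' + of_real ((cmod l)\<^sup>2) * c \<in> \<real> \<and>
      0 \<le> Re (a + cnj l * b + l * b' + of_real ((cmod l)\<^sup>2) * c)"
    and a: "a \<in> \<real>" "0 \<le> Re a" and c: "c \<in> \<real>" "0 \<le> Re c"
  shows "b' = cnj b" "(cmod b)\<^sup>2 \<le> Re a * Re c"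
proof -
  have im: "Im a = 0" "Im c = 0" using a c by (auto simp: complex_is_Real_iff)
  have "Im (b + b') = 0" using pos[of 1] im by (simp add: complex_is_Real_iff)
  moreover have "Re b' = Re b" using pos[of \<i>] im by (simp add: complex_is_Real_iff)
  ultimately show b': "b' = cnj b" by (simp add: complex_eq_iff)
  define B where "B = (cmod b)\<^sup>2"
  have q: "0 \<le> Re a - 2 * s * B + s\<^sup>2 * B * Re c" for s :: real
  proof -
    have bb: "cnj b * b = of_real B" "b * cnj b = of_real B"
      unfolding B_def by (metis complex_norm_square mult.commute)+
    have eq: "a + cnj (- of_real s * b) * b + (- of_real s * b) * b' + of_real ((cmod (- of_real s * b))\<^sup>2) * c
       = a - of_real s * (cnj b * b) - of_real s * (b * cnj b) + of_real (s\<^sup>2 * B) * c"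
      unfolding b' by (simp add: norm_mult power_mult_distrib B_def mult.assoc)
    have "0 \<le> Re (a - of_real s * (cnj b * b) - of_real s * (b * cnj b) + of_real (s\<^sup>2 * B) * c)"
      using conjunct2[OF pos[of "- of_real s * b", unfolded eq]] .
    then show ?thesis unfolding bb by (simp add: im mult_ac)
  qed
  have "0 \<le> B" by (simp add: B_def)
  show "(cmod b)\<^sup>2 \<le> Re a * Re c"
    unfolding B_def[symmetric]
  proof (cases "Re c = 0")
    case True
    have "B = 0"
    proof (rule ccontr)
      assume "B \<noteq> 0"
      then show False using q[of "(Re a + 1) / (2 * B)"] True by simp
    qed
    then show "B \<le> Re a * Re c" using a c by simp
  next
    case False
    then have c0: "0 < Re c" using c by simp
    have "0 \<le> Re a - 2 * (1 / Re c) * B + (1 / Re c)\<^sup>2 * B * Re c" by (rule q)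
    also have "\<dots> = Re a - B / Re c" using c0 by (simp add: power2_eq_square field_simps)
    finally show "B \<le> Re a * Re c" using c0 by (simp add: field_simps)
  qed
qed

section \<open>Elementary facts on unital C*-algebras\<close>

context unital_cstar_algebra
begin

lemma add_closed: "x \<in> carrier A \<Longrightarrow> y \<in> carrier A \<Longrightarrow> x \<oplus> y \<in> carrier A"
  by (rule M.a_closed)

lemma scale_closed: "x \<in> carrier A \<Longrightarrow> c \<odot> x \<in> carrier A"
  by (rule smult_closed) auto

lemma unit_closed: "\<one> \<in> carrier A"
  by (rule one_closed)

lemmas closed = add_closed scale_closed unit_closed mult_closed adj_closed M.zero_closed

lemma scale_add: "x \<in> carrier A \<Longrightarrow> (c + d) \<odot> x = c \<odot> x \<oplus> d \<odot> x"
  using smult_l_distr[of c d x] by simp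

lemma scale_add_right: "x \<in> carrier A \<Longrightarrow> y \<in> carrier A \<Longrightarrow> c \<odot> (x \<oplus> y) = c \<odot> x \<oplus> c \<odot> y"
  using smult_r_distr[of c x y] by simp

lemma scale_scale: "x \<in> carrier A \<Longrightarrow> c \<odot> (d \<odot> x) = (c * d) \<odot> x"
  using smult_assoc1[of c d x] by simp

lemma scale_one: "x \<in> carrier A \<Longrightarrow> 1 \<odot> x = x"
  using smult_one[of x] by simp

lemma scale_zero: "x \<in> carrier A \<Longrightarrow> 0 \<odot> x = \<zero>"
  using smult_l_null[of x] by simp

lemma neg_scale: "x \<in> carrier A \<Longrightarrow> \<ominus> x = (-1) \<odot> x"
proof -
  assume x: "x \<in> carrier A"
  have "(-1) \<odot> x \<oplus> x = (-1 + 1) \<odot> x" using x by (simp only: scale_add scale_one)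
  then have "(-1) \<odot> x \<oplus> x = \<zero>" using x by (simp add: scale_zero)
  then show ?thesis using x scale_closed by (metis M.minus_equality)
qed

lemma diff_scale: "x \<in> carrier A \<Longrightarrow> y \<in> carrier A \<Longrightarrow> x \<ominus> y = x \<oplus> (-1) \<odot> y"
  by (simp add: a_minus_def neg_scale)

lemma diff_closed: "x \<in> carrier A \<Longrightarrow> y \<in> carrier A \<Longrightarrow> x \<ominus> y \<in> carrier A"
  by (simp add: diff_scale closed)

lemma adj_one: "adj A \<one> = \<one>"
  by (metis adj_adj adj_closed adj_mult l_one r_one one_closed)

lemma alg_norm_nonneg:
  assumes "x \<in> carrier A"
  shows "0 \<le> alg_norm A x"
proof -
  have "alg_norm A (x \<oplus> (-1) \<odot> x) \<le> alg_norm A x + alg_norm A ((-1) \<odot> x)"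
    using assms by (intro norm_triangle closed)
  moreover have "x \<oplus> (-1) \<odot> x = \<zero>"
    using assms by (metis neg_scale M.r_neg)
  moreover have "alg_norm A \<zero> = 0" using norm_eq_zero M.zero_closed by blast
  ultimately show ?thesis using assms norm_smult[of x "-1"] by simp
qed

lemma alg_norm_adj_le:
  assumes "x \<in> carrier A"
  shows "alg_norm A x \<le> alg_norm A (adj A x)"
proof (cases "alg_norm A x = 0")
  case True then show ?thesis using alg_norm_nonneg[OF adj_closed[OF assms]] by simp
next
  case False
  then have p: "0 < alg_norm A x" using alg_norm_nonneg[OF assms] by simp
  have "alg_norm A x * alg_norm A x \<le> alg_norm A (adj A x) * alg_norm A x"
    using cstar_identity[OF assms] norm_mult[OF adj_closed[OF assms] assms] by (simp add: power2_eq_square)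
  then show ?thesis using p by simp
qed

lemma alg_norm_adj: "x \<in> carrier A \<Longrightarrow> alg_norm A (adj A x) = alg_norm A x"
  using alg_norm_adj_le[of x] alg_norm_adj_le[of "adj A x"] adj_adj[of x] adj_closed[of x] by force

text \<open>Only an inequality, because the zero algebra is not excluded by the locale.\<close>

lemma alg_norm_one_le: "alg_norm A \<one> \<le> 1"
proof -
  have "(alg_norm A \<one>)\<^sup>2 = alg_norm A \<one>"
    using cstar_identity[OF unit_closed] by (simp add: adj_one)
  then have "alg_norm A \<one> = 0 \<or> alg_norm A \<one> = 1" by (simp add: power2_eq_square)
  then show ?thesis by auto
qed

lemma alg_norm_isometry:
  assumes "U \<in> carrier A" "adj A U \<otimes> U = \<one>"
  shows "alg_norm A U \<le> 1"
proof -
  have "(alg_norm A U)\<^sup>2 \<le> 1\<^sup>2" using cstar_identity[OF assms(1)] assms(2) alg_norm_one_le by simp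
  then show ?thesis by (rule power2_le_imp_le) simp
qed

section \<open>The seminorm of a single tracial state\<close>

context
  fixes \<tau>
  assumes \<tau>: "\<tau> \<in> tracial_states A"
begin

lemma tr_add: "x \<in> carrier A \<Longrightarrow> y \<in> carrier A \<Longrightarrow> \<tau> (x \<oplus> y) = \<tau> x + \<tau> y"
  using \<tau> unfolding tracial_states_def by auto

lemma tr_scale: "x \<in> carrier A \<Longrightarrow> \<tau> (c \<odot> x) = c * \<tau> x"
  using \<tau> unfolding tracial_states_def by auto

lemma tr_commute: "x \<in> carrier A \<Longrightarrow> y \<in> carrier A \<Longrightarrow> \<tau> (x \<otimes> y) = \<tau> (y \<otimes> x)"
  using \<tau> unfolding tracial_states_def by auto

lemma tr_pos: "x \<in> carrier A \<Longrightarrow> \<tau> (adj A x \<otimes> x) \<in> \<real> \<and> 0 \<le> Re (\<tau> (adj A x \<otimes> x))"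
  using \<tau> unfolding tracial_states_def by auto

lemma tr_bound:
  assumes x: "x \<in> carrier A"
  shows "cmod (\<tau> x) \<le> alg_norm A x"
proof (cases "x = \<zero>")
  case True
  then have "\<tau> x = 0" using tr_scale[OF x, of 0] x by (simp add: scale_zero)
  then show ?thesis using alg_norm_nonneg[OF x] by simp
next
  case False
  then have p: "0 < alg_norm A x" using alg_norm_nonneg[OF x] norm_eq_zero[OF x] by linarith
  let ?c = "complex_of_real (1 / alg_norm A x)"
  have "?c \<odot> x \<in> contractions A"
    unfolding contractions_def using p x by (simp add: closed norm_smult norm_divide)
  moreover have "bdd_above ((\<lambda>x. cmod (\<tau> x)) ` contractions A)" "(SUP x\<in>contractions A. cmod (\<tau> x)) = 1"
    using \<tau> unfolding tracial_states_def by auto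
  ultimately have "cmod (\<tau> (?c \<odot> x)) \<le> 1" by (metis cSUP_upper)
  then show ?thesis using p tr_scale[OF x, of ?c] by (simp add: norm_mult norm_divide)
qed

lemma tr_sesquilinear:
  assumes x: "x \<in> carrier A" and y: "y \<in> carrier A"
  shows "\<tau> (adj A (x \<oplus> c \<odot> y) \<otimes> (x \<oplus> c \<odot> y))
    = \<tau> (adj A x \<otimes> x) + cnj c * \<tau> (adj A y \<otimes> x) + c * \<tau> (adj A x \<otimes> y) + of_real ((cmod c)\<^sup>2) * \<tau> (adj A y \<otimes> y)"
proof -
  have cc: "of_real ((cmod c)\<^sup>2) = c * cnj c" by (rule complex_norm_square)
  have "adj A (x \<oplus> c \<odot> y) \<otimes> (x \<oplus> c \<odot> y)
     = (adj A x \<otimes> x \<oplus> cnj c \<odot> (adj A y \<otimes> x)) \<oplus> (c \<odot> (adj A x \<otimes> y) \<oplus> (c * cnj c) \<odot> (adj A y \<otimes> y))"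
    using x y by (simp add: closed adj_add adj_smult mult_add_left mult_add_right smult_mult_left smult_mult_right scale_scale scale_add_right)
  then show ?thesis unfolding cc using x y by (simp add: closed tr_add tr_scale algebra_simps)
qed

lemma
  assumes x: "x \<in> carrier A" and y: "y \<in> carrier A"
  shows tr_hermitian: "\<tau> (adj A x \<otimes> y) = cnj (\<tau> (adj A y \<otimes> x))"
    and tr_cauchy_schwarz: "(cmod (\<tau> (adj A y \<otimes> x)))\<^sup>2 \<le> Re (\<tau> (adj A x \<otimes> x)) * Re (\<tau> (adj A y \<otimes> y))"
proof -
  have *: "\<tau> (adj A x \<otimes> x) + cnj l * \<tau> (adj A y \<otimes> x) + l * \<tau> (adj A x \<otimes> y) + of_real ((cmod l)\<^sup>2) * \<tau> (adj A y \<otimes> y) \<in> \<real> \<and>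
      0 \<le> Re (\<tau> (adj A x \<otimes> x) + cnj l * \<tau> (adj A y \<otimes> x) + l * \<tau> (adj A x \<otimes> y) + of_real ((cmod l)\<^sup>2) * \<tau> (adj A y \<otimes> y))" for l
    unfolding tr_sesquilinear[OF x y, symmetric] using x y by (intro tr_pos closed)
  show "\<tau> (adj A x \<otimes> y) = cnj (\<tau> (adj A y \<otimes> x))"
    by (rule nonneg_quadratic_form(1)[OF *]) (use tr_pos x y in auto)
  show "(cmod (\<tau> (adj A y \<otimes> x)))\<^sup>2 \<le> Re (\<tau> (adj A x \<otimes> x)) * Re (\<tau> (adj A y \<otimes> y))"
    by (rule nonneg_quadratic_form(2)[OF *]) (use tr_pos x y in auto)
qed

lemma trace_norm2_sq: "x \<in> carrier A \<Longrightarrow> (trace_norm2 A \<tau> x)\<^sup>2 = Re (\<tau> (adj A x \<otimes> x))"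
  unfolding trace_norm2_def using tr_pos by simp

lemma trace_norm2_nonneg: "x \<in> carrier A \<Longrightarrow> 0 \<le> trace_norm2 A \<tau> x"
  unfolding trace_norm2_def using tr_pos by simp

lemma trace_norm2_le_norm:
  assumes x: "x \<in> carrier A"
  shows "trace_norm2 A \<tau> x \<le> alg_norm A x"
proof (rule power2_le_imp_le)
  have "(trace_norm2 A \<tau> x)\<^sup>2 \<le> cmod (\<tau> (adj A x \<otimes> x))"
    unfolding trace_norm2_sq[OF x] by (rule complex_Re_le_cmod)
  also have "\<dots> \<le> (alg_norm A x)\<^sup>2"
    using tr_bound[of "adj A x \<otimes> x"] x by (simp add: closed cstar_identity)
  finally show "(trace_norm2 A \<tau> x)\<^sup>2 \<le> (alg_norm A x)\<^sup>2" .
qed (rule alg_norm_nonneg[OF x])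

lemma trace_norm2_triangle:
  assumes x: "x \<in> carrier A" and y: "y \<in> carrier A"
  shows "trace_norm2 A \<tau> (x \<oplus> y) \<le> trace_norm2 A \<tau> x + trace_norm2 A \<tau> y"
proof (rule power2_le_imp_le)
  let ?N = "trace_norm2 A \<tau>"
  have "cmod (\<tau> (adj A y \<otimes> x)) \<le> ?N x * ?N y"
  proof (rule power2_le_imp_le)
    show "(cmod (\<tau> (adj A y \<otimes> x)))\<^sup>2 \<le> (?N x * ?N y)\<^sup>2"
      unfolding power_mult_distrib trace_norm2_sq[OF x] trace_norm2_sq[OF y] by (rule tr_cauchy_schwarz[OF x y])
  qed (use trace_norm2_nonneg x y in simp)
  then have "Re (\<tau> (adj A y \<otimes> x)) \<le> ?N x * ?N y" using complex_Re_le_cmod order.trans by blast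
  moreover have "(?N (x \<oplus> y))\<^sup>2 = (?N x)\<^sup>2 + 2 * Re (\<tau> (adj A y \<otimes> x)) + (?N y)\<^sup>2"
    using tr_sesquilinear[OF x y, of 1] tr_hermitian[OF x y] x y
    by (simp add: trace_norm2_sq closed scale_one)
  ultimately show "(?N (x \<oplus> y))\<^sup>2 \<le> (?N x + ?N y)\<^sup>2" by (simp add: power2_sum)
qed (use trace_norm2_nonneg x y in simp)

lemma trace_norm2_adj: "x \<in> carrier A \<Longrightarrow> trace_norm2 A \<tau> (adj A x) = trace_norm2 A \<tau> x"
  unfolding trace_norm2_def using tr_commute[of x "adj A x"] by (simp add: adj_adj closed)

lemma trace_norm2_scale:
  assumes x: "x \<in> carrier A"
  shows "trace_norm2 A \<tau> (c \<odot> x) = cmod c * trace_norm2 A \<tau> x"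
proof -
  have "adj A (c \<odot> x) \<otimes> (c \<odot> x) = (c * cnj c) \<odot> (adj A x \<otimes> x)"
    using x by (simp add: closed adj_smult smult_mult_left smult_mult_right scale_scale mult.commute)
  then have "\<tau> (adj A (c \<odot> x) \<otimes> (c \<odot> x)) = of_real ((cmod c)\<^sup>2) * \<tau> (adj A x \<otimes> x)"
    using x by (simp only: tr_scale closed complex_norm_square)
  then show ?thesis unfolding trace_norm2_def by (simp add: real_sqrt_mult)
qed

text \<open>Iterating Cauchy-Schwarz along \<open>h, h\<^sup>2, h\<^sup>4, \<dots>\<close> with \<open>h = a* a\<close> avoids a square root of
  \<open>\<parallel>a\<parallel>\<^sup>2 - a* a\<close>.\<close>

lemma trace_norm2_mult_left:
  assumes a: "a \<in> carrier A" and b: "b \<in> carrier A"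
  shows "trace_norm2 A \<tau> (a \<otimes> b) \<le> alg_norm A a * trace_norm2 A \<tau> b"
proof -
  define h where "h = rec_nat (adj A a \<otimes> a) (\<lambda>_ x. x \<otimes> x)"
  have h0: "h 0 = adj A a \<otimes> a" and hS: "h (Suc k) = h k \<otimes> h k" for k by (simp_all add: h_def)
  have hc: "h k \<in> carrier A" for k by (induction k) (auto simp: h0 hS closed a)
  have hsa: "adj A (h k) = h k" for k
    by (induction k) (simp_all add: h0 hS adj_mult hc closed a adj_adj)
  define M where "M = (alg_norm A a)\<^sup>2"
  have M0: "0 \<le> M" by (simp add: M_def)
  have hn: "alg_norm A (h k) \<le> M ^ (2 ^ k)" for k
  proof (induction k)
    case 0 show ?case by (simp add: h0 cstar_identity a M_def)
  next
    case (Suc k)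
    have "alg_norm A (h (Suc k)) \<le> alg_norm A (h k) * alg_norm A (h k)"
      unfolding hS by (rule norm_mult[OF hc hc])
    also have "\<dots> \<le> M ^ (2 ^ k) * M ^ (2 ^ k)"
      using Suc alg_norm_nonneg[OF hc] M0 by (intro mult_mono) auto
    also have "\<dots> = M ^ (2 ^ Suc k)" by (simp add: power_add[symmetric] mult_2)
    finally show ?case .
  qed
  define f where "f k = cmod (\<tau> (adj A b \<otimes> (h k \<otimes> b)))" for k
  define \<beta> where "\<beta> = Re (\<tau> (adj A b \<otimes> b))"
  have \<beta>0: "0 \<le> \<beta>" using tr_pos[OF b] by (simp add: \<beta>_def)
  have fS: "(f k)\<^sup>2 \<le> \<beta> * f (Suc k)" for k
  proof -
    have "(f k)\<^sup>2 \<le> Re (\<tau> (adj A (h k \<otimes> b) \<otimes> (h k \<otimes> b))) * \<beta>"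
      unfolding f_def \<beta>_def by (rule tr_cauchy_schwarz) (use hc b closed in auto)
    also have "adj A (h k \<otimes> b) \<otimes> (h k \<otimes> b) = adj A b \<otimes> (h (Suc k) \<otimes> b)"
      using hc b by (simp add: adj_mult hsa hS mult_assoc closed)
    also have "Re (\<tau> (adj A b \<otimes> (h (Suc k) \<otimes> b))) * \<beta> \<le> f (Suc k) * \<beta>"
      unfolding f_def using \<beta>0 by (intro mult_right_mono complex_Re_le_cmod)
    finally show ?thesis by (simp add: mult.commute)
  qed
  \<comment> \<open>This is \<open>f 0 ^ (2 ^ k) \<le> \<beta> ^ (2 ^ k - 1) * f k\<close>, obtained
    by iterating \<open>fS\<close> and multiplied by \<open>\<beta>\<close> to avoid subtraction in
    the exponent.\<close>
  have fpow: "\<beta> * f 0 ^ (2 ^ k) \<le> \<beta> ^ (2 ^ k) * f k" for k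
  proof (induction k)
    case 0 show ?case by simp
  next
    case (Suc k)
    show ?case
    proof (cases "\<beta> = 0")
      case False
      then have p: "0 < \<beta>" using \<beta>0 by simp
      have "\<beta> * (\<beta> * f 0 ^ (2 ^ Suc k)) = (\<beta> * f 0 ^ (2 ^ k))\<^sup>2"
        by (simp add: power2_eq_square mult_2 power_add)
      also have "\<dots> \<le> (\<beta> ^ (2 ^ k) * f k)\<^sup>2"
        using Suc p by (intro power_mono) (auto simp: f_def)
      also have "\<dots> = \<beta> ^ (2 ^ Suc k) * (f k)\<^sup>2"
        by (simp add: power_mult_distrib power2_eq_square mult_2 power_add)
      also have "\<dots> \<le> \<beta> ^ (2 ^ Suc k) * (\<beta> * f (Suc k))" using fS p by (intro mult_left_mono) auto
      also have "\<dots> = \<beta> * (\<beta> ^ (2 ^ Suc k) * f (Suc k))" by simp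
      finally show ?thesis using p by simp
    qed (simp add: f_def)
  qed
  have fb: "f k \<le> (alg_norm A b)\<^sup>2 * M ^ (2 ^ k)" for k
  proof -
    have "f k \<le> alg_norm A (adj A b \<otimes> (h k \<otimes> b))" unfolding f_def by (intro tr_bound closed hc b)
    also have "\<dots> \<le> alg_norm A (adj A b) * (alg_norm A (h k) * alg_norm A b)"
      using norm_mult[of "adj A b" "h k \<otimes> b"] norm_mult[OF hc b, of k] alg_norm_nonneg[OF adj_closed[OF b]] hc b
      by (meson adj_closed mult_closed mult_left_mono order.trans)
    also have "\<dots> \<le> alg_norm A b * (M ^ (2 ^ k) * alg_norm A b)"
      using hn[of k] alg_norm_nonneg[OF b] by (simp add: alg_norm_adj b mult_left_mono mult_right_mono)
    finally show ?thesis by (simp add: power2_eq_square mult_ac)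
  qed
  have "f 0 \<le> \<beta> * M"
  proof (cases "\<beta> = 0")
    case True
    then have "(f 0)\<^sup>2 \<le> 0" using fS[of 0] by simp
    then show ?thesis using True by simp
  next
    case False
    have "\<beta> * f 0 ^ (2 ^ k) \<le> (alg_norm A b)\<^sup>2 * (\<beta> * M) ^ (2 ^ k)" for k
    proof -
      have "\<beta> * f 0 ^ (2 ^ k) \<le> \<beta> ^ (2 ^ k) * ((alg_norm A b)\<^sup>2 * M ^ (2 ^ k))"
        using fpow[of k] fb[of k] \<beta>0 by (meson mult_left_mono order.trans zero_le_power)
      then show ?thesis by (simp add: power_mult_distrib mult_ac)
    qed
    then show ?thesis by (rule doubling_powers_le) (use False \<beta>0 M0 f_def in auto)
  qed
  then have "Re (\<tau> (adj A b \<otimes> (h 0 \<otimes> b))) \<le> \<beta> * M"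
    unfolding f_def using complex_Re_le_cmod order.trans by blast
  moreover have "adj A b \<otimes> (h 0 \<otimes> b) = adj A (a \<otimes> b) \<otimes> (a \<otimes> b)"
    using a b by (simp add: h0 adj_mult mult_assoc closed)
  ultimately have "(trace_norm2 A \<tau> (a \<otimes> b))\<^sup>2 \<le> (alg_norm A a * trace_norm2 A \<tau> b)\<^sup>2"
    using a b by (simp add: trace_norm2_sq closed power_mult_distrib M_def \<beta>_def mult.commute)
  then show ?thesis
    by (rule power2_le_imp_le) (use a b alg_norm_nonneg trace_norm2_nonneg in auto)
qed

text \<open>The trace property makes \<open>trace_norm2\<close> invariant under adjoints, so the
  sides can be exchanged.\<close>

lemma trace_norm2_mult_right:
  assumes a: "a \<in> carrier A" and b: "b \<in> carrier A"
  shows "trace_norm2 A \<tau> (a \<otimes> b) \<le> trace_norm2 A \<tau> a * alg_norm A b"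
proof -
  have "trace_norm2 A \<tau> (a \<otimes> b) = trace_norm2 A \<tau> (adj A b \<otimes> adj A a)"
    using a b by (simp add: adj_mult[symmetric] trace_norm2_adj closed)
  also have "\<dots> \<le> alg_norm A (adj A b) * trace_norm2 A \<tau> (adj A a)"
    using a b by (intro trace_norm2_mult_left closed)
  finally show ?thesis using a b by (simp add: alg_norm_adj trace_norm2_adj mult.commute)
qed

end

section \<open>The uniform trace seminorm\<close>

context
  assumes T: "tracial_states A \<noteq> {}"
begin

lemma trace_norm2_bdd: "x \<in> carrier A \<Longrightarrow> bdd_above ((\<lambda>\<tau>. trace_norm2 A \<tau> x) ` tracial_states A)"
  using trace_norm2_le_norm by (intro bdd_aboveI[of _ "alg_norm A x"]) auto

lemma trace_norm2_le_uniform: "\<tau> \<in> tracial_states A \<Longrightarrow> x \<in> carrier A \<Longrightarrow> trace_norm2 A \<tau> x \<le> uniform_norm2 A x"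
  unfolding uniform_norm2_def by (rule cSUP_upper[OF _ trace_norm2_bdd])

lemma uniform_norm2_le: "(\<And>\<tau>. \<tau> \<in> tracial_states A \<Longrightarrow> trace_norm2 A \<tau> x \<le> c) \<Longrightarrow> uniform_norm2 A x \<le> c"
  unfolding uniform_norm2_def by (rule cSUP_least[OF T])

lemma uniform_norm2_nonneg:
  assumes "x \<in> carrier A"
  shows "0 \<le> uniform_norm2 A x"
proof -
  obtain \<tau> where \<tau>: "\<tau> \<in> tracial_states A" using T by auto
  show ?thesis using trace_norm2_nonneg[OF \<tau> assms] trace_norm2_le_uniform[OF \<tau> assms] by linarith
qed

lemma uniform_norm2_triangle:
  assumes "x \<in> carrier A" "y \<in> carrier A"
  shows "uniform_norm2 A (x \<oplus> y) \<le> uniform_norm2 A x + uniform_norm2 A y"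
  by (rule uniform_norm2_le) (meson add_mono assms order.trans trace_norm2_le_uniform trace_norm2_triangle)

lemma uniform_norm2_adj: "x \<in> carrier A \<Longrightarrow> uniform_norm2 A (adj A x) = uniform_norm2 A x"
  unfolding uniform_norm2_def by (simp add: trace_norm2_adj)

lemma uniform_norm2_scale:
  assumes x: "x \<in> carrier A"
  shows "uniform_norm2 A (c \<odot> x) \<le> cmod c * uniform_norm2 A x"
proof (rule uniform_norm2_le)
  fix \<tau> assume \<tau>: "\<tau> \<in> tracial_states A"
  show "trace_norm2 A \<tau> (c \<odot> x) \<le> cmod c * uniform_norm2 A x"
    unfolding trace_norm2_scale[OF \<tau> x] by (intro mult_left_mono trace_norm2_le_uniform[OF \<tau> x]) simp
qed

lemma uniform_norm2_mult_left:
  assumes a: "a \<in> carrier A" and b: "b \<in> carrier A"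
  shows "uniform_norm2 A (a \<otimes> b) \<le> alg_norm A a * uniform_norm2 A b"
proof (rule uniform_norm2_le)
  fix \<tau> assume \<tau>: "\<tau> \<in> tracial_states A"
  have "trace_norm2 A \<tau> (a \<otimes> b) \<le> alg_norm A a * trace_norm2 A \<tau> b" by (rule trace_norm2_mult_left[OF \<tau> a b])
  also have "\<dots> \<le> alg_norm A a * uniform_norm2 A b"
    by (intro mult_left_mono trace_norm2_le_uniform[OF \<tau> b] alg_norm_nonneg[OF a])
  finally show "trace_norm2 A \<tau> (a \<otimes> b) \<le> alg_norm A a * uniform_norm2 A b" .
qed

lemma uniform_norm2_mult_right:
  assumes a: "a \<in> carrier A" and b: "b \<in> carrier A"
  shows "uniform_norm2 A (a \<otimes> b) \<le> uniform_norm2 A a * alg_norm A b"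
proof (rule uniform_norm2_le)
  fix \<tau> assume \<tau>: "\<tau> \<in> tracial_states A"
  have "trace_norm2 A \<tau> (a \<otimes> b) \<le> trace_norm2 A \<tau> a * alg_norm A b" by (rule trace_norm2_mult_right[OF \<tau> a b])
  also have "\<dots> \<le> uniform_norm2 A a * alg_norm A b"
    by (intro mult_right_mono trace_norm2_le_uniform[OF \<tau> a] alg_norm_nonneg[OF b])
  finally show "trace_norm2 A \<tau> (a \<otimes> b) \<le> uniform_norm2 A a * alg_norm A b" .
qed

end

end

section \<open>Homomorphisms from algebras of matrix-valued functions\<close>

text \<open>Elements of the block algebra are handled through families of entries defined for all
  indices and points. \<open>matrix_data\<close> forgets the values outside the relevant ranges, and
  \<open>agree\<close> is the equality that remains.\<close>

definition matrix_data :: "nat \<Rightarrow> (nat \<Rightarrow> nat) \<Rightarrow> (nat \<Rightarrow> 'z metric) \<Rightarrow> (nat \<Rightarrow> 'z \<Rightarrow> nat \<Rightarrow> nat \<Rightarrow> complex) \<Rightarrow> nat \<Rightarrow> 'z \<Rightarrow> complex mat" where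
  "matrix_data m n Z Y = (\<lambda>i\<in>{..<m}. \<lambda>z\<in>mspace (Z i). mat (n i) (n i) (\<lambda>(j, k). Y i z j k))"

definition C0_data :: "nat \<Rightarrow> (nat \<Rightarrow> nat) \<Rightarrow> (nat \<Rightarrow> 'z metric) \<Rightarrow> (nat \<Rightarrow> 'z \<Rightarrow> nat \<Rightarrow> nat \<Rightarrow> complex) \<Rightarrow> bool" where
  "C0_data m n Z Y \<longleftrightarrow> (\<forall>i<m. \<forall>j<n i. \<forall>k<n i. (\<lambda>z. Y i z j k) \<in> C0_functions (mtopology_of (Z i)))"

definition agree :: "nat \<Rightarrow> (nat \<Rightarrow> nat) \<Rightarrow> (nat \<Rightarrow> 'z metric) \<Rightarrow> (nat \<Rightarrow> 'z \<Rightarrow> nat \<Rightarrow> nat \<Rightarrow> complex) \<Rightarrow> (nat \<Rightarrow> 'z \<Rightarrow> nat \<Rightarrow> nat \<Rightarrow> complex) \<Rightarrow> bool" where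
  "agree m n Z X Y \<longleftrightarrow> (\<forall>i<m. \<forall>z\<in>mspace (Z i). \<forall>j<n i. \<forall>k<n i. X i z j k = Y i z j k)"

definition data_adj :: "(nat \<Rightarrow> 'z \<Rightarrow> nat \<Rightarrow> nat \<Rightarrow> complex) \<Rightarrow> nat \<Rightarrow> 'z \<Rightarrow> nat \<Rightarrow> nat \<Rightarrow> complex" where
  "data_adj Y = (\<lambda>i z j k. cnj (Y i z k j))"

definition data_mult :: "(nat \<Rightarrow> nat) \<Rightarrow> (nat \<Rightarrow> 'z \<Rightarrow> nat \<Rightarrow> nat \<Rightarrow> complex) \<Rightarrow> (nat \<Rightarrow> 'z \<Rightarrow> nat \<Rightarrow> nat \<Rightarrow> complex) \<Rightarrow> nat \<Rightarrow> 'z \<Rightarrow> nat \<Rightarrow> nat \<Rightarrow> complex" where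
  "data_mult n X Y = (\<lambda>i z. mat_prod (n i) (X i z) (Y i z))"

abbreviation block_algebra :: "nat \<Rightarrow> (nat \<Rightarrow> nat) \<Rightarrow> (nat \<Rightarrow> 'z metric) \<Rightarrow> (nat \<Rightarrow> 'z \<Rightarrow> complex mat) cstar_struct" where
  "block_algebra m n Z \<equiv> direct_sum_algebra m (\<lambda>i. matrix_C0_algebra (n i) (Z i))"

lemma matrix_data_carrier:
  assumes "C0_data m n Z Y"
  shows "matrix_data m n Z Y \<in> carrier (block_algebra m n Z)"
proof -
  have "(\<lambda>z. (\<lambda>z\<in>mspace (Z i). mat (n i) (n i) (\<lambda>(j, k). Y i z j k)) z $$ (j, k)) \<in> C0_functions (mtopology_of (Z i))"
    if "i < m" "j < n i" "k < n i" for i j k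
    by (rule C0_cong[of _ "\<lambda>z. Y i z j k"]) (use assms that in \<open>auto simp: C0_data_def\<close>)
  then show ?thesis
    by (auto simp: direct_sum_algebra_def matrix_C0_algebra_def matrix_data_def PiE_iff)
qed

lemma matrix_data_surj:
  assumes "b \<in> carrier (block_algebra m n Z)"
  shows "\<exists>Y. C0_data m n Z Y \<and> matrix_data m n Z Y = b"
proof (intro exI conjI)
  let ?Y = "\<lambda>i z j k. b i z $$ (j, k)"
  have b: "b \<in> extensional {..<m}"
    "\<And>i. i < m \<Longrightarrow> b i \<in> mspace (Z i) \<rightarrow>\<^sub>E carrier_mat (n i) (n i)"
    "\<And>i j k. i < m \<Longrightarrow> j < n i \<Longrightarrow> k < n i \<Longrightarrow> (\<lambda>z. b i z $$ (j, k)) \<in> C0_functions (mtopology_of (Z i))"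
    using assms by (auto simp: direct_sum_algebra_def matrix_C0_algebra_def PiE_iff)
  show "C0_data m n Z ?Y" using b(3) by (simp add: C0_data_def)
  show "matrix_data m n Z ?Y = b"
  proof
    fix i
    show "matrix_data m n Z ?Y i = b i"
    proof (cases "i < m")
      case True
      show ?thesis
      proof
        fix z
        show "matrix_data m n Z ?Y i z = b i z"
        proof (cases "z \<in> mspace (Z i)")
          case zin: True
          then have "b i z \<in> carrier_mat (n i) (n i)" using b(2)[OF True] by auto
          then show ?thesis using True zin by (auto simp: matrix_data_def intro!: eq_matI)
        next
          case False
          then show ?thesis using True PiE_arb[OF b(2)[OF True]] by (simp add: matrix_data_def)
        qed
      qed
    next
      case False
      then show ?thesis using b(1) by (simp add: matrix_data_def extensional_def)
    qed
  qed
qed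

lemma matrix_data_eq_iff: "matrix_data m n Z X = matrix_data m n Z Y \<longleftrightarrow> agree m n Z X Y"
proof
  assume eq: "matrix_data m n Z X = matrix_data m n Z Y"
  show "agree m n Z X Y"
    unfolding agree_def
  proof (intro allI ballI impI)
    fix i z j k assume a: "i < m" "z \<in> mspace (Z i)" "j < n i" "k < n i"
    have "matrix_data m n Z X i z $$ (j, k) = matrix_data m n Z Y i z $$ (j, k)" using eq by simp
    then show "X i z j k = Y i z j k" using a by (simp add: matrix_data_def)
  qed
next
  assume "agree m n Z X Y"
  then show "matrix_data m n Z X = matrix_data m n Z Y"
    unfolding matrix_data_def agree_def by (intro restrict_ext eq_matI) auto
qed

lemma matrix_data_add:
  "matrix_data m n Z X \<oplus>\<^bsub>block_algebra m n Z\<^esub> matrix_data m n Z Y = matrix_data m n Z (\<lambda>i z j k. X i z j k + Y i z j k)"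
  unfolding matrix_data_def direct_sum_algebra_def matrix_C0_algebra_def
  by (auto intro!: restrict_ext eq_matI)

lemma matrix_data_scale:
  "c \<odot>\<^bsub>block_algebra m n Z\<^esub> matrix_data m n Z Y = matrix_data m n Z (\<lambda>i z j k. c * Y i z j k)"
  unfolding matrix_data_def direct_sum_algebra_def matrix_C0_algebra_def
  by (auto intro!: restrict_ext eq_matI)

lemma matrix_data_mult:
  "matrix_data m n Z X \<otimes>\<^bsub>block_algebra m n Z\<^esub> matrix_data m n Z Y = matrix_data m n Z (data_mult n X Y)"
  unfolding matrix_data_def direct_sum_algebra_def matrix_C0_algebra_def data_mult_def mat_prod_def
  by (auto intro!: restrict_ext eq_matI simp: times_mat_def scalar_prod_def lessThan_atLeast0)

lemma matrix_data_adj: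
  "adj (block_algebra m n Z) (matrix_data m n Z Y) = matrix_data m n Z (data_adj Y)"
  unfolding matrix_data_def direct_sum_algebra_def matrix_C0_algebra_def data_adj_def
  by (auto intro!: restrict_ext eq_matI simp: mat_adjoint_def mat_of_rows_def)

lemma C0_data_add: "C0_data m n Z X \<Longrightarrow> C0_data m n Z Y \<Longrightarrow> C0_data m n Z (\<lambda>i z j k. X i z j k + Y i z j k)"
  unfolding C0_data_def by (auto intro: C0_add)

lemma C0_data_scale: "C0_data m n Z Y \<Longrightarrow> C0_data m n Z (\<lambda>i z j k. c * Y i z j k)"
  unfolding C0_data_def by (auto intro: C0_cmult)

lemma C0_data_mult: "C0_data m n Z X \<Longrightarrow> C0_data m n Z Y \<Longrightarrow> C0_data m n Z (data_mult n X Y)"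
  unfolding C0_data_def data_mult_def mat_prod_def by (auto intro!: C0_sum C0_mult)

lemma C0_data_adj: "C0_data m n Z Y \<Longrightarrow> C0_data m n Z (data_adj Y)"
  unfolding C0_data_def data_adj_def by (auto intro: C0_cnj)

lemma C0_data_zero: "C0_data m n Z (\<lambda>i z j k. 0)"
  unfolding C0_data_def by (auto intro: C0_zero)

lemma C0_data_sum:
  "finite S \<Longrightarrow> (\<And>s. s \<in> S \<Longrightarrow> C0_data m n Z (X s)) \<Longrightarrow> C0_data m n Z (\<lambda>i z j k. \<Sum>s\<in>S. X s i z j k)"
  unfolding C0_data_def by (auto intro: C0_sum)

definition hermitian_data :: "nat \<Rightarrow> (nat \<Rightarrow> nat) \<Rightarrow> (nat \<Rightarrow> 'z metric) \<Rightarrow> (nat \<Rightarrow> 'z \<Rightarrow> nat \<Rightarrow> nat \<Rightarrow> complex) \<Rightarrow> bool" where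
  "hermitian_data m n Z Y \<longleftrightarrow> (\<forall>i<m. \<forall>z\<in>mspace (Z i). hermitian (n i) (Y i z))"

definition data_fun :: "(nat \<Rightarrow> nat) \<Rightarrow> (nat \<Rightarrow> real \<Rightarrow> real) \<Rightarrow> (nat \<Rightarrow> 'z \<Rightarrow> nat \<Rightarrow> nat \<Rightarrow> complex) \<Rightarrow> nat \<Rightarrow> 'z \<Rightarrow> nat \<Rightarrow> nat \<Rightarrow> complex" where
  "data_fun n G Y = (\<lambda>i z. herm_fun (n i) (G i) (Y i z))"

lemma C0_data_herm_fun:
  assumes "C0_data m n Z Y" "hermitian_data m n Z Y" "\<And>i. i < m \<Longrightarrow> continuous_on UNIV (G i)" "\<And>i. i < m \<Longrightarrow> G i 0 = 0"
  shows "C0_data m n Z (data_fun n G Y)"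
  unfolding C0_data_def data_fun_def
  using assms by (intro allI impI C0_herm_fun) (auto simp: C0_data_def hermitian_data_def)

lemma hermitian_data_herm_fun: "hermitian_data m n Z (data_fun n G Y)"
  unfolding hermitian_data_def data_fun_def herm_fun_def by (auto intro: spectral_fun_hermitian)

lemma hermitian_data_iff: "hermitian_data m n Z Y \<longleftrightarrow> agree m n Z (data_adj Y) Y"
  unfolding hermitian_data_def agree_def data_adj_def hermitian_def by metis

text \<open>No norm condition is assumed, since \<open>cstar_iso\<close> is purely algebraic; the
  norm bounds are derived in \<open>\<Psi>_contraction\<close> and
  \<open>\<Psi>_norm_le\<close>.\<close>

locale matrix_function_hom = unital_cstar_algebra A
  for A :: "('a, 'm) cstar_struct_scheme" (structure) +
  fixes m :: nat and n :: "nat \<Rightarrow> nat" and Z :: "nat \<Rightarrow> 'z metric"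
    and \<Psi> :: "(nat \<Rightarrow> 'z \<Rightarrow> nat \<Rightarrow> nat \<Rightarrow> complex) \<Rightarrow> 'a"
  assumes size_pos: "i < m \<Longrightarrow> 0 < n i"
    and \<Psi>_closed: "C0_data m n Z Y \<Longrightarrow> \<Psi> Y \<in> carrier A"
    and \<Psi>_cong: "agree m n Z X Y \<Longrightarrow> \<Psi> X = \<Psi> Y"
    and \<Psi>_add: "C0_data m n Z X \<Longrightarrow> C0_data m n Z Y \<Longrightarrow> \<Psi> (\<lambda>i z j k. X i z j k + Y i z j k) = \<Psi> X \<oplus> \<Psi> Y"
    and \<Psi>_scale: "C0_data m n Z Y \<Longrightarrow> \<Psi> (\<lambda>i z j k. c * Y i z j k) = c \<odot> \<Psi> Y"
    and \<Psi>_mult: "C0_data m n Z X \<Longrightarrow> C0_data m n Z Y \<Longrightarrow> \<Psi> (data_mult n X Y) = \<Psi> X \<otimes> \<Psi> Y"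
    and \<Psi>_adj: "C0_data m n Z Y \<Longrightarrow> \<Psi> (data_adj Y) = adj A (\<Psi> Y)"
begin

abbreviation "dat \<equiv> C0_data m n Z"

text \<open>The extension of \<open>\<Psi>\<close> to the unitization.\<close>

definition \<Phi> :: "complex \<Rightarrow> (nat \<Rightarrow> 'z \<Rightarrow> nat \<Rightarrow> nat \<Rightarrow> complex) \<Rightarrow> 'a" where
  "\<Phi> c Y = c \<odot> \<one> \<oplus> \<Psi> Y"

lemma \<Phi>_closed: "dat Y \<Longrightarrow> \<Phi> c Y \<in> carrier A"
  unfolding \<Phi>_def by (intro closed \<Psi>_closed)

lemma \<Phi>_cong: "agree m n Z X Y \<Longrightarrow> \<Phi> c X = \<Phi> c Y"
  unfolding \<Phi>_def using \<Psi>_cong by simp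

lemma \<Phi>_zero: "dat Y \<Longrightarrow> \<Phi> 0 Y = \<Psi> Y"
  unfolding \<Phi>_def using \<Psi>_closed by (simp add: scale_zero closed)

lemma \<Psi>_zero: "\<Psi> (\<lambda>i z j k. 0) = \<zero>"
  using \<Psi>_scale[OF C0_data_zero, of 0] \<Psi>_closed[OF C0_data_zero] by (simp add: scale_zero)

lemma \<Phi>_one: "\<Phi> 1 (\<lambda>i z j k. 0) = \<one>"
  unfolding \<Phi>_def \<Psi>_zero by (simp add: scale_one closed)

lemma \<Phi>_adj: "dat Y \<Longrightarrow> adj A (\<Phi> c Y) = \<Phi> (cnj c) (data_adj Y)"
  unfolding \<Phi>_def using \<Psi>_closed by (simp add: \<Psi>_adj adj_add adj_smult closed adj_one)

lemma \<Phi>_scale: "dat Y \<Longrightarrow> d \<odot> \<Phi> c Y = \<Phi> (d * c) (\<lambda>i z j k. d * Y i z j k)"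
  unfolding \<Phi>_def using \<Psi>_closed by (simp add: \<Psi>_scale scale_add_right scale_scale closed)

lemma \<Phi>_add:
  assumes X: "dat X" and Y: "dat Y"
  shows "\<Phi> c X \<oplus> \<Phi> d Y = \<Phi> (c + d) (\<lambda>i z j k. X i z j k + Y i z j k)"
  unfolding \<Phi>_def using \<Psi>_closed[OF X] \<Psi>_closed[OF Y] X Y
  by (simp add: \<Psi>_add scale_add closed M.a_ac)

lemma \<Phi>_diff:
  assumes X: "dat X" and Y: "dat Y"
  shows "\<Phi> c X \<ominus> \<Phi> d Y = \<Phi> (c - d) (\<lambda>i z j k. X i z j k - Y i z j k)"
proof -
  have "\<Phi> c X \<ominus> \<Phi> d Y = \<Phi> c X \<oplus> \<Phi> (-1 * d) (\<lambda>i z j k. -1 * Y i z j k)"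
    using X Y by (simp only: diff_scale \<Phi>_closed \<Phi>_scale)
  also have "\<dots> = \<Phi> (c + -1 * d) (\<lambda>i z j k. X i z j k + -1 * Y i z j k)"
    by (intro \<Phi>_add X C0_data_scale Y)
  finally show ?thesis by simp
qed

lemma \<Phi>_mult:
  assumes X: "dat X" and Y: "dat Y"
  shows "\<Phi> c X \<otimes> \<Phi> d Y = \<Phi> (c * d) (\<lambda>i z j k. c * Y i z j k + d * X i z j k + data_mult n X Y i z j k)"
proof -
  note cl = \<Psi>_closed[OF X] \<Psi>_closed[OF Y]
  have "\<Psi> (\<lambda>i z j k. c * Y i z j k + d * X i z j k + data_mult n X Y i z j k)
     = c \<odot> \<Psi> Y \<oplus> d \<odot> \<Psi> X \<oplus> \<Psi> X \<otimes> \<Psi> Y"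
    using X Y by (simp add: \<Psi>_add \<Psi>_scale \<Psi>_mult C0_data_add C0_data_scale C0_data_mult)
  moreover have "(c \<odot> \<one> \<oplus> \<Psi> X) \<otimes> (d \<odot> \<one> \<oplus> \<Psi> Y)
     = (c * d) \<odot> \<one> \<oplus> (c \<odot> \<Psi> Y \<oplus> d \<odot> \<Psi> X \<oplus> \<Psi> X \<otimes> \<Psi> Y)"
    using cl by (simp add: mult_add_left mult_add_right smult_mult_left smult_mult_right scale_scale
        scale_add_right closed M.a_ac mult.commute)
  ultimately show ?thesis unfolding \<Phi>_def by simp
qed

lemma data_fun_mult:
  assumes "hermitian_data m n Z Y" "i < m" "z \<in> mspace (Z i)" "j < n i" "k < n i"
  shows "data_mult n (data_fun n G Y) (data_fun n H Y) i z j k = data_fun n (\<lambda>i x. G i x * H i x) Y i z j k"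
  unfolding data_mult_def data_fun_def herm_fun_def
  using assms by (intro spectral_fun_mult[OF spectral_choice]) (auto simp: hermitian_data_def)

lemma data_fun_id:
  assumes "hermitian_data m n Z Y" "i < m" "z \<in> mspace (Z i)" "j < n i" "k < n i"
  shows "data_fun n (\<lambda>i x. x) Y i z j k = Y i z j k"
  unfolding data_fun_def herm_fun_def
  using assms by (intro spectral_fun_id[OF spectral_choice]) (auto simp: hermitian_data_def)

text \<open>If \<open>x = \<Psi> Y\<close> and \<open>v = 1 - sqrt (1 - x\<^sup>2)\<close>, then \<open>x + \<i> (1 - v)\<close> is unitary, so \<open>x\<close>, its
  real part, is a contraction. No spectral theory in \<open>A\<close> is needed.\<close>

lemma \<Psi>_contraction:
  assumes Y: "dat Y" and h: "hermitian_data m n Z Y"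
    and b: "\<And>i z. i < m \<Longrightarrow> z \<in> mspace (Z i) \<Longrightarrow> op_bound (n i) (Y i z) 1"
  shows "alg_norm A (\<Psi> Y) \<le> 1"
proof -
  \<comment> \<open>\<open>G\<close> is used rather than the square root itself because
    \<open>G 0 = 0\<close> keeps \<open>V\<close> vanishing at infinity; \<open>max 0\<close> makes
    \<open>G\<close> continuous on the whole line.\<close>
  define G where "G x = 1 - sqrt (max 0 (1 - x\<^sup>2))" for x :: real
  define V where "V = data_fun n (\<lambda>_. G) Y"
  have V: "dat V" unfolding V_def
    by (rule C0_data_herm_fun[OF Y h]) (auto simp: G_def[abs_def] intro!: continuous_intros)
  have hV: "hermitian_data m n Z V" unfolding V_def by (rule hermitian_data_herm_fun)
  define W where "W = (\<lambda>i z j k. Y i z j k + (- \<i>) * V i z j k)"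
  have W: "dat W" unfolding W_def by (intro C0_data_add C0_data_scale Y V)
  note W' = C0_data_adj[OF W]
  \<comment> \<open>With \<open>W = Y - \<i> V\<close> this is
    \<open>\<Psi> Y + \<i> (1 - \<Psi> V)\<close>.\<close>
  define U where "U = \<Phi> \<i> W"
  have U: "U \<in> carrier A" unfolding U_def by (rule \<Phi>_closed[OF W])
  have aU: "adj A U = \<Phi> (- \<i>) (data_adj W)" unfolding U_def using \<Phi>_adj[OF W, of \<i>] by simp
  have W'eq: "data_adj W i z j k = Y i z j k + \<i> * V i z j k"
    if "i < m" "z \<in> mspace (Z i)" "j < n i" "k < n i" for i z j k
    using h hV that hermitianD[of "n i" "Y i z" k j] hermitianD[of "n i" "V i z" k j]
    by (simp add: data_adj_def W_def hermitian_data_def)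
  \<comment> \<open>The scalar part of \<open>adj A U \<otimes> U\<close> is 1 already; what has to
    vanish is the remaining matrix-valued function. It does because
    \<open>x * x + G x * G x = 2 * G x\<close> on \<open>[-1, 1]\<close>.\<close>
  have "agree m n Z (\<lambda>i z j k. (- \<i>) * W i z j k + \<i> * data_adj W i z j k + data_mult n (data_adj W) W i z j k) (\<lambda>i z j k. 0)"
    unfolding agree_def
  proof (intro allI ballI impI)
    fix i z j k assume a: "i < m" "z \<in> mspace (Z i)" "j < n i" "k < n i"
    let ?Y = "Y i z"
    have sp: "spectral (n i) ?Y (fst (spectral_choice (n i) ?Y)) (snd (spectral_choice (n i) ?Y))"
      using h a by (intro spectral_choice) (auto simp: hermitian_data_def)
    have Yid: "Y i z j k = data_fun n (\<lambda>i x. x) Y i z j k" if "j < n i" "k < n i" for j k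
      using data_fun_id[OF h a(1,2) that] by simp
    have cg: "data_mult n P Q i z j k = data_mult n P' Q' i z j k"
      if "\<And>l. l < n i \<Longrightarrow> P i z j l = P' i z j l" "\<And>l. l < n i \<Longrightarrow> Q i z l k = Q' i z l k" for P Q P' Q'
      unfolding data_mult_def mat_prod_def using that by simp
    have YY: "data_mult n Y Y i z j k = data_fun n (\<lambda>i x. x * x) Y i z j k"
      by (subst cg[of _ "data_fun n (\<lambda>i x. x) Y" _ "data_fun n (\<lambda>i x. x) Y"])
        (use Yid a in \<open>auto simp: data_fun_mult[OF h]\<close>)
    have YV: "data_mult n Y V i z j k = data_fun n (\<lambda>i x. x * G x) Y i z j k"
      by (subst cg[of _ "data_fun n (\<lambda>i x. x) Y" _ "data_fun n (\<lambda>_. G) Y"])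
        (use Yid a in \<open>auto simp: data_fun_mult[OF h] V_def\<close>)
    have VY: "data_mult n V Y i z j k = data_fun n (\<lambda>i x. x * G x) Y i z j k"
      by (subst cg[of _ "data_fun n (\<lambda>_. G) Y" _ "data_fun n (\<lambda>i x. x) Y"])
        (use Yid a in \<open>auto simp: data_fun_mult[OF h] V_def mult.commute\<close>)
    have VV: "data_mult n V V i z j k = data_fun n (\<lambda>i x. G x * G x) Y i z j k"
      unfolding V_def using a by (intro data_fun_mult[OF h])
    have Geq: "x * x + G x * G x = 2 * G x" if "\<bar>x\<bar> \<le> 1" for x
    proof -
      have "x\<^sup>2 \<le> 1" using that by (simp add: abs_square_le_1)
      then obtain s where s: "s * s = 1 - x * x" and Gx: "G x = 1 - s"
        by (intro that[of "sqrt (1 - x\<^sup>2)"]) (simp_all add: G_def power2_eq_square)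
      show ?thesis unfolding Gx using s by (simp add: algebra_simps)
    qed
    have fs: "data_fun n (\<lambda>i x. x * x) Y i z j k + data_fun n (\<lambda>i x. G x * G x) Y i z j k = 2 * V i z j k"
      unfolding V_def data_fun_def herm_fun_def spectral_fun_def sum.distrib[symmetric] sum_distrib_left
    proof (intro sum.cong refl)
      fix l assume l: "l \<in> {..<n i}"
      let ?d = "snd (spectral_choice (n i) ?Y) l"
      let ?u = "fst (spectral_choice (n i) ?Y) l j * cnj (fst (spectral_choice (n i) ?Y) l k)"
      have "?d * ?d + G ?d * G ?d = 2 * G ?d"
        using op_bound_eigenvalue[OF sp b[OF a(1,2)]] l by (intro Geq) auto
      then have "complex_of_real (?d * ?d) * ?u + complex_of_real (G ?d * G ?d) * ?u = complex_of_real (2 * G ?d) * ?u"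
        by (simp only: distrib_right[symmetric] of_real_add[symmetric])
      then show "complex_of_real (?d * ?d) * ?u + complex_of_real (G ?d * G ?d) * ?u = 2 * (complex_of_real (G ?d) * ?u)"
        by simp
    qed
    have "data_mult n (data_adj W) W i z j k = (\<Sum>l<n i. (Y i z j l + \<i> * V i z j l) * (Y i z l k - \<i> * V i z l k))"
      unfolding data_mult_def mat_prod_def using a W'eq by (intro sum.cong refl) (simp add: W_def)
    also have "\<dots> = data_mult n Y Y i z j k + data_mult n V V i z j k + \<i> * (data_mult n V Y i z j k - data_mult n Y V i z j k)"
      unfolding data_mult_def mat_prod_def sum_distrib_left right_diff_distrib sum_subtractf[symmetric] sum.distrib[symmetric]
      by (intro sum.cong refl) (simp add: algebra_simps)
    also have "\<dots> = 2 * V i z j k" unfolding YV VY YY VV fs by simp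
    finally show "(- \<i>) * W i z j k + \<i> * data_adj W i z j k + data_mult n (data_adj W) W i z j k = 0"
      using W'eq[OF a] by (simp add: W_def algebra_simps)
  qed
  then have "adj A U \<otimes> U = \<one>"
    unfolding aU unfolding U_def \<Phi>_mult[OF W' W] using \<Phi>_one by (simp add: \<Phi>_cong)
  then have nU: "alg_norm A U \<le> 1" by (rule alg_norm_isometry[OF U])
  have "U \<oplus> adj A U = \<Phi> 0 (\<lambda>i z j k. W i z j k + data_adj W i z j k)"
    unfolding aU unfolding U_def \<Phi>_add[OF W W'] by simp
  also have "\<dots> = \<Phi> 0 (\<lambda>i z j k. 2 * Y i z j k)"
  proof (rule \<Phi>_cong, unfold agree_def, intro allI ballI impI)
    fix i z j k assume "i < m" "z \<in> mspace (Z i)" "j < n i" "k < n i"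
    note W'eq[OF this]
    then show "W i z j k + data_adj W i z j k = 2 * Y i z j k"
      unfolding W_def[THEN fun_cong, THEN fun_cong, THEN fun_cong, THEN fun_cong, of i z j k] by simp
  qed
  also have "\<dots> = 2 \<odot> \<Psi> Y" using Y by (simp add: \<Phi>_zero C0_data_scale \<Psi>_scale)
  finally have "alg_norm A (2 \<odot> \<Psi> Y) \<le> alg_norm A U + alg_norm A (adj A U)"
    using norm_triangle[OF U adj_closed[OF U]] by simp
  then show ?thesis using nU norm_smult[OF \<Psi>_closed[OF Y], of 2] by (simp add: alg_norm_adj U)
qed

lemma \<Psi>_norm_le:
  assumes Y: "dat Y" and h: "hermitian_data m n Z Y" and R: "0 < R"
    and b: "\<And>i z. i < m \<Longrightarrow> z \<in> mspace (Z i) \<Longrightarrow> op_bound (n i) (Y i z) R"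
  shows "alg_norm A (\<Psi> Y) \<le> R"
proof -
  let ?c = "complex_of_real (1 / R)"
  let ?Y = "\<lambda>i z j k. ?c * Y i z j k"
  have "alg_norm A (\<Psi> ?Y) \<le> 1"
  proof (rule \<Psi>_contraction[OF C0_data_scale[OF Y]])
    show "hermitian_data m n Z ?Y"
      unfolding hermitian_data_def
    proof (intro allI impI ballI)
      fix i z assume "i < m" "z \<in> mspace (Z i)"
      then have "hermitian (n i) (Y i z)" using h by (simp add: hermitian_data_def)
      from hermitianD[OF this] show "hermitian (n i) (?Y i z)" by (simp add: hermitian_def)
    qed
    fix i z assume "i < m" "z \<in> mspace (Z i)"
    from b[OF this] have o: "l2_sq (n i) (\<lambda>j. \<Sum>k<n i. x k * Y i z k j) \<le> R\<^sup>2 * l2_sq (n i) x" for x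
      by (simp add: op_bound_def)
    have "l2_sq (n i) (\<lambda>j. \<Sum>k<n i. x k * ?Y i z k j) = (1 / R)\<^sup>2 * l2_sq (n i) (\<lambda>j. \<Sum>k<n i. x k * Y i z k j)" for x
    proof -
      have eq: "(\<Sum>k<n i. x k * ?Y i z k j) = ?c * (\<Sum>k<n i. x k * Y i z k j)" for j
        by (simp add: sum_distrib_left mult_ac)
      show ?thesis
        unfolding l2_sq_def eq norm_mult power_mult_distrib sum_distrib_left[symmetric]
        using R by (simp add: norm_divide power_divide flip: sum_divide_distrib)
    qed
    then show "op_bound (n i) (?Y i z) 1"
      unfolding op_bound_def using o R by (simp add: power_divide divide_le_eq mult.commute)
  qed
  moreover have "alg_norm A (\<Psi> ?Y) = alg_norm A (\<Psi> Y) / R"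
    unfolding \<Psi>_scale[OF Y] using norm_smult[OF \<Psi>_closed[OF Y], of ?c] R by (simp add: norm_divide)
  ultimately show ?thesis using R by (simp add: divide_le_eq)
qed

text \<open>The function \<open>h\<close> times a matrix unit of the \<open>i\<close>-th summand.
  Matrix units themselves may be missing from the algebra, since constants need not vanish at
  infinity.\<close>

definition unit_data :: "nat \<Rightarrow> nat \<Rightarrow> nat \<Rightarrow> ('z \<Rightarrow> complex) \<Rightarrow> nat \<Rightarrow> 'z \<Rightarrow> nat \<Rightarrow> nat \<Rightarrow> complex" where
  "unit_data i j k h = (\<lambda>i' z j' k'. if i' = i \<and> j' = j \<and> k' = k then h z else 0)"

lemma unit_data: "h \<in> C0_functions (mtopology_of (Z i)) \<Longrightarrow> dat (unit_data i j k h)"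
  unfolding C0_data_def unit_data_def
proof (intro allI impI)
  fix i' j' k' assume h: "h \<in> C0_functions (mtopology_of (Z i))"
  show "(\<lambda>z. if i' = i \<and> j' = j \<and> k' = k then h z else 0) \<in> C0_functions (mtopology_of (Z i'))"
    by (cases "i' = i \<and> j' = j \<and> k' = k") (use h C0_zero in auto)
qed

lemma unit_data_mult:
  assumes "k < n i"
  shows "data_mult n (unit_data i j k g) (unit_data i k l h) = unit_data i j l (\<lambda>z. g z * h z)"
proof (intro ext)
  fix i' z j' l'
  show "data_mult n (unit_data i j k g) (unit_data i k l h) i' z j' l' = unit_data i j l (\<lambda>z. g z * h z) i' z j' l'"
  proof (cases "i' = i \<and> j' = j \<and> l' = l")
    case True
    have "data_mult n (unit_data i j k g) (unit_data i k l h) i' z j' l' = (\<Sum>k'<n i. if k' = k then g z * h z else 0)"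
      unfolding data_mult_def mat_prod_def unit_data_def by (intro sum.cong refl) (use True in auto)
    then show ?thesis using True assms by (simp add: unit_data_def)
  next
    case False
    then show ?thesis by (auto simp: data_mult_def mat_prod_def unit_data_def intro!: sum.neutral)
  qed
qed

lemma unit_data_mult_zero:
  assumes "k \<noteq> k'"
  shows "data_mult n (unit_data i j k g) (unit_data i k' l h) = (\<lambda>i z j k. 0)"
  using assms by (auto simp: data_mult_def mat_prod_def unit_data_def fun_eq_iff intro!: sum.neutral)

text \<open>Split \<open>w\<close> into \<open>sqrt (cmod w)\<close> and
  \<open>w / sqrt (cmod w)\<close>; both are continuous and vanish at 0, the latter through the
  convention for division by 0. The two factors are distributed over two matrix units, which makes
  the trace property applicable without a unit.\<close>

lemma C0_factor:
  assumes h: "h \<in> C0_functions X"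
  obtains h1 h2 where "h1 \<in> C0_functions X" "h2 \<in> C0_functions X" "\<And>z. h z = h1 z * h2 z"
proof -
  define k1 where "k1 w = complex_of_real (sqrt (cmod w))" for w
  define k2 where "k2 w = w / complex_of_real (sqrt (cmod w))" for w
  have n2: "cmod (k2 w) = sqrt (cmod w)" for w
    unfolding k2_def by (simp add: norm_divide real_div_sqrt)
  have "continuous (at w) k2" for w
  proof (cases "w = 0")
    case False
    then show ?thesis unfolding k2_def by (intro continuous_intros) auto
  next
    case True
    have "((\<lambda>w. sqrt (cmod w)) \<longlongrightarrow> sqrt (cmod 0)) (at 0)"
      by (intro tendsto_intros)
    then have "((\<lambda>w. cmod (k2 w)) \<longlongrightarrow> 0) (at 0)" by (simp add: n2)
    then have "(k2 \<longlongrightarrow> 0) (at 0)" by (rule tendsto_norm_zero_cancel)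
    then show ?thesis using True by (simp add: continuous_within k2_def)
  qed
  then have c2: "continuous_on UNIV k2" by (simp add: continuous_at_imp_continuous_on)
  have c1: "continuous_on UNIV k1" unfolding k1_def by (intro continuous_intros)
  show thesis
  proof (rule that)
    show "(\<lambda>z. k1 (h z)) \<in> C0_functions X" by (rule C0_comp[OF h c1]) (simp add: k1_def)
    show "(\<lambda>z. k2 (h z)) \<in> C0_functions X" by (rule C0_comp[OF h c2]) (simp add: k2_def)
    show "h z = k1 (h z) * k2 (h z)" for z by (simp add: k1_def k2_def)
  qed
qed

section \<open>Traces on matrix-valued functions\<close>

context
  fixes \<tau>
  assumes \<tau>: "\<tau> \<in> tracial_states A"
begin

lemma trace_hom_add: "dat X \<Longrightarrow> dat Y \<Longrightarrow> \<tau> (\<Psi> (\<lambda>i z j k. X i z j k + Y i z j k)) = \<tau> (\<Psi> X) + \<tau> (\<Psi> Y)"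
  by (simp add: \<Psi>_add tr_add[OF \<tau>] \<Psi>_closed)

lemma trace_hom_commute: "dat X \<Longrightarrow> dat Y \<Longrightarrow> \<tau> (\<Psi> (data_mult n X Y)) = \<tau> (\<Psi> (data_mult n Y X))"
  by (simp add: \<Psi>_mult tr_commute[OF \<tau>] \<Psi>_closed)

lemma trace_hom_zero: "\<tau> (\<Psi> (\<lambda>i z j k. 0)) = 0"
  using trace_hom_add[OF C0_data_zero C0_data_zero] by simp

lemma trace_hom_sum:
  assumes "finite S" "\<And>s. s \<in> S \<Longrightarrow> dat (X s)"
  shows "\<tau> (\<Psi> (\<lambda>i z j k. \<Sum>s\<in>S. X s i z j k)) = (\<Sum>s\<in>S. \<tau> (\<Psi> (X s)))"
  using assms
proof (induction S rule: finite_induct)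
  case empty then show ?case by (simp add: trace_hom_zero)
next
  case (insert s S)
  then show ?case using trace_hom_add[of "X s" "\<lambda>i z j k. \<Sum>s\<in>S. X s i z j k"] by (simp add: C0_data_sum)
qed

text \<open>With matrix units \<open>e\<close>, write the element as
  \<open>(h1 e_jj) (h2 e_jk)\<close>; the product in the opposite order is zero.\<close>

lemma trace_unit_off_diagonal:
  assumes h: "h \<in> C0_functions (mtopology_of (Z i))" and j: "j < n i" and jk: "j \<noteq> k"
  shows "\<tau> (\<Psi> (unit_data i j k h)) = 0"
proof -
  obtain h1 h2 where hh: "h1 \<in> C0_functions (mtopology_of (Z i))" "h2 \<in> C0_functions (mtopology_of (Z i))"
    "\<And>z. h z = h1 z * h2 z" using C0_factor[OF h] by blast
  have "h = (\<lambda>z. h1 z * h2 z)" using hh(3) by auto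
  then have "\<tau> (\<Psi> (unit_data i j k h)) = \<tau> (\<Psi> (data_mult n (unit_data i j j h1) (unit_data i j k h2)))"
    using j by (simp add: unit_data_mult)
  also have "\<dots> = \<tau> (\<Psi> (data_mult n (unit_data i j k h2) (unit_data i j j h1)))"
    by (intro trace_hom_commute unit_data hh)
  also have "\<dots> = 0" using jk by (simp add: unit_data_mult_zero trace_hom_zero)
  finally show ?thesis .
qed

text \<open>Write the element as \<open>(h1 e_j0) (h2 e_0j)\<close>; exchanging the factors moves it
  to the corner \<open>(0, 0)\<close>.\<close>

lemma trace_unit_diagonal:
  assumes h: "h \<in> C0_functions (mtopology_of (Z i))" and j: "j < n i"
  shows "\<tau> (\<Psi> (unit_data i j j h)) = \<tau> (\<Psi> (unit_data i 0 0 h))"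
proof -
  obtain h1 h2 where hh: "h1 \<in> C0_functions (mtopology_of (Z i))" "h2 \<in> C0_functions (mtopology_of (Z i))"
    "\<And>z. h z = h1 z * h2 z" using C0_factor[OF h] by blast
  have eq: "h = (\<lambda>z. h1 z * h2 z)" "h = (\<lambda>z. h2 z * h1 z)" using hh(3) by (auto simp: mult.commute)
  have "\<tau> (\<Psi> (unit_data i j j h)) = \<tau> (\<Psi> (data_mult n (unit_data i j 0 h1) (unit_data i 0 j h2)))"
    using j eq(1) by (simp add: unit_data_mult)
  also have "\<dots> = \<tau> (\<Psi> (data_mult n (unit_data i 0 j h2) (unit_data i j 0 h1)))"
    by (intro trace_hom_commute unit_data hh)
  also have "\<dots> = \<tau> (\<Psi> (unit_data i 0 0 h))" using j eq(2) by (simp add: unit_data_mult)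
  finally show ?thesis .
qed

text \<open>Expand \<open>g\<close> in matrix units: off-diagonal terms have trace zero, and
  diagonal terms can be moved to the corner \<open>(0, 0)\<close>. Hence \<open>\<tau>\<close>
  depends only on the pointwise matrix trace.\<close>

lemma trace_pointwise:
  assumes g: "dat g"
  shows "\<tau> (\<Psi> g) = (\<Sum>i<m. \<tau> (\<Psi> (unit_data i 0 0 (\<lambda>z. \<Sum>j<n i. g i z j j))))"
proof -
  define S where "S = (SIGMA i:{..<m}. {..<n i} \<times> {..<n i})"
  define E where "E = (\<lambda>(i, j, k). unit_data i j k (\<lambda>z. g i z j k))"
  have finS: "finite S" by (simp add: S_def)
  have gC: "(\<lambda>z. g i z j k) \<in> C0_functions (mtopology_of (Z i))" if "i < m" "j < n i" "k < n i" for i j k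
    using g that by (simp add: C0_data_def)
  have E: "dat (E s)" if "s \<in> S" for s
    using that by (auto simp: S_def E_def intro!: unit_data gC)
  have "\<tau> (\<Psi> g) = \<tau> (\<Psi> (\<lambda>i z j k. \<Sum>s\<in>S. E s i z j k))"
  proof (rule arg_cong[where f = \<tau>], rule \<Psi>_cong, unfold agree_def, intro allI ballI impI)
    fix i z j k assume a: "i < m" "z \<in> mspace (Z i)" "j < n i" "k < n i"
    then have s: "(i, j, k) \<in> S" by (simp add: S_def)
    have "(\<Sum>s\<in>S. E s i z j k) = (\<Sum>s\<in>S. if s = (i, j, k) then g i z j k else 0)"
      by (intro sum.cong refl) (auto simp: E_def unit_data_def split: prod.splits)
    also have "\<dots> = g i z j k" using s finS by simp
    finally show "g i z j k = (\<Sum>s\<in>S. E s i z j k)" ..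
  qed
  also have "\<dots> = (\<Sum>s\<in>S. \<tau> (\<Psi> (E s)))" by (rule trace_hom_sum[OF finS E])
  also have "\<dots> = (\<Sum>i<m. \<Sum>jk\<in>{..<n i} \<times> {..<n i}. \<tau> (\<Psi> (E (i, jk))))"
    unfolding S_def by (subst sum.Sigma) auto
  also have "\<dots> = (\<Sum>i<m. \<Sum>j<n i. \<Sum>k<n i. \<tau> (\<Psi> (E (i, j, k))))"
    by (simp add: sum.cartesian_product)
  also have "\<dots> = (\<Sum>i<m. \<Sum>j<n i. \<tau> (\<Psi> (unit_data i 0 0 (\<lambda>z. g i z j j))))"
  proof (intro sum.cong refl)
    fix i j assume i: "i \<in> {..<m}" and j: "j \<in> {..<n i}"
    have "(\<Sum>k<n i. \<tau> (\<Psi> (E (i, j, k)))) = (\<Sum>k<n i. if k = j then \<tau> (\<Psi> (unit_data i 0 0 (\<lambda>z. g i z j j))) else 0)"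
    proof (intro sum.cong refl)
      fix k assume k: "k \<in> {..<n i}"
      show "\<tau> (\<Psi> (E (i, j, k))) = (if k = j then \<tau> (\<Psi> (unit_data i 0 0 (\<lambda>z. g i z j j))) else 0)"
        using trace_unit_diagonal[OF gC, of i j j j] trace_unit_off_diagonal[OF gC, of i j k j k] i j k
        by (auto simp: E_def)
    qed
    then show "(\<Sum>k<n i. \<tau> (\<Psi> (E (i, j, k)))) = \<tau> (\<Psi> (unit_data i 0 0 (\<lambda>z. g i z j j)))" using j by simp
  qed
  also have "\<dots> = (\<Sum>i<m. \<tau> (\<Psi> (unit_data i 0 0 (\<lambda>z. \<Sum>j<n i. g i z j j))))"
  proof (intro sum.cong refl)
    fix i assume i: "i \<in> {..<m}"
    have "\<tau> (\<Psi> (\<lambda>i' z j' k'. \<Sum>j<n i. unit_data i 0 0 (\<lambda>z. g i z j j) i' z j' k'))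
        = (\<Sum>j<n i. \<tau> (\<Psi> (unit_data i 0 0 (\<lambda>z. g i z j j))))"
      using i by (intro trace_hom_sum unit_data gC) auto
    moreover have "(\<lambda>i' z j' k'. \<Sum>j<n i. unit_data i 0 0 (\<lambda>z. g i z j j) i' z j' k') = unit_data i 0 0 (\<lambda>z. \<Sum>j<n i. g i z j j)"
      by (auto simp: unit_data_def fun_eq_iff)
    ultimately show "(\<Sum>j<n i. \<tau> (\<Psi> (unit_data i 0 0 (\<lambda>z. g i z j j)))) = \<tau> (\<Psi> (unit_data i 0 0 (\<lambda>z. \<Sum>j<n i. g i z j j)))"
      by simp
  qed
  finally show ?thesis .
qed

text \<open>By \<open>trace_pointwise\<close> the product of the adjoint of \<open>Y\<close> with
  \<open>Y\<close> has the same trace as \<open>g'\<close>, the scalar matrix with the same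
  pointwise trace. Its scalar values lie between 0 and \<open>R\<close>, so its image has norm at
  most \<open>R\<close>.\<close>

lemma trace_norm2_hs_sq_le:
  fixes R :: real
  assumes Y: "dat Y" and R: "0 < R"
    and b: "\<And>i z. i < m \<Longrightarrow> z \<in> mspace (Z i) \<Longrightarrow> hs_sq (n i) (Y i z) \<le> R * n i"
  shows "(trace_norm2 A \<tau> (\<Psi> Y))\<^sup>2 \<le> R"
proof -
  define g where "g = data_mult n (data_adj Y) Y"
  have g: "dat g" unfolding g_def by (intro C0_data_mult C0_data_adj Y)
  have trg: "(\<Sum>j<n i. g i z j j) = of_real (hs_sq (n i) (Y i z))" for i z
  proof -
    have "(\<Sum>j<n i. g i z j j) = (\<Sum>j<n i. \<Sum>l<n i. of_real ((cmod (Y i z l j))\<^sup>2))"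
      unfolding g_def data_mult_def mat_prod_def data_adj_def complex_norm_square by (simp add: mult.commute)
    also have "\<dots> = (\<Sum>l<n i. \<Sum>j<n i. of_real ((cmod (Y i z l j))\<^sup>2))" by (rule sum.swap)
    finally show ?thesis by (simp add: hs_sq_def l2_sq_def)
  qed
  define g' where "g' = (\<lambda>i z (j::nat) k. if j = k then complex_of_real (hs_sq (n i) (Y i z)) / of_nat (n i) else 0)"
  have g': "dat g'"
    unfolding C0_data_def
  proof (intro allI impI)
    fix i j k assume a: "i < m" "j < n i" "k < n i"
    have "(\<lambda>z. complex_of_real (hs_sq (n i) (Y i z))) \<in> C0_functions (mtopology_of (Z i))"
      using Y a by (intro C0_hs_sq) (auto simp: C0_data_def)
    from C0_cmult[OF this, of "1 / of_nat (n i)"]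
    show "(\<lambda>z. g' i z j k) \<in> C0_functions (mtopology_of (Z i))"
      by (cases "j = k") (auto simp: g'_def C0_zero)
  qed
  have "\<tau> (\<Psi> g) = \<tau> (\<Psi> g')"
    unfolding trace_pointwise[OF g] trace_pointwise[OF g'] trg
    by (intro sum.cong refl) (use size_pos in \<open>auto simp: g'_def\<close>)
  moreover have "alg_norm A (\<Psi> g') \<le> R"
  proof (rule \<Psi>_norm_le)
    show "dat g'" "0 < R" by fact+
    show "hermitian_data m n Z g'" by (auto simp: hermitian_data_def hermitian_def g'_def)
    fix i z assume a: "i < m" "z \<in> mspace (Z i)"
    define c where "c = hs_sq (n i) (Y i z) / n i"
    have c: "0 \<le> c" "c \<le> R" using b[OF a] size_pos[OF a(1)] hs_sq_nonneg[of "n i" "Y i z"]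
      by (auto simp: c_def divide_le_eq)
    have "(\<Sum>k<n i. x k * g' i z k j) = of_real c * x j" if "j < n i" for x j
    proof -
      have "(\<Sum>k<n i. x k * g' i z k j) = (\<Sum>k<n i. if k = j then of_real c * x j else 0)"
        by (intro sum.cong refl) (auto simp: g'_def c_def)
      then show ?thesis using that by simp
    qed
    then have "l2_sq (n i) (\<lambda>j. \<Sum>k<n i. x k * g' i z k j) = c\<^sup>2 * l2_sq (n i) x" for x
      unfolding l2_sq_def sum_distrib_left
      by (intro sum.cong refl) (simp add: Real_Vector_Spaces.norm_mult power_mult_distrib)
    moreover have "c\<^sup>2 * l2_sq (n i) x \<le> R\<^sup>2 * l2_sq (n i) x" for x
      using c by (intro mult_right_mono power_mono) (auto simp: l2_sq_def intro!: sum_nonneg)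
    ultimately show "op_bound (n i) (g' i z) R" unfolding op_bound_def using R by simp
  qed
  ultimately have "cmod (\<tau> (\<Psi> g)) \<le> R" using tr_bound[OF \<tau> \<Psi>_closed[OF g']] by simp
  moreover have "\<Psi> g = adj A (\<Psi> Y) \<otimes> \<Psi> Y"
    unfolding g_def using Y by (simp add: \<Psi>_mult \<Psi>_adj C0_data_adj)
  ultimately show ?thesis
    using trace_norm2_sq[OF \<tau> \<Psi>_closed[OF Y]] complex_Re_le_cmod[of "\<tau> (\<Psi> g)"] by simp
qed

end

end

context unital_cstar_algebra
begin

lemma alg_metric: "Metric_space (carrier A) (alg_dist A)"
proof
  have norm_diff: "alg_norm A (x \<ominus> y) = alg_norm A (y \<ominus> x)" if "x \<in> carrier A" "y \<in> carrier A" for x y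
  proof -
    have "y \<ominus> x = (-1) \<odot> (x \<ominus> y)"
      using that by (simp add: diff_scale scale_add_right scale_scale closed scale_one M.a_comm)
    then show ?thesis using norm_smult[of "x \<ominus> y" "-1"] that by (simp add: diff_closed)
  qed
  fix x y z
  show "0 \<le> alg_dist A x y" by (simp add: alg_dist_def alg_norm_nonneg diff_closed)
  show "alg_dist A x y = alg_dist A y x" using norm_diff by (simp add: alg_dist_def)
  assume x: "x \<in> carrier A" and y: "y \<in> carrier A"
  show "alg_dist A x y = 0 \<longleftrightarrow> x = y"
    using x y by (auto simp: alg_dist_def norm_eq_zero diff_closed)
  assume z: "z \<in> carrier A"
  have "x \<ominus> z = (x \<ominus> y) \<oplus> (y \<ominus> z)"
  proof -
    have "(x \<ominus> y) \<oplus> (y \<ominus> z) = x \<oplus> (\<ominus> y \<oplus> y) \<oplus> \<ominus> z"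
      using x y z unfolding a_minus_def by (simp add: M.a_assoc M.a_inv_closed closed)
    then show ?thesis using x y z by (simp add: a_minus_def M.l_neg)
  qed
  then show "alg_dist A x z \<le> alg_dist A x y + alg_dist A y z"
    using x y z norm_triangle[of "x \<ominus> y" "y \<ominus> z"] by (simp add: alg_dist_def diff_closed)
qed

text \<open>The inclusion is hidden in \<open>closedin\<close>: closed sets lie in the underlying
  space, which is the carrier once the metric axioms are known.\<close>

lemma subalgebra_subset: "cstar_subalgebra C A \<Longrightarrow> C \<subseteq> carrier A"
  unfolding cstar_subalgebra_def alg_topology_def
  using closedin_subset Metric_space.topspace_mtopology[OF alg_metric] by fastforce

text \<open>\<open>\<Psi>\<close> is the inverse of the given isomorphism, composed with
  \<open>matrix_data\<close>; the algebraic laws are pulled back through the injectivity of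
  \<open>\<phi>\<close> on \<open>C\<close>.\<close>

lemma LTH_subalgebra_hom:
  assumes "LTH_subalgebra A C m n (Z :: nat \<Rightarrow> 'z metric)"
  shows "\<exists>\<Psi>. matrix_function_hom A m n Z \<Psi> \<and> (\<forall>c\<in>C. \<exists>Y. C0_data m n Z Y \<and> \<Psi> Y = c)"
proof -
  let ?B = "block_algebra m n Z"
  have sub: "cstar_subalgebra C A" and npos: "\<And>i. i < m \<Longrightarrow> 0 < n i"
    and iso: "cstar_iso (A\<lparr>carrier := C\<rparr>) ?B"
    using assms unfolding LTH_subalgebra_def by auto
  have CA: "C \<subseteq> carrier A" by (rule subalgebra_subset[OF sub])
  obtain \<phi> where bij: "bij_betw \<phi> C (carrier ?B)"
    and add: "\<And>x y. x \<in> C \<Longrightarrow> y \<in> C \<Longrightarrow> \<phi> (x \<oplus> y) = \<phi> x \<oplus>\<^bsub>?B\<^esub> \<phi> y"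
    and mul: "\<And>x y. x \<in> C \<Longrightarrow> y \<in> C \<Longrightarrow> \<phi> (x \<otimes> y) = \<phi> x \<otimes>\<^bsub>?B\<^esub> \<phi> y"
    and scl: "\<And>c x. x \<in> C \<Longrightarrow> \<phi> (c \<odot> x) = c \<odot>\<^bsub>?B\<^esub> \<phi> x"
    and adj: "\<And>x. x \<in> C \<Longrightarrow> \<phi> (adj A x) = adj ?B (\<phi> x)"
    using iso unfolding cstar_iso_def by auto
  define \<psi> where "\<psi> = inv_into C \<phi>"
  have inj: "inj_on \<phi> C" and surj: "\<phi> ` C = carrier ?B" using bij by (auto simp: bij_betw_def)
  have \<psi>\<phi>: "\<psi> (\<phi> c) = c" if "c \<in> C" for c unfolding \<psi>_def using inj that by (rule inv_into_f_f)
  have \<psi>: "\<psi> b \<in> C" "\<phi> (\<psi> b) = b" if "b \<in> carrier ?B" for b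
    using that surj unfolding \<psi>_def by (auto intro: inv_into_into f_inv_into_f)
  define \<Psi> where "\<Psi> Y = \<psi> (matrix_data m n Z Y)" for Y
  have \<Psi>C: "\<Psi> Y \<in> C" and \<phi>\<Psi>: "\<phi> (\<Psi> Y) = matrix_data m n Z Y" if "C0_data m n Z Y" for Y
    using \<psi>[OF matrix_data_carrier[OF that]] by (auto simp: \<Psi>_def)
  have Ccl: "x \<in> C \<Longrightarrow> y \<in> C \<Longrightarrow> x \<oplus> y \<in> C" "x \<in> C \<Longrightarrow> y \<in> C \<Longrightarrow> x \<otimes> y \<in> C"
    "x \<in> C \<Longrightarrow> c \<odot> x \<in> C" "x \<in> C \<Longrightarrow> adj A x \<in> C" for x y c
    using sub unfolding cstar_subalgebra_def by auto
  have "matrix_function_hom A m n Z \<Psi>"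
  proof
    fix X Y c i
    show "i < m \<Longrightarrow> 0 < n i" by (rule npos)
    show "agree m n Z X Y \<Longrightarrow> \<Psi> X = \<Psi> Y" by (simp add: \<Psi>_def matrix_data_eq_iff[symmetric])
    assume Y: "C0_data m n Z Y"
    show "\<Psi> Y \<in> carrier A" using \<Psi>C[OF Y] CA by auto
    have "\<phi> (c \<odot> \<Psi> Y) = matrix_data m n Z (\<lambda>i z j k. c * Y i z j k)"
      by (simp only: scl \<Psi>C[OF Y] \<phi>\<Psi>[OF Y] matrix_data_scale)
    from this[symmetric] show "\<Psi> (\<lambda>i z j k. c * Y i z j k) = c \<odot> \<Psi> Y"
      unfolding \<Psi>_def[of "\<lambda>i z j k. c * Y i z j k"] by (simp only: \<psi>\<phi> Ccl \<Psi>C[OF Y])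
    have "\<phi> (adj A (\<Psi> Y)) = matrix_data m n Z (data_adj Y)"
      by (simp only: adj \<Psi>C[OF Y] \<phi>\<Psi>[OF Y] matrix_data_adj)
    from this[symmetric] show "\<Psi> (data_adj Y) = adj A (\<Psi> Y)"
      unfolding \<Psi>_def[of "data_adj Y"] by (simp only: \<psi>\<phi> Ccl \<Psi>C[OF Y])
    assume X: "C0_data m n Z X"
    have "\<phi> (\<Psi> X \<oplus> \<Psi> Y) = matrix_data m n Z (\<lambda>i z j k. X i z j k + Y i z j k)"
      by (simp only: add \<Psi>C[OF X] \<Psi>C[OF Y] \<phi>\<Psi>[OF X] \<phi>\<Psi>[OF Y] matrix_data_add)
    from this[symmetric] show "\<Psi> (\<lambda>i z j k. X i z j k + Y i z j k) = \<Psi> X \<oplus> \<Psi> Y"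
      unfolding \<Psi>_def[of "\<lambda>i z j k. X i z j k + Y i z j k"] by (simp only: \<psi>\<phi> Ccl \<Psi>C[OF X] \<Psi>C[OF Y])
    have "\<phi> (\<Psi> X \<otimes> \<Psi> Y) = matrix_data m n Z (data_mult n X Y)"
      by (simp only: mul \<Psi>C[OF X] \<Psi>C[OF Y] \<phi>\<Psi>[OF X] \<phi>\<Psi>[OF Y] matrix_data_mult)
    from this[symmetric] show "\<Psi> (data_mult n X Y) = \<Psi> X \<otimes> \<Psi> Y"
      unfolding \<Psi>_def[of "data_mult n X Y"] by (simp only: \<psi>\<phi> Ccl \<Psi>C[OF X] \<Psi>C[OF Y])
  qed
  moreover have "\<exists>Y. C0_data m n Z Y \<and> \<Psi> Y = c" if c: "c \<in> C" for c
  proof -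
    obtain Y where "C0_data m n Z Y" "matrix_data m n Z Y = \<phi> c"
      using matrix_data_surj[of "\<phi> c" m n Z] surj c by blast
    then show ?thesis using \<psi>\<phi>[OF c] by (auto simp: \<Psi>_def)
  qed
  ultimately show ?thesis by blast
qed

end

section \<open>Almost invertible approximations\<close>

lemma data_fun_add: "data_fun n (\<lambda>i x. G i x + H i x) Y i z j k = data_fun n G Y i z j k + data_fun n H Y i z j k"
  unfolding data_fun_def herm_fun_def spectral_fun_def by (simp add: sum.distrib distrib_right)

lemma data_fun_cmult: "data_fun n (\<lambda>i x. c * G i x) Y i z j k = of_real c * data_fun n G Y i z j k"
  unfolding data_fun_def herm_fun_def spectral_fun_def by (simp add: sum_distrib_left mult.assoc)

lemma covering_dim_less:
  assumes "covering_dim X / ereal (real n) < ereal N" "0 < n"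
  obtains k where "covering_order_le X k" "real k - 1 < N * n"
proof -
  have "covering_dim X < ereal (N * n)"
    using assms by (cases "covering_dim X") (auto simp: divide_less_eq)
  then obtain k where "covering_order_le X k" "ereal (real k - 1) < ereal (N * n)"
    unfolding covering_dim_def INF_less_iff by auto
  then show thesis using that by simp
qed

text \<open>Take \<open>r\<close> to be \<open>\<theta> * n\<close> rounded up. The lower bound on
  \<open>n\<close> gives \<open>\<theta> * n \<ge> 1\<close>, so rounding at most doubles, and
  \<open>(\<theta> * n)\<^sup>2 \<ge> (N + 1) * n \<ge> N * n + 1 > k\<close>.\<close>

lemma corank_choice:
  assumes \<theta>: "0 < \<theta>" "\<theta> \<le> 1" and N: "0 < N" and n: "(N + 1) / \<theta>\<^sup>2 \<le> real n" and k: "real k - 1 < N * n" and n0: "0 < n"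
  obtains r where "r \<le> n" "k < r\<^sup>2" "real r \<le> 2 * \<theta> * n"
proof -
  define r where "r = nat \<lceil>\<theta> * n\<rceil>"
  have \<theta>n: "0 \<le> \<theta> * n" using \<theta> by simp
  have r1: "\<theta> * n \<le> r" unfolding r_def by linarith
  have r2: "real r \<le> \<theta> * n + 1" unfolding r_def using \<theta>n by linarith
  have Nn: "N + 1 \<le> \<theta>\<^sup>2 * n" using n \<theta> by (simp add: divide_le_eq mult.commute)
  have "\<theta>\<^sup>2 \<le> \<theta>" using \<theta> by (simp add: power2_eq_square mult_left_le)
  then have "\<theta>\<^sup>2 * n \<le> \<theta> * n" by (intro mult_right_mono) auto
  then have \<theta>n1: "1 \<le> \<theta> * n" using Nn N by linarith
  have "\<theta> * n \<le> n" using \<theta> by (simp add: mult_left_le_one_le)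
  then have "r \<le> n" unfolding r_def by linarith
  moreover have "real k < (real r)\<^sup>2"
  proof -
    have "real k < N * n + 1" using k by simp
    also have "\<dots> \<le> (N + 1) * n" using n0 by (simp add: algebra_simps)
    also have "\<dots> \<le> (\<theta>\<^sup>2 * n) * n" using Nn by (intro mult_right_mono) auto
    also have "\<dots> = (\<theta> * n)\<^sup>2" by (simp add: power2_eq_square)
    also have "\<dots> \<le> (real r)\<^sup>2" using r1 \<theta>n by (intro power_mono) auto
    finally show ?thesis .
  qed
  moreover have "real r \<le> 2 * \<theta> * n" using r2 \<theta>n1 by simp
  ultimately show thesis using that[of r] by (simp flip: of_nat_power)
qed

text \<open>\<open>push \<epsilon> \<eta>\<close> moves the part of the spectrum outside \<open>[-\<eta>, \<eta>]\<close> away from \<open>(-\<epsilon>, \<epsilon>)\<close>;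
  \<open>push_inv \<epsilon> \<eta>\<close> is its reciprocal there.\<close>

definition push :: "real \<Rightarrow> real \<Rightarrow> real \<Rightarrow> real" where
  "push \<epsilon> \<eta> x = x * max \<epsilon> \<bar>x\<bar> / max \<eta> \<bar>x\<bar>"

definition push_inv :: "real \<Rightarrow> real \<Rightarrow> real \<Rightarrow> real" where
  "push_inv \<epsilon> \<eta> x = x / (max \<eta> \<bar>x\<bar> * max \<epsilon> \<bar>x\<bar>)"

lemma push_close:
  assumes "0 < \<eta>" "\<eta> \<le> \<epsilon>"
  shows "\<bar>x - push \<epsilon> \<eta> x\<bar> \<le> \<epsilon>"
proof (cases "\<epsilon> \<le> \<bar>x\<bar>")
  case True
  then have "push \<epsilon> \<eta> x = x" using assms by (simp add: push_def)
  then show ?thesis using assms by simp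
next
  case False
  define m where "m = max \<eta> \<bar>x\<bar>"
  have m: "0 < m" "\<bar>x\<bar> \<le> m" "m \<le> \<epsilon>" using assms False by (auto simp: m_def)
  have eq: "x - push \<epsilon> \<eta> x = x / m * (m - \<epsilon>)"
    using False m(1) by (simp add: push_def m_def[symmetric] field_simps)
  have "\<bar>x - push \<epsilon> \<eta> x\<bar> = \<bar>x\<bar> / m * (\<epsilon> - m)"
    unfolding eq abs_mult using m by simp
  also have "\<dots> \<le> 1 * (\<epsilon> - m)" using m by (intro mult_right_mono) auto
  finally show ?thesis using m by simp
qed

lemma push_inv_bound:
  assumes "0 < \<eta>" "0 < \<epsilon>"
  shows "\<bar>push_inv \<epsilon> \<eta> x\<bar> \<le> 1 / \<epsilon>"
proof -
  have "\<bar>push_inv \<epsilon> \<eta> x\<bar> = \<bar>x\<bar> / max \<eta> \<bar>x\<bar> * (1 / max \<epsilon> \<bar>x\<bar>)"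
    using assms by (simp add: push_inv_def abs_mult)
  also have "\<dots> \<le> 1 * (1 / \<epsilon>)" using assms by (intro mult_mono frac_le) auto
  finally show ?thesis by simp
qed

text \<open>The factors \<open>max \<epsilon> \<bar>x\<bar>\<close> cancel, leaving the square of
  \<open>x / max \<eta> \<bar>x\<bar>\<close>.\<close>

lemma push_mult_inv:
  assumes "0 < \<eta>" "0 < \<epsilon>"
  shows "0 \<le> 1 - push \<epsilon> \<eta> x * push_inv \<epsilon> \<eta> x" "1 - push \<epsilon> \<eta> x * push_inv \<epsilon> \<eta> x \<le> 1"
    "\<eta> \<le> \<bar>x\<bar> \<Longrightarrow> 1 - push \<epsilon> \<eta> x * push_inv \<epsilon> \<eta> x = 0"
proof -
  have p: "max \<epsilon> \<bar>x\<bar> > 0" "max \<eta> \<bar>x\<bar> > 0" using assms by auto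
  have eq: "push \<epsilon> \<eta> x * push_inv \<epsilon> \<eta> x = (x / max \<eta> \<bar>x\<bar>)\<^sup>2"
  proof -
    have "push \<epsilon> \<eta> x * push_inv \<epsilon> \<eta> x = (x * x) / (max \<eta> \<bar>x\<bar> * max \<eta> \<bar>x\<bar>) * (max \<epsilon> \<bar>x\<bar> / max \<epsilon> \<bar>x\<bar>)"
      unfolding push_def push_inv_def by (simp only: times_divide_times_eq mult_ac)
    then show ?thesis using p by (simp add: power2_eq_square)
  qed
  have "\<bar>x / max \<eta> \<bar>x\<bar>\<bar> \<le> 1" using p by (simp add: divide_le_eq)
  then have "(x / max \<eta> \<bar>x\<bar>)\<^sup>2 \<le> 1" by (simp add: abs_square_le_1)
  then show "0 \<le> 1 - push \<epsilon> \<eta> x * push_inv \<epsilon> \<eta> x" unfolding eq by simp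
  show "1 - push \<epsilon> \<eta> x * push_inv \<epsilon> \<eta> x \<le> 1" unfolding eq by simp
  assume "\<eta> \<le> \<bar>x\<bar>"
  then have "\<bar>x / max \<eta> \<bar>x\<bar>\<bar> = 1" using p by simp
  then have "(x / max \<eta> \<bar>x\<bar>)\<^sup>2 = 1" by (metis power2_abs one_power2)
  then show "1 - push \<epsilon> \<eta> x * push_inv \<epsilon> \<eta> x = 0" unfolding eq by simp
qed

context matrix_function_hom
begin

lemma \<Psi>_diff:
  assumes "dat X" "dat Y"
  shows "\<Psi> X \<ominus> \<Psi> Y = \<Psi> (\<lambda>i z j k. X i z j k - Y i z j k)"
proof -
  have "dat (\<lambda>i z j k. X i z j k + (-1) * Y i z j k)" by (intro C0_data_add C0_data_scale assms)
  then have "dat (\<lambda>i z j k. X i z j k - Y i z j k)" by simp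
  then show ?thesis using \<Phi>_diff[OF assms, of 0 0] assms by (simp add: \<Phi>_zero)
qed

text \<open>Elements \<open>c + G(Y)\<close> of the unitization multiply like the functions
  \<open>c + G\<close>. The data \<open>P\<close> and \<open>Q\<close> are only required to agree
  with functions of \<open>Y\<close>, so that expressions such as the negative of \<open>Y\<close>
  can be used directly.\<close>

lemma \<Phi>_herm_fun_mult:
  assumes h: "hermitian_data m n Z Y" and P: "dat P" and Q: "dat Q"
    and PG: "agree m n Z P (data_fun n G Y)" and QH: "agree m n Z Q (data_fun n H Y)"
  shows "\<Phi> (of_real c) P \<otimes> \<Phi> (of_real d) Q = \<Phi> (of_real (c * d)) (data_fun n (\<lambda>i x. c * H i x + (d * G i x + G i x * H i x)) Y)"
proof -
  have "agree m n Z (\<lambda>i z j k. of_real c * Q i z j k + of_real d * P i z j k + data_mult n P Q i z j k)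
      (data_fun n (\<lambda>i x. c * H i x + (d * G i x + G i x * H i x)) Y)"
    unfolding agree_def
  proof (intro allI ballI impI)
    fix i z j k assume a: "i < m" "z \<in> mspace (Z i)" "j < n i" "k < n i"
    have "data_mult n P Q i z j k = data_mult n (data_fun n G Y) (data_fun n H Y) i z j k"
      unfolding data_mult_def mat_prod_def using PG QH a by (intro sum.cong refl) (simp add: agree_def)
    then show "of_real c * Q i z j k + of_real d * P i z j k + data_mult n P Q i z j k
        = data_fun n (\<lambda>i x. c * H i x + (d * G i x + G i x * H i x)) Y i z j k"
      unfolding data_fun_add data_fun_cmult data_fun_mult[OF h a, symmetric] using PG QH a by (simp add: agree_def)
  qed
  then show ?thesis unfolding \<Phi>_mult[OF P Q] of_real_mult by (intro \<Phi>_cong)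
qed

lemma \<Phi>_herm_fun_adj:
  assumes P: "dat P" and PG: "agree m n Z P (data_fun n G Y)"
  shows "adj A (\<Phi> (of_real c) P) = \<Phi> (of_real c) P"
proof -
  have "hermitian_data m n Z P"
    unfolding hermitian_data_def hermitian_def
  proof (intro allI ballI impI)
    fix i z j k assume a: "i < m" "z \<in> mspace (Z i)" "j < n i" "k < n i"
    then have "P i z k j = data_fun n G Y i z k j" "P i z j k = data_fun n G Y i z j k" using PG by (auto simp: agree_def)
    then show "P i z k j = cnj (P i z j k)"
      using hermitian_data_herm_fun[of m n Z G Y] a hermitianD[of "n i" "data_fun n G Y i z" j k] by (simp add: hermitian_data_def)
  qed
  then show ?thesis using \<Phi>_adj[OF P, of "of_real c"] by (simp add: hermitian_data_iff \<Phi>_cong)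
qed

text \<open>Clamping to \<open>[0, 1]\<close> brings each number closer to 1. To turn this into an
  inequality of traces, which are positive on squares only, the difference of the two squares is
  written as the square of \<open>S\<close>; \<open>S 0 = 0\<close> keeps it in the algebra without
  unit. Clamping secures the pointwise bound 1 on the approximate unit, which is not extracted from
  its norm in \<open>A\<close>.\<close>

lemma clamp_approximate_unit:
  assumes \<tau>: "\<tau> \<in> tracial_states A" and E0: "dat E0" and h: "hermitian_data m n Z E0"
  shows "trace_norm2 A \<tau> (\<one> \<ominus> \<Psi> (data_fun n (\<lambda>i x. min 1 (max 0 x)) E0)) \<le> trace_norm2 A \<tau> (\<one> \<ominus> \<Psi> E0)"
proof -
  define G where "G x = min 1 (max 0 x)" for x :: real
  define S where "S x = sqrt ((1 - x)\<^sup>2 - (1 - G x)\<^sup>2)" for x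
  have "\<bar>1 - G x\<bar> \<le> \<bar>1 - x\<bar>" for x by (simp add: G_def)
  then have GS: "(1 - G x)\<^sup>2 + S x * S x = (1 - x)\<^sup>2" for x
    by (simp add: S_def abs_le_square_iff)
  define E where "E = data_fun n (\<lambda>i. G) E0"
  have E: "dat E" unfolding E_def
    by (rule C0_data_herm_fun[OF E0 h]) (auto simp: G_def[abs_def] intro!: continuous_intros)
  have Sd: "dat (data_fun n (\<lambda>i. S) E0)"
    by (rule C0_data_herm_fun[OF E0 h]) (auto simp: G_def[abs_def] S_def[abs_def] intro!: continuous_intros)
  have neg: "dat (\<lambda>i z j k. - Y i z j k)" if "dat Y" for Y using C0_data_scale[OF that, of "-1"] by simp
  have sub: "\<one> \<ominus> \<Psi> Y = \<Phi> (of_real 1) (\<lambda>i z j k. - Y i z j k)" if "dat Y" for Y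
    using \<Phi>_diff[OF C0_data_zero that, of 1 0] that by (simp add: \<Phi>_one \<Phi>_zero)
  have agE0: "agree m n Z (\<lambda>i z j k. - E0 i z j k) (data_fun n (\<lambda>i x. - 1 * x) E0)"
    unfolding agree_def data_fun_cmult[of _ _ "\<lambda>i x. x"] using data_fun_id[OF h] by simp
  have agE: "agree m n Z (\<lambda>i z j k. - E i z j k) (data_fun n (\<lambda>i x. - 1 * G x) E0)"
    unfolding agree_def data_fun_cmult[of _ _ "\<lambda>i. G"] E_def by simp
  have agS: "agree m n Z (data_fun n (\<lambda>i. S) E0) (data_fun n (\<lambda>i. S) E0)" by (simp add: agree_def)
  let ?y = "\<one> \<ominus> \<Psi> E0" and ?x = "\<one> \<ominus> \<Psi> E" and ?s = "\<Phi> (of_real 0) (data_fun n (\<lambda>i. S) E0)"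
  have cl: "?y \<in> carrier A" "?x \<in> carrier A" "?s \<in> carrier A"
    by (intro diff_closed closed \<Psi>_closed E0 E \<Phi>_closed Sd)+
  have x0: "adj A ?y \<otimes> ?y = \<Phi> 1 (data_fun n (\<lambda>i x. (1 - x)\<^sup>2 - 1) E0)"
    unfolding sub[OF E0] \<Phi>_herm_fun_adj[OF neg[OF E0] agE0] \<Phi>_herm_fun_mult[OF h neg[OF E0] neg[OF E0] agE0 agE0]
    by (simp add: power2_eq_square algebra_simps)
  have x: "adj A ?x \<otimes> ?x = \<Phi> 1 (data_fun n (\<lambda>i x. (1 - G x)\<^sup>2 - 1) E0)"
    unfolding sub[OF E] \<Phi>_herm_fun_adj[OF neg[OF E] agE] \<Phi>_herm_fun_mult[OF h neg[OF E] neg[OF E] agE agE]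
    by (simp add: power2_eq_square algebra_simps)
  have s: "adj A ?s \<otimes> ?s = \<Phi> 0 (data_fun n (\<lambda>i x. S x * S x) E0)"
    unfolding \<Phi>_herm_fun_adj[OF Sd agS] \<Phi>_herm_fun_mult[OF h Sd Sd agS agS] by simp
  have d1: "dat (data_fun n (\<lambda>i x. (1 - G x)\<^sup>2 - 1) E0)" "dat (data_fun n (\<lambda>i x. S x * S x) E0)"
    by (rule C0_data_herm_fun[OF E0 h]; auto simp: G_def[abs_def] S_def[abs_def] intro!: continuous_intros)+
  have eqf: "(\<lambda>i x. (1 - G x)\<^sup>2 - 1 + S x * S x) = (\<lambda>(i :: nat) x. (1 - x)\<^sup>2 - 1)"
    using GS by (simp add: fun_eq_iff algebra_simps)
  have "adj A ?x \<otimes> ?x \<oplus> adj A ?s \<otimes> ?s = adj A ?y \<otimes> ?y"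
    unfolding x0 x s \<Phi>_add[OF d1] data_fun_add[symmetric] eqf by simp
  then have "\<tau> (adj A ?x \<otimes> ?x) + \<tau> (adj A ?s \<otimes> ?s) = \<tau> (adj A ?y \<otimes> ?y)"
    using tr_add[OF \<tau>, of "adj A ?x \<otimes> ?x" "adj A ?s \<otimes> ?s"] cl closed by metis
  then have "Re (\<tau> (adj A ?x \<otimes> ?x)) + Re (\<tau> (adj A ?s \<otimes> ?s)) = Re (\<tau> (adj A ?y \<otimes> ?y))"
    by (metis plus_complex.simps(1))
  then have "Re (\<tau> (adj A ?x \<otimes> ?x)) \<le> Re (\<tau> (adj A ?y \<otimes> ?y))" using tr_pos[OF \<tau> cl(3)] by linarith
  then show ?thesis unfolding trace_norm2_def E_def G_def[abs_def] by (rule real_sqrt_le_mono)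
qed

text \<open>With the clamped approximate unit \<open>e = \<Psi> E\<close>, split
  \<open>1 - b c = (1 - e) (1 - b c) + e (1 - b c)\<close>. The first term is at most
  \<open>\<delta>\<close> times the norm of \<open>1 - b c\<close>. The second comes from a
  matrix-valued function whose squared Hilbert-Schmidt norm is at most
  \<open>2 * \<theta> * n i\<close> at each point: either \<open>E\<close> is small there, or
  \<open>1 - b c\<close> has rank less than \<open>r\<close>. The error
  \<open>2 * \<epsilon>\<close> is one \<open>\<epsilon>\<close> for the perturbation and one for
  pushing the spectrum.\<close>

lemma almost_invertible_approximation:
  fixes \<epsilon> \<theta> \<delta> :: real
  assumes T: "tracial_states A \<noteq> {}"
    and F: "dat F" "hermitian_data m n Z F" and E0: "dat E0" "hermitian_data m n Z E0"
    and \<epsilon>: "0 < \<epsilon>" and \<theta>: "0 < \<theta>"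
    and dims: "\<And>i. i < m \<Longrightarrow> \<exists>k r. covering_order_le (mtopology_of (Z i)) k \<and> r \<le> n i \<and> k < r\<^sup>2 \<and> real r \<le> 2 * \<theta> * n i"
    and \<delta>: "uniform_norm2 A (\<one> \<ominus> \<Psi> E0) \<le> \<delta>"
  shows "\<exists>b c. b \<in> carrier A \<and> c \<in> carrier A \<and> adj A b = b \<and> adj A c = c \<and>
     alg_norm A (\<Psi> F \<ominus> b) \<le> 2 * \<epsilon> \<and> alg_norm A c \<le> 1 / \<epsilon> \<and>
     uniform_norm2 A (\<one> \<ominus> b \<otimes> c) \<le> \<delta> * (1 + alg_norm A b * alg_norm A c) + sqrt (2 * \<theta>)"
proof -
  define E where "E = data_fun n (\<lambda>i x. min 1 (max 0 x)) E0"
  have E: "dat E" unfolding E_def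
    by (rule C0_data_herm_fun[OF E0]) (auto intro!: continuous_intros)
  have hE: "hermitian_data m n Z E" unfolding E_def by (rule hermitian_data_herm_fun)
  have oE: "op_bound (n i) (E i z) 1" if "i < m" "z \<in> mspace (Z i)" for i z
    unfolding E_def data_fun_def herm_fun_def
    by (rule op_bound_spectral_fun[OF spectral_choice]) (use E0(2) that in \<open>auto simp: hermitian_data_def\<close>)
  have ex: "\<exists>b \<eta> r. 0 < \<eta> \<and> real r \<le> 2 * \<theta> * n i \<and> (\<forall>z\<in>mspace (Z i). hermitian (n i) (b z)) \<and>
    (\<forall>j<n i. \<forall>k<n i. (\<lambda>z. b z j k) \<in> C0_functions (mtopology_of (Z i))) \<and>
    (\<forall>z\<in>mspace (Z i). \<forall>j<n i. \<forall>k<n i. cmod (b z j k - F i z j k) \<le> \<epsilon> / n i) \<and>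
    (\<forall>z\<in>mspace (Z i). (\<forall>u d. spectral (n i) (b z) u d \<longrightarrow> card {l. l < n i \<and> \<bar>d l\<bar> \<le> \<eta>} < r) \<or> hs_sq (n i) (E i z) \<le> \<theta> * n i)"
    if i: "i < m" for i
  proof -
    obtain k r where k: "covering_order_le (mtopology_of (Z i)) k" "r \<le> n i" "k < r\<^sup>2" and r: "real r \<le> 2 * \<theta> * n i"
      using dims[OF i] by blast
    \<comment> \<open>The entrywise error \<open>\<epsilon> / n i\<close> becomes the operator bound
      \<open>\<epsilon>\<close> by \<open>op_bound_entries\<close>; \<open>\<theta> * n i\<close> is
      the level below which \<open>E\<close> counts as small.\<close>
    have pos: "0 < \<epsilon> / n i" "0 < \<theta> * n i" using \<epsilon> \<theta> size_pos[OF i] by auto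
    have 1: "\<forall>z\<in>mspace (Z i). hermitian (n i) (F i z)" using F(2) i by (simp add: hermitian_data_def)
    have 2: "\<forall>j<n i. \<forall>k<n i. (\<lambda>z. F i z j k) \<in> C0_functions (mtopology_of (Z i))" using F(1) i by (simp add: C0_data_def)
    have 3: "\<forall>j<n i. \<forall>k<n i. (\<lambda>z. E i z j k) \<in> C0_functions (mtopology_of (Z i))" using E i by (simp add: C0_data_def)
    from generic_perturbation[OF k(1) 1 2 3 pos k(2,3)] r show ?thesis by (elim exE conjE) (intro exI conjI, assumption+)
  qed
  have "\<forall>i. \<exists>b \<eta> r. i < m \<longrightarrow> 0 < \<eta> \<and> real r \<le> 2 * \<theta> * n i \<and> (\<forall>z\<in>mspace (Z i). hermitian (n i) (b z)) \<and>
    (\<forall>j<n i. \<forall>k<n i. (\<lambda>z. b z j k) \<in> C0_functions (mtopology_of (Z i))) \<and>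
    (\<forall>z\<in>mspace (Z i). \<forall>j<n i. \<forall>k<n i. cmod (b z j k - F i z j k) \<le> \<epsilon> / n i) \<and>
    (\<forall>z\<in>mspace (Z i). (\<forall>u d. spectral (n i) (b z) u d \<longrightarrow> card {l. l < n i \<and> \<bar>d l\<bar> \<le> \<eta>} < r) \<or> hs_sq (n i) (E i z) \<le> \<theta> * n i)"
    (is "\<forall>i. ?ex i")
  proof
    fix i
    show "?ex i"
    proof (cases "i < m")
      case True
      from ex[OF True] show ?thesis by (elim exE) (rule exI, rule exI, rule exI, rule impI, assumption)
    next
      case False
      show ?thesis by (intro exI impI) (rule notE[OF False])
    qed
  qed
  then have "\<exists>b \<eta> r. \<forall>i. i < m \<longrightarrow> 0 < \<eta> i \<and> real (r i) \<le> 2 * \<theta> * n i \<and> (\<forall>z\<in>mspace (Z i). hermitian (n i) (b i z)) \<and>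
    (\<forall>j<n i. \<forall>k<n i. (\<lambda>z. b i z j k) \<in> C0_functions (mtopology_of (Z i))) \<and>
    (\<forall>z\<in>mspace (Z i). \<forall>j<n i. \<forall>k<n i. cmod (b i z j k - F i z j k) \<le> \<epsilon> / n i) \<and>
    (\<forall>z\<in>mspace (Z i). (\<forall>u d. spectral (n i) (b i z) u d \<longrightarrow> card {l. l < n i \<and> \<bar>d l\<bar> \<le> \<eta> i} < r i) \<or> hs_sq (n i) (E i z) \<le> \<theta> * n i)"
    unfolding choice_iff .
  then obtain b0 \<eta> r where b0: "\<And>i. i < m \<Longrightarrow> 0 < \<eta> i \<and> real (r i) \<le> 2 * \<theta> * n i \<and> (\<forall>z\<in>mspace (Z i). hermitian (n i) (b0 i z)) \<and>
    (\<forall>j<n i. \<forall>k<n i. (\<lambda>z. b0 i z j k) \<in> C0_functions (mtopology_of (Z i))) \<and>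
    (\<forall>z\<in>mspace (Z i). \<forall>j<n i. \<forall>k<n i. cmod (b0 i z j k - F i z j k) \<le> \<epsilon> / n i) \<and>
    (\<forall>z\<in>mspace (Z i). (\<forall>u d. spectral (n i) (b0 i z) u d \<longrightarrow> card {l. l < n i \<and> \<bar>d l\<bar> \<le> \<eta> i} < r i) \<or> hs_sq (n i) (E i z) \<le> \<theta> * n i)"
    by blast
  have B0: "dat b0" unfolding C0_data_def using b0 by blast
  have hB0: "hermitian_data m n Z b0" unfolding hermitian_data_def using b0 by blast
  have sp: "spectral (n i) (b0 i z) (fst (spectral_choice (n i) (b0 i z))) (snd (spectral_choice (n i) (b0 i z)))"
    if "i < m" "z \<in> mspace (Z i)" for i z
    using hB0 that by (intro spectral_choice) (auto simp: hermitian_data_def)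
  \<comment> \<open>\<open>push_close\<close> requires the threshold not to exceed
    \<open>\<epsilon>\<close>; lowering it preserves the count of small eigenvalues.\<close>
  define \<eta>' where "\<eta>' i = min (\<eta> i) \<epsilon>" for i
  have \<eta>': "0 < \<eta>' i" "\<eta>' i \<le> \<epsilon>" "\<eta>' i \<le> \<eta> i" if "i < m" for i using b0[OF that] \<epsilon> by (auto simp: \<eta>'_def)
  define G where "G i = push \<epsilon> (\<eta>' i)" for i
  define H where "H i = push_inv \<epsilon> (\<eta>' i)" for i
  have Gc: "continuous_on UNIV (G i)" "G i 0 = 0" if "i < m" for i
    using \<eta>'[OF that] \<epsilon> unfolding G_def push_def[abs_def] by (auto intro!: continuous_intros)
  have Hc: "continuous_on UNIV (H i)" "H i 0 = 0" if "i < m" for i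
    using \<eta>'[OF that] \<epsilon> unfolding H_def push_inv_def[abs_def] by (auto intro!: continuous_intros)
  define B where "B = data_fun n G b0"
  define C where "C = data_fun n H b0"
  have B: "dat B" unfolding B_def by (rule C0_data_herm_fun[OF B0 hB0 Gc])
  have C: "dat C" unfolding C_def by (rule C0_data_herm_fun[OF B0 hB0 Hc])
  have hB: "hermitian_data m n Z B" and hC: "hermitian_data m n Z C" unfolding B_def C_def by (rule hermitian_data_herm_fun)+
  let ?b = "\<Psi> B" and ?c = "\<Psi> C"
  have bc: "?b \<in> carrier A" "?c \<in> carrier A" by (intro \<Psi>_closed B C)+
  have sa: "adj A ?b = ?b" "adj A ?c = ?c"
    using hB hC unfolding hermitian_data_iff by (metis \<Psi>_adj B C \<Psi>_cong)+
  have dif: "dat (\<lambda>i z j k. X i z j k - Y i z j k)" if "dat X" "dat Y" for X Y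
    using C0_data_add[OF that(1) C0_data_scale[OF that(2), of "-1"]] by simp
  have hdif: "hermitian_data m n Z (\<lambda>i z j k. X i z j k - Y i z j k)" if X: "hermitian_data m n Z X" and Y: "hermitian_data m n Z Y" for X Y
    unfolding hermitian_data_def
  proof (intro allI impI ballI)
    fix i z assume a: "i < m" "z \<in> mspace (Z i)"
    then have "hermitian (n i) (X i z)" "hermitian (n i) (Y i z)" using X Y by (auto simp: hermitian_data_def)
    from hermitianD[OF this(1)] hermitianD[OF this(2)] show "hermitian (n i) (\<lambda>j k. X i z j k - Y i z j k)"
      by (simp add: hermitian_def)
  qed
  have n1: "alg_norm A (\<Psi> F \<ominus> \<Psi> b0) \<le> \<epsilon>"
    unfolding \<Psi>_diff[OF F(1) B0]
  proof (rule \<Psi>_norm_le[OF dif[OF F(1) B0] hdif[OF F(2) hB0] \<epsilon>])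
    fix i z assume a: "i < m" "z \<in> mspace (Z i)"
    have "op_bound (n i) (\<lambda>j k. F i z j k - b0 i z j k) (n i * (\<epsilon> / n i))"
    proof (rule op_bound_entries)
      fix j k assume "j < n i" "k < n i"
      then have "cmod (b0 i z j k - F i z j k) \<le> \<epsilon> / n i" using b0[OF a(1)] a by blast
      then show "cmod (F i z j k - b0 i z j k) \<le> \<epsilon> / n i" by (simp only: norm_minus_commute)
    qed (use \<epsilon> in auto)
    then show "op_bound (n i) (\<lambda>j k. F i z j k - b0 i z j k) \<epsilon>" using size_pos[OF a(1)] by simp
  qed
  have n2: "alg_norm A (\<Psi> b0 \<ominus> ?b) \<le> \<epsilon>"
    unfolding \<Psi>_diff[OF B0 B]
  proof (rule \<Psi>_norm_le[OF dif[OF B0 B] hdif[OF hB0 hB] \<epsilon>])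
    fix i z assume a: "i < m" "z \<in> mspace (Z i)"
    have "op_bound (n i) (data_fun n (\<lambda>i x. x + -1 * G i x) b0 i z) \<epsilon>"
      unfolding data_fun_def herm_fun_def
      by (rule op_bound_spectral_fun[OF sp[OF a]]) (use push_close[OF \<eta>'(1,2)[OF a(1)]] \<epsilon> in \<open>auto simp: G_def\<close>)
    also have "op_bound (n i) (data_fun n (\<lambda>i x. x + -1 * G i x) b0 i z) \<epsilon> = op_bound (n i) (\<lambda>j k. b0 i z j k - B i z j k) \<epsilon>"
      by (rule op_bound_cong) (unfold data_fun_add data_fun_cmult, simp add: data_fun_id[OF hB0 a] B_def)
    finally show "op_bound (n i) (\<lambda>j k. b0 i z j k - B i z j k) \<epsilon>" .
  qed
  have "alg_norm A (\<Psi> F \<ominus> ?b) \<le> 2 * \<epsilon>"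
  proof -
    have "\<Psi> F \<ominus> ?b = (\<Psi> F \<ominus> \<Psi> b0) \<oplus> (\<Psi> b0 \<ominus> ?b)"
      unfolding \<Psi>_diff[OF F(1) B] \<Psi>_diff[OF F(1) B0] \<Psi>_diff[OF B0 B] \<Psi>_add[OF dif[OF F(1) B0] dif[OF B0 B], symmetric]
      by simp
    then show ?thesis
      using n1 n2 norm_triangle[of "\<Psi> F \<ominus> \<Psi> b0" "\<Psi> b0 \<ominus> ?b"] \<Psi>_closed F(1) B0 B by (simp add: diff_closed)
  qed
  moreover have "alg_norm A ?c \<le> 1 / \<epsilon>"
  proof (rule \<Psi>_norm_le[OF C hC])
    fix i z assume a: "i < m" "z \<in> mspace (Z i)"
    show "op_bound (n i) (C i z) (1 / \<epsilon>)"
      unfolding C_def data_fun_def herm_fun_def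
      by (rule op_bound_spectral_fun[OF sp[OF a]]) (use push_inv_bound[OF \<eta>'(1)[OF a(1)] \<epsilon>] \<epsilon> in \<open>auto simp: H_def\<close>)
  qed (use \<epsilon> in simp)
  moreover have "uniform_norm2 A (\<one> \<ominus> ?b \<otimes> ?c) \<le> \<delta> * (1 + alg_norm A ?b * alg_norm A ?c) + sqrt (2 * \<theta>)"
  proof -
    let ?q = "\<one> \<ominus> ?b \<otimes> ?c" and ?e = "\<Psi> E"
    have e: "?e \<in> carrier A" by (rule \<Psi>_closed[OF E])
    have q: "?q \<in> carrier A" by (intro diff_closed closed bc)
    have BC: "dat (data_mult n B C)" by (rule C0_data_mult[OF B C])
    define N where "N = (\<lambda>i z j k. - data_mult n B C i z j k)"
    have N: "dat N" using C0_data_scale[OF BC, of "-1"] by (simp add: N_def)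
    have qN: "?q = \<Phi> 1 N"
      using \<Phi>_diff[OF C0_data_zero BC, of 1 0] BC by (simp add: \<Phi>_one \<Phi>_zero \<Psi>_mult[OF B C] N_def)
    define Y where "Y = (\<lambda>i z j k. E i z j k + data_mult n E N i z j k)"
    have Y: "dat Y" unfolding Y_def by (intro C0_data_add C0_data_mult E N)
    have eq: "?e \<otimes> ?q = \<Psi> Y"
      unfolding qN using \<Phi>_mult[OF E N, of 0 1] E Y by (simp add: \<Phi>_zero Y_def)
    have hsY: "hs_sq (n i) (Y i z) \<le> 2 * \<theta> * n i" if a: "i < m" "z \<in> mspace (Z i)" for i z
    proof -
      \<comment> \<open>The value of \<open>1 - b c\<close> at \<open>z\<close>. As it does not
        vanish at infinity, it enters the algebra only as 1 plus the data \<open>N\<close>, or after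
        multiplication by \<open>E\<close>.\<close>
      define Q where "Q = spectral_fun (n i) (fst (spectral_choice (n i) (b0 i z))) (snd (spectral_choice (n i) (b0 i z))) (\<lambda>x. 1 - G i x * H i x)"
      have oQ: "op_bound (n i) Q 1"
        unfolding Q_def
        by (rule op_bound_spectral_fun[OF sp[OF a]]) (use push_mult_inv(1,2)[OF \<eta>'(1)[OF a(1)] \<epsilon>] in \<open>auto simp: G_def H_def abs_le_iff\<close>)
      have hQ: "hermitian (n i) Q" unfolding Q_def by (rule spectral_fun_hermitian)
      have Qe: "Q l k = (if l = k then 1 else 0) + N i z l k" if "l < n i" "k < n i" for l k
      proof -
        have "N i z l k = - data_fun n (\<lambda>i x. G i x * H i x) b0 i z l k"
          unfolding N_def B_def C_def data_fun_mult[OF hB0 a that] ..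
        then show ?thesis
          unfolding spectral_fun_one[OF sp[OF a] that, symmetric]
          by (simp add: Q_def data_fun_def herm_fun_def spectral_fun_def left_diff_distrib sum_subtractf)
      qed
      have "hs_sq (n i) (Y i z) = hs_sq (n i) (mat_prod (n i) (E i z) Q)"
      proof (rule hs_sq_cong)
        fix j k assume jk: "j < n i" "k < n i"
        have "mat_prod (n i) (E i z) Q j k = (\<Sum>l<n i. (if l = k then E i z j k else 0) + E i z j l * N i z l k)"
          unfolding mat_prod_def using jk by (intro sum.cong refl) (simp add: Qe distrib_left)
        also have "\<dots> = Y i z j k" using jk by (simp add: sum.distrib Y_def data_mult_def mat_prod_def)
        finally show "Y i z j k = mat_prod (n i) (E i z) Q j k" ..
      qed
      also have "\<dots> \<le> 2 * \<theta> * n i"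
      proof (cases "hs_sq (n i) (E i z) \<le> \<theta> * n i")
        case True
        have "hs_sq (n i) (mat_prod (n i) (E i z) Q) \<le> 1\<^sup>2 * hs_sq (n i) (E i z)" by (rule hs_sq_mat_prod_right[OF oQ])
        moreover have "\<theta> * n i \<le> 2 * \<theta> * n i" using \<theta> by simp
        ultimately show ?thesis using True by simp
      next
        case False
        then have card: "card {l. l < n i \<and> \<bar>snd (spectral_choice (n i) (b0 i z)) l\<bar> \<le> \<eta> i} < r i"
          using b0[OF a(1)] a(2) sp[OF a] by blast
        have hEz: "hermitian (n i) (E i z)" using hE a by (simp add: hermitian_data_def)
        have "hs_sq (n i) (mat_prod (n i) (E i z) Q) \<le> 1\<^sup>2 * hs_sq (n i) Q" by (rule hs_sq_mat_prod_left[OF oE[OF a] hEz hQ])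
        also have "hs_sq (n i) Q = (\<Sum>l<n i. (1 - G i (snd (spectral_choice (n i) (b0 i z)) l) * H i (snd (spectral_choice (n i) (b0 i z)) l))\<^sup>2)"
          unfolding Q_def by (rule hs_sq_spectral_fun[OF sp[OF a]])
        \<comment> \<open>Eigenvalues of modulus greater than \<open>\<eta> i\<close> are inverted
          exactly and contribute 0; each of the others contributes at most 1.\<close>
        also have "\<dots> \<le> (\<Sum>l<n i. if \<bar>snd (spectral_choice (n i) (b0 i z)) l\<bar> \<le> \<eta> i then 1 else 0)"
        proof (rule sum_mono)
          fix l
          let ?d = "snd (spectral_choice (n i) (b0 i z)) l"
          note p = push_mult_inv[OF \<eta>'(1)[OF a(1)] \<epsilon>, of ?d]
          show "(1 - G i ?d * H i ?d)\<^sup>2 \<le> (if \<bar>?d\<bar> \<le> \<eta> i then 1 else 0)"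
          proof (cases "\<bar>?d\<bar> \<le> \<eta> i")
            case True
            have "(1 - G i ?d * H i ?d)\<^sup>2 \<le> 1" using p(1,2) by (intro power_le_one) (auto simp: G_def H_def)
            then show ?thesis using True by simp
          next
            case False
            then have "\<eta>' i \<le> \<bar>?d\<bar>" using \<eta>'(3)[OF a(1)] by linarith
            then have "1 - G i ?d * H i ?d = 0" using p(3) by (simp add: G_def H_def)
            then show ?thesis using False by simp
          qed
        qed
        also have "\<dots> = real (card {l. l < n i \<and> \<bar>snd (spectral_choice (n i) (b0 i z)) l\<bar> \<le> \<eta> i})"
          by (simp add: sum.If_cases Int_def lessThan_def)
        finally show ?thesis using card b0[OF a(1)] by simp
      qed
      finally show ?thesis .
    qed
    have ue: "uniform_norm2 A (\<one> \<ominus> ?e) \<le> \<delta>"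
    proof (rule uniform_norm2_le[OF T])
      fix \<tau> assume \<tau>: "\<tau> \<in> tracial_states A"
      have "\<one> \<ominus> \<Psi> E0 \<in> carrier A" by (intro diff_closed closed \<Psi>_closed E0)
      from trace_norm2_le_uniform[OF T \<tau> this] clamp_approximate_unit[OF \<tau> E0] \<delta>
      show "trace_norm2 A \<tau> (\<one> \<ominus> ?e) \<le> \<delta>" unfolding E_def by linarith
    qed
    have uY: "uniform_norm2 A (\<Psi> Y) \<le> sqrt (2 * \<theta>)"
    proof (rule uniform_norm2_le[OF T])
      fix \<tau> assume \<tau>: "\<tau> \<in> tracial_states A"
      have "(trace_norm2 A \<tau> (\<Psi> Y))\<^sup>2 \<le> 2 * \<theta>"
        by (rule trace_norm2_hs_sq_le[OF \<tau> Y _ hsY]) (use \<theta> in auto)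
      then show "trace_norm2 A \<tau> (\<Psi> Y) \<le> sqrt (2 * \<theta>)" by (rule real_le_rsqrt)
    qed
    have "?q = (\<one> \<ominus> ?e) \<otimes> ?q \<oplus> ?e \<otimes> ?q"
    proof -
      have "(\<one> \<ominus> ?e) \<oplus> ?e = \<one>" using e by (simp add: a_minus_def M.a_assoc M.l_neg closed)
      then show ?thesis using e q mult_add_left[of "\<one> \<ominus> ?e" ?e ?q] by (simp add: diff_closed closed)
    qed
    then have "uniform_norm2 A ?q \<le> uniform_norm2 A ((\<one> \<ominus> ?e) \<otimes> ?q) + uniform_norm2 A (?e \<otimes> ?q)"
      using uniform_norm2_triangle[OF T, of "(\<one> \<ominus> ?e) \<otimes> ?q" "?e \<otimes> ?q"] e q by (metis diff_closed closed(3,4))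
    also have "\<dots> \<le> uniform_norm2 A (\<one> \<ominus> ?e) * alg_norm A ?q + sqrt (2 * \<theta>)"
      using uniform_norm2_mult_right[OF T, of "\<one> \<ominus> ?e" ?q] uY e q unfolding eq by (simp add: diff_closed closed)
    also have "\<dots> \<le> \<delta> * (1 + alg_norm A ?b * alg_norm A ?c) + sqrt (2 * \<theta>)"
    proof -
      have "alg_norm A ?q \<le> alg_norm A \<one> + alg_norm A ((-1) \<odot> (?b \<otimes> ?c))"
        unfolding diff_scale[OF unit_closed mult_closed[OF bc]] by (intro norm_triangle closed bc)
      also have "\<dots> \<le> 1 + alg_norm A ?b * alg_norm A ?c"
        using alg_norm_one_le norm_smult[OF mult_closed[OF bc], of "-1"] norm_mult[OF bc] by simp
      finally have "alg_norm A ?q \<le> 1 + alg_norm A ?b * alg_norm A ?c" .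
      moreover have "0 \<le> \<delta>"
        using uniform_norm2_nonneg[OF T, of "\<one> \<ominus> ?e"] e ue by (simp add: diff_closed closed)
      ultimately show ?thesis
        using ue alg_norm_nonneg[OF q] by (intro add_right_mono mult_mono) auto
    qed
    finally show ?thesis .
  qed
  ultimately show ?thesis using bc sa by (intro exI[of _ ?b] exI[of _ ?c]) simp
qed

text \<open>Replace the approximant by its Hermitian part. As \<open>x\<close> is self-adjoint, the
  new error is the Hermitian part of the old one, and adjoints preserve both norms.\<close>

lemma real_part:
  assumes X: "dat X" and x: "x \<in> carrier A" "adj A x = x" and T: "tracial_states A \<noteq> {}"
  shows "\<exists>Y. dat Y \<and> hermitian_data m n Z Y \<and> adj A (\<Psi> Y) = \<Psi> Y \<and> alg_norm A (\<Psi> Y) \<le> alg_norm A (\<Psi> X) \<and>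
     uniform_norm2 A (x \<ominus> \<Psi> Y) \<le> uniform_norm2 A (x \<ominus> \<Psi> X)"
proof -
  define Y where "Y = (\<lambda>i z j k. 1 / 2 * (X i z j k + data_adj X i z j k))"
  have Y: "dat Y" unfolding Y_def by (intro C0_data_scale C0_data_add C0_data_adj X)
  have h: "hermitian_data m n Z Y" by (auto simp: hermitian_data_def hermitian_def Y_def data_adj_def)
  let ?c = "\<Psi> X"
  have c: "?c \<in> carrier A" by (rule \<Psi>_closed[OF X])
  have Yc: "\<Psi> Y = (1 / 2) \<odot> (?c \<oplus> adj A ?c)"
    unfolding Y_def by (simp only: \<Psi>_scale \<Psi>_add \<Psi>_adj C0_data_add C0_data_adj X)
  have aY: "adj A (\<Psi> Y) = \<Psi> Y" using h unfolding hermitian_data_iff by (metis \<Psi>_adj Y \<Psi>_cong)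
  have "alg_norm A (\<Psi> Y) \<le> 1 / 2 * (alg_norm A ?c + alg_norm A (adj A ?c))"
    unfolding Yc using c norm_triangle[OF c adj_closed[OF c]] norm_smult[of "?c \<oplus> adj A ?c" "1 / 2"] by (simp add: closed)
  then have nY: "alg_norm A (\<Psi> Y) \<le> alg_norm A ?c" using c by (simp add: alg_norm_adj)
  have "x \<ominus> \<Psi> Y = (1 / 2) \<odot> ((x \<ominus> ?c) \<oplus> adj A (x \<ominus> ?c))"
  proof -
    have "adj A (x \<ominus> ?c) = x \<oplus> (-1) \<odot> adj A ?c"
      using x c by (simp add: diff_scale adj_add adj_smult closed)
    then have "(x \<ominus> ?c) \<oplus> adj A (x \<ominus> ?c) = (x \<oplus> x) \<oplus> (-1) \<odot> (?c \<oplus> adj A ?c)"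
      using x c by (simp add: diff_scale closed scale_add_right M.a_ac)
    moreover have "x \<oplus> x = 2 \<odot> x" using x scale_add[OF x(1), of 1 1] by (simp add: scale_one)
    ultimately show ?thesis
      unfolding Yc using x c by (simp add: diff_scale closed scale_add_right scale_scale scale_one)
  qed
  moreover have d: "x \<ominus> ?c \<in> carrier A" using x c by (simp add: diff_closed)
  ultimately have "uniform_norm2 A (x \<ominus> \<Psi> Y) \<le> cmod (1 / 2) * uniform_norm2 A ((x \<ominus> ?c) \<oplus> adj A (x \<ominus> ?c))"
    using uniform_norm2_scale[OF T, of "(x \<ominus> ?c) \<oplus> adj A (x \<ominus> ?c)" "1 / 2"] by (simp only: closed)
  also have "\<dots> \<le> cmod (1 / 2) * (uniform_norm2 A (x \<ominus> ?c) + uniform_norm2 A (adj A (x \<ominus> ?c)))"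
    by (intro mult_left_mono uniform_norm2_triangle[OF T] d closed) auto
  also have "\<dots> = uniform_norm2 A (x \<ominus> ?c)" using d by (simp add: uniform_norm2_adj[OF T])
  finally show ?thesis using Y h aY nY by blast
qed

end

context unital_cstar_algebra
begin

lemma flat_growth_approximation:
  assumes T: "tracial_states A \<noteq> {}" and flat: "locally_flat_dimension_growth TYPE('z) A"
    and a: "a \<in> carrier A" "adj A a = a" "alg_norm A a \<le> 1" and \<epsilon>: "0 < \<epsilon>" and \<delta>: "0 < \<delta>"
  shows "\<exists>a' b c. a' \<in> carrier A \<and> b \<in> carrier A \<and> c \<in> carrier A \<and> adj A b = b \<and> adj A c = c \<and>
     alg_norm A a' \<le> 1 \<and> uniform_norm2 A (a \<ominus> a') \<le> \<delta> \<and>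
     alg_norm A (a' \<ominus> b) \<le> 2 * \<epsilon> \<and> alg_norm A c \<le> 1 / \<epsilon> \<and> uniform_norm2 A (\<one> \<ominus> b \<otimes> c) \<le> \<delta>"
proof -
  \<comment> \<open>\<open>K\<close> bounds \<open>1 + alg_norm A b * alg_norm A c\<close>, because
    \<open>b\<close> will have norm at most \<open>1 + 2 * \<epsilon>\<close> and \<open>c\<close>
    at most \<open>1 / \<epsilon>\<close>.\<close>
  define K where "K = 1 + (1 + 2 * \<epsilon>) * (1 / \<epsilon>)"
  have K: "1 \<le> K" using \<epsilon> by (simp add: K_def)
  define \<delta>0 where "\<delta>0 = \<delta> / (2 * K)"
  have \<delta>0: "0 < \<delta>0" using \<delta> K by (simp add: \<delta>0_def)
  have \<delta>K: "\<delta>0 * K = \<delta> / 2" using K by (simp add: \<delta>0_def)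
  have \<delta>0\<delta>: "\<delta>0 \<le> \<delta>" using K \<delta> by (simp add: \<delta>0_def divide_le_eq)
  \<comment> \<open>Chosen so that \<open>sqrt (2 * \<theta>)\<close> uses half of
    \<open>\<delta>\<close>; the other half is \<open>\<delta>0 * K\<close>.\<close>
  define \<theta> where "\<theta> = min 1 (\<delta>\<^sup>2 / 8)"
  have \<theta>: "0 < \<theta>" "\<theta> \<le> 1" using \<delta> by (auto simp: \<theta>_def)
  have s\<theta>: "sqrt (2 * \<theta>) \<le> \<delta> / 2"
    using \<delta> by (intro real_le_lsqrt) (auto simp: \<theta>_def power_divide)
  \<comment> \<open>The unit is approximated together with \<open>a\<close>: its approximant
    supplies the approximate unit of the subalgebra.\<close>
  have "finite {a, \<one>} \<and> {a, \<one>} \<subseteq> contractions A \<and> 0 < \<delta>0"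
    using a \<delta>0 alg_norm_one_le by (simp add: contractions_def closed)
  from flat[unfolded locally_flat_dimension_growth_def, rule_format, OF this]
  obtain N :: real where N: "0 < N" and "\<forall>k. \<exists>C m n (Z :: nat \<Rightarrow> 'z metric).
      LTH_subalgebra A C m n Z \<and> tracially_approximates A C {a, \<one>} \<delta>0 \<and>
      (\<forall>i<m. k \<le> n i \<and> covering_dim (mtopology_of (Z i)) / ereal (real (n i)) < ereal N)"
    by (elim exE conjE) (rule that)
  \<comment> \<open>Flatness enters here: \<open>N\<close> is fixed before the matrix sizes, so they
    can be required to exceed \<open>(N + 1) / \<theta>\<^sup>2\<close>, as
    \<open>corank_choice\<close> demands.\<close>
  then obtain C m n and Z :: "nat \<Rightarrow> 'z metric" where LTH: "LTH_subalgebra A C m n Z"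
    and ap: "tracially_approximates A C {a, \<one>} \<delta>0"
    and dim: "\<forall>i<m. nat \<lceil>(N + 1) / \<theta>\<^sup>2\<rceil> \<le> n i \<and> covering_dim (mtopology_of (Z i)) / ereal (real (n i)) < ereal N"
    by blast
  obtain \<Psi> where \<Psi>: "matrix_function_hom A m n Z \<Psi>" and surj: "\<forall>c\<in>C. \<exists>Y. C0_data m n Z Y \<and> \<Psi> Y = c"
    using LTH_subalgebra_hom[OF LTH] by blast
  interpret H: matrix_function_hom A m n Z \<Psi> by (rule \<Psi>)
  have dims: "\<exists>k r. covering_order_le (mtopology_of (Z i)) k \<and> r \<le> n i \<and> k < r\<^sup>2 \<and> real r \<le> 2 * \<theta> * n i" if i: "i < m" for i
  proof -
    have n0: "0 < n i" by (rule H.size_pos[OF i])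
    obtain k where k: "covering_order_le (mtopology_of (Z i)) k" "real k - 1 < N * n i"
      using covering_dim_less[OF _ n0] dim i by blast
    have "(N + 1) / \<theta>\<^sup>2 \<le> real (n i)" using dim i by (simp add: nat_le_iff ceiling_le_iff)
    then obtain r where "r \<le> n i" "k < r\<^sup>2" "real r \<le> 2 * \<theta> * n i"
      using corank_choice[OF \<theta> N _ k(2) n0] by blast
    then show ?thesis using k by blast
  qed
  obtain ca where ca: "ca \<in> C" "alg_norm A ca \<le> 1" "uniform_norm2 A (a \<ominus> ca) < \<delta>0"
    using ap unfolding tracially_approximates_def by blast
  obtain ce where ce: "ce \<in> C" "alg_norm A ce \<le> 1" "uniform_norm2 A (\<one> \<ominus> ce) < \<delta>0"
    using ap unfolding tracially_approximates_def by blast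
  obtain Xa where Xa: "C0_data m n Z Xa" "\<Psi> Xa = ca" using surj ca by blast
  obtain Xe where Xe: "C0_data m n Z Xe" "\<Psi> Xe = ce" using surj ce by blast
  obtain F where F: "C0_data m n Z F" "hermitian_data m n Z F" "alg_norm A (\<Psi> F) \<le> alg_norm A ca"
    "uniform_norm2 A (a \<ominus> \<Psi> F) \<le> uniform_norm2 A (a \<ominus> ca)"
    using H.real_part[OF Xa(1) a(1,2) T] unfolding Xa(2) by blast
  obtain E where E: "C0_data m n Z E" "hermitian_data m n Z E"
    "uniform_norm2 A (\<one> \<ominus> \<Psi> E) \<le> uniform_norm2 A (\<one> \<ominus> ce)"
    using H.real_part[OF Xe(1) unit_closed adj_one T] unfolding Xe(2) by blast
  have uE: "uniform_norm2 A (\<one> \<ominus> \<Psi> E) \<le> \<delta>0" using E ce by linarith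
  obtain b c where bc: "b \<in> carrier A" "c \<in> carrier A" "adj A b = b" "adj A c = c"
    "alg_norm A (\<Psi> F \<ominus> b) \<le> 2 * \<epsilon>" "alg_norm A c \<le> 1 / \<epsilon>"
    "uniform_norm2 A (\<one> \<ominus> b \<otimes> c) \<le> \<delta>0 * (1 + alg_norm A b * alg_norm A c) + sqrt (2 * \<theta>)"
    using H.almost_invertible_approximation[OF T F(1,2) E(1,2) \<epsilon> \<theta>(1) dims uE] by blast
  have Fc: "\<Psi> F \<in> carrier A" by (rule H.\<Psi>_closed[OF F(1)])
  have nF: "alg_norm A (\<Psi> F) \<le> 1" using F ca by linarith
  have "b = \<Psi> F \<oplus> (-1) \<odot> (\<Psi> F \<ominus> b)"
  proof -
    have "\<Psi> F \<oplus> (-1) \<odot> (\<Psi> F \<ominus> b) = (\<Psi> F \<oplus> (-1) \<odot> \<Psi> F) \<oplus> b"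
      using Fc bc(1) by (simp add: diff_scale closed scale_add_right scale_scale scale_one M.a_assoc)
    also have "\<Psi> F \<oplus> (-1) \<odot> \<Psi> F = \<zero>" using Fc by (metis neg_scale M.r_neg)
    finally show ?thesis using bc(1) by simp
  qed
  then have "alg_norm A b \<le> alg_norm A (\<Psi> F) + alg_norm A ((-1) \<odot> (\<Psi> F \<ominus> b))"
    using norm_triangle[OF Fc scale_closed[OF diff_closed[OF Fc bc(1)], of "-1"]] by simp
  then have nb: "alg_norm A b \<le> 1 + 2 * \<epsilon>"
    using nF bc(5) norm_smult[OF diff_closed[OF Fc bc(1)], of "-1"] by simp
  have "alg_norm A b * alg_norm A c \<le> (1 + 2 * \<epsilon>) * (1 / \<epsilon>)"
    using nb bc(6) alg_norm_nonneg[OF bc(2)] \<epsilon> by (intro mult_mono) auto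
  then have "\<delta>0 * (1 + alg_norm A b * alg_norm A c) \<le> \<delta>0 * K"
    using \<delta>0 by (intro mult_left_mono) (auto simp: K_def)
  then have "uniform_norm2 A (\<one> \<ominus> b \<otimes> c) \<le> \<delta>" using bc(7) s\<theta> \<delta>K by linarith
  moreover have "uniform_norm2 A (a \<ominus> \<Psi> F) \<le> \<delta>" using F ca \<delta>0\<delta> by linarith
  ultimately show ?thesis using bc Fc nF by blast
qed

end

section \<open>The tracial ultrapower\<close>

context unital_cstar_algebra
begin

lemma bounded_sequences_simps:
  "x \<oplus>\<^bsub>bounded_sequences A\<^esub> y = (\<lambda>n. x n \<oplus> y n)"
  "x \<otimes>\<^bsub>bounded_sequences A\<^esub> y = (\<lambda>n. x n \<otimes> y n)"
  "\<one>\<^bsub>bounded_sequences A\<^esub> = (\<lambda>n. \<one>)"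
  "\<zero>\<^bsub>bounded_sequences A\<^esub> = (\<lambda>n. \<zero>)"
  "c \<odot>\<^bsub>bounded_sequences A\<^esub> x = (\<lambda>n. c \<odot> x n)"
  "adj (bounded_sequences A) x = (\<lambda>n. adj A (x n))"
  "alg_norm (bounded_sequences A) x = (SUP n. alg_norm A (x n))"
  by (simp_all add: bounded_sequences_def)

lemma bounded_sequences_carrier:
  "x \<in> carrier (bounded_sequences A) \<longleftrightarrow> (\<forall>n. x n \<in> carrier A) \<and> (\<exists>M. \<forall>n. alg_norm A (x n) \<le> M)"
  by (auto simp: bounded_sequences_def bdd_above_def)

lemma bounded_sequences_closed:
  assumes x: "x \<in> carrier (bounded_sequences A)" and y: "y \<in> carrier (bounded_sequences A)"
  shows "(\<lambda>n. x n \<oplus> y n) \<in> carrier (bounded_sequences A)"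
    and "(\<lambda>n. x n \<otimes> y n) \<in> carrier (bounded_sequences A)"
    and "(\<lambda>n. c \<odot> x n) \<in> carrier (bounded_sequences A)"
    and "(\<lambda>n. adj A (x n)) \<in> carrier (bounded_sequences A)"
    and "(\<lambda>n. \<one>) \<in> carrier (bounded_sequences A)"
    and "(\<lambda>n. \<zero>) \<in> carrier (bounded_sequences A)"
proof -
  obtain M where M: "\<And>n. x n \<in> carrier A" "\<And>n. alg_norm A (x n) \<le> M"
    using x unfolding bounded_sequences_carrier by auto
  obtain N where N: "\<And>n. y n \<in> carrier A" "\<And>n. alg_norm A (y n) \<le> N"
    using y unfolding bounded_sequences_carrier by auto
  have "alg_norm A (x n \<oplus> y n) \<le> M + N" for n
    using norm_triangle[OF M(1) N(1), of n n] M(2)[of n] N(2)[of n] by simp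
  then show "(\<lambda>n. x n \<oplus> y n) \<in> carrier (bounded_sequences A)"
    unfolding bounded_sequences_carrier using M N closed by blast
  have "alg_norm A (x n \<otimes> y n) \<le> M * N" for n
  proof -
    have "alg_norm A (x n) * alg_norm A (y n) \<le> M * N"
      using M(2)[of n] N(2)[of n] alg_norm_nonneg[OF M(1)[of n]] alg_norm_nonneg[OF N(1)[of n]]
      by (intro mult_mono) auto
    then show ?thesis using norm_mult[OF M(1)[of n] N(1)[of n]] by simp
  qed
  then show "(\<lambda>n. x n \<otimes> y n) \<in> carrier (bounded_sequences A)"
    unfolding bounded_sequences_carrier using M N closed by blast
  have "alg_norm A (c \<odot> x n) \<le> cmod c * M" for n
    unfolding norm_smult[OF M(1)] using M(2)[of n] by (intro mult_left_mono) auto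
  then show "(\<lambda>n. c \<odot> x n) \<in> carrier (bounded_sequences A)"
    unfolding bounded_sequences_carrier using M closed by blast
  show "(\<lambda>n. adj A (x n)) \<in> carrier (bounded_sequences A)"
    unfolding bounded_sequences_carrier using M by (auto simp: closed alg_norm_adj)
  show "(\<lambda>n. \<one>) \<in> carrier (bounded_sequences A)" "(\<lambda>n. \<zero>) \<in> carrier (bounded_sequences A)"
    unfolding bounded_sequences_carrier using closed by auto
qed

lemma bounded_sequences_ring: "ring (bounded_sequences A)"
proof (rule ringI)
  let ?B = "bounded_sequences A"
  have carr: "x n \<in> carrier A" if "x \<in> carrier ?B" for x n using that by (simp add: bounded_sequences_carrier)
  have zero: "(\<lambda>n. \<zero>) \<in> carrier ?B" unfolding bounded_sequences_carrier by auto
  show "abelian_group ?B"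
  proof (rule abelian_groupI)
    show "\<zero>\<^bsub>?B\<^esub> \<in> carrier ?B" unfolding bounded_sequences_simps by (rule zero)
    fix x y z assume x: "x \<in> carrier ?B"
    show "\<zero>\<^bsub>?B\<^esub> \<oplus>\<^bsub>?B\<^esub> x = x" unfolding bounded_sequences_simps using carr[OF x] by simp
    show "\<exists>y\<in>carrier ?B. y \<oplus>\<^bsub>?B\<^esub> x = \<zero>\<^bsub>?B\<^esub>"
    proof (rule bexI)
      show "(\<lambda>n. (-1) \<odot> x n) \<in> carrier ?B" by (rule bounded_sequences_closed[OF x x])
      show "(\<lambda>n. (-1) \<odot> x n) \<oplus>\<^bsub>?B\<^esub> x = \<zero>\<^bsub>?B\<^esub>"
        unfolding bounded_sequences_simps using carr[OF x] by (simp add: neg_scale[symmetric] M.l_neg)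
    qed
    assume y: "y \<in> carrier ?B"
    show "x \<oplus>\<^bsub>?B\<^esub> y \<in> carrier ?B" unfolding bounded_sequences_simps by (rule bounded_sequences_closed[OF x y])
    show "x \<oplus>\<^bsub>?B\<^esub> y = y \<oplus>\<^bsub>?B\<^esub> x" unfolding bounded_sequences_simps using carr[OF x] carr[OF y] by (simp add: M.a_comm)
    assume z: "z \<in> carrier ?B"
    show "x \<oplus>\<^bsub>?B\<^esub> y \<oplus>\<^bsub>?B\<^esub> z = x \<oplus>\<^bsub>?B\<^esub> (y \<oplus>\<^bsub>?B\<^esub> z)"
      unfolding bounded_sequences_simps using carr[OF x] carr[OF y] carr[OF z] by (simp add: M.a_assoc)
  qed
  show "Group.monoid ?B"
  proof (rule monoidI)
    show "\<one>\<^bsub>?B\<^esub> \<in> carrier ?B" unfolding bounded_sequences_simps by (rule bounded_sequences_closed[OF zero zero])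
    fix x y z assume x: "x \<in> carrier ?B"
    show "\<one>\<^bsub>?B\<^esub> \<otimes>\<^bsub>?B\<^esub> x = x" "x \<otimes>\<^bsub>?B\<^esub> \<one>\<^bsub>?B\<^esub> = x"
      unfolding bounded_sequences_simps using carr[OF x] by simp_all
    assume y: "y \<in> carrier ?B"
    show "x \<otimes>\<^bsub>?B\<^esub> y \<in> carrier ?B" unfolding bounded_sequences_simps by (rule bounded_sequences_closed[OF x y])
    assume z: "z \<in> carrier ?B"
    show "x \<otimes>\<^bsub>?B\<^esub> y \<otimes>\<^bsub>?B\<^esub> z = x \<otimes>\<^bsub>?B\<^esub> (y \<otimes>\<^bsub>?B\<^esub> z)"
      unfolding bounded_sequences_simps using carr[OF x] carr[OF y] carr[OF z] by (simp add: mult_assoc)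
  qed
  fix x y z assume x: "x \<in> carrier ?B" and y: "y \<in> carrier ?B" and z: "z \<in> carrier ?B"
  show "(x \<oplus>\<^bsub>?B\<^esub> y) \<otimes>\<^bsub>?B\<^esub> z = x \<otimes>\<^bsub>?B\<^esub> z \<oplus>\<^bsub>?B\<^esub> y \<otimes>\<^bsub>?B\<^esub> z"
    "z \<otimes>\<^bsub>?B\<^esub> (x \<oplus>\<^bsub>?B\<^esub> y) = z \<otimes>\<^bsub>?B\<^esub> x \<oplus>\<^bsub>?B\<^esub> z \<otimes>\<^bsub>?B\<^esub> y"
    unfolding bounded_sequences_simps using carr[OF x] carr[OF y] carr[OF z]
    by (simp_all add: mult_add_left mult_add_right)
qed

lemma bounded_sequences_diff:
  assumes x: "x \<in> carrier (bounded_sequences A)" and y: "y \<in> carrier (bounded_sequences A)"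
  shows "x \<ominus>\<^bsub>bounded_sequences A\<^esub> y = (\<lambda>n. x n \<ominus> y n)"
proof -
  interpret B: ring "bounded_sequences A" by (rule bounded_sequences_ring)
  have yn: "y n \<in> carrier A" for n using y by (simp add: bounded_sequences_carrier)
  have "\<ominus>\<^bsub>bounded_sequences A\<^esub> y = (\<lambda>n. (-1) \<odot> y n)"
    by (rule B.minus_equality[OF _ y bounded_sequences_closed(3)[OF y y]])
      (simp add: bounded_sequences_simps neg_scale[symmetric] M.l_neg yn)
  then show ?thesis
    unfolding a_minus_def by (simp add: bounded_sequences_simps neg_scale yn)
qed

section \<open>The trace-kernel ideal and its quotient\<close>

context
  fixes U :: "nat filter"
  assumes T: "tracial_states A \<noteq> {}"
begin

lemma trace_kernel_memI:
  assumes x: "x \<in> carrier (bounded_sequences A)" and f: "(f \<longlongrightarrow> 0) U"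
    and le: "\<And>n. uniform_norm2 A (x n) \<le> f n"
  shows "x \<in> trace_kernel_ideal U A"
  unfolding trace_kernel_ideal_def
proof (intro CollectI conjI x)
  have "norm (uniform_norm2 A (x n)) \<le> f n" for n
    using le[of n] uniform_norm2_nonneg[OF T, of "x n"] x by (simp add: bounded_sequences_carrier)
  then show "((\<lambda>n. uniform_norm2 A (x n)) \<longlongrightarrow> 0) U"
    by (intro Lim_null_comparison[OF _ f]) auto
qed

lemma trace_kernel_carrier: "x \<in> trace_kernel_ideal U A \<Longrightarrow> x \<in> carrier (bounded_sequences A)"
  and trace_kernel_limit: "x \<in> trace_kernel_ideal U A \<Longrightarrow> ((\<lambda>n. uniform_norm2 A (x n)) \<longlongrightarrow> 0) U"
  by (auto simp: trace_kernel_ideal_def)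

lemma trace_kernel_add:
  assumes x: "x \<in> trace_kernel_ideal U A" and y: "y \<in> trace_kernel_ideal U A"
  shows "(\<lambda>n. x n \<oplus> y n) \<in> trace_kernel_ideal U A"
proof (rule trace_kernel_memI)
  note c = trace_kernel_carrier[OF x] trace_kernel_carrier[OF y]
  show "(\<lambda>n. x n \<oplus> y n) \<in> carrier (bounded_sequences A)" by (rule bounded_sequences_closed(1)[OF c])
  show "((\<lambda>n. uniform_norm2 A (x n) + uniform_norm2 A (y n)) \<longlongrightarrow> 0) U"
    using tendsto_add[OF trace_kernel_limit[OF x] trace_kernel_limit[OF y]] by simp
  show "uniform_norm2 A (x n \<oplus> y n) \<le> uniform_norm2 A (x n) + uniform_norm2 A (y n)" for n
    using c by (intro uniform_norm2_triangle[OF T]) (auto simp: bounded_sequences_carrier)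
qed

lemma trace_kernel_scale:
  assumes x: "x \<in> trace_kernel_ideal U A"
  shows "(\<lambda>n. c \<odot> x n) \<in> trace_kernel_ideal U A"
proof (rule trace_kernel_memI)
  note xc = trace_kernel_carrier[OF x]
  show "(\<lambda>n. c \<odot> x n) \<in> carrier (bounded_sequences A)" by (rule bounded_sequences_closed(3)[OF xc xc])
  show "((\<lambda>n. cmod c * uniform_norm2 A (x n)) \<longlongrightarrow> 0) U"
    using tendsto_mult_left[OF trace_kernel_limit[OF x], of "cmod c"] by simp
  show "uniform_norm2 A (c \<odot> x n) \<le> cmod c * uniform_norm2 A (x n)" for n
    using xc by (intro uniform_norm2_scale[OF T]) (auto simp: bounded_sequences_carrier)
qed

lemma trace_kernel_adj:
  assumes x: "x \<in> trace_kernel_ideal U A"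
  shows "(\<lambda>n. adj A (x n)) \<in> trace_kernel_ideal U A"
proof (rule trace_kernel_memI[OF _ trace_kernel_limit[OF x]])
  note xc = trace_kernel_carrier[OF x]
  show "(\<lambda>n. adj A (x n)) \<in> carrier (bounded_sequences A)" by (rule bounded_sequences_closed(4)[OF xc xc])
  show "uniform_norm2 A (adj A (x n)) \<le> uniform_norm2 A (x n)" for n
    using xc by (simp add: uniform_norm2_adj[OF T] bounded_sequences_carrier)
qed

lemma trace_kernel_mult:
  assumes x: "x \<in> trace_kernel_ideal U A" and y: "y \<in> carrier (bounded_sequences A)"
  shows "(\<lambda>n. y n \<otimes> x n) \<in> trace_kernel_ideal U A" "(\<lambda>n. x n \<otimes> y n) \<in> trace_kernel_ideal U A"
proof -
  note xc = trace_kernel_carrier[OF x]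
  have xn: "x n \<in> carrier A" for n using xc by (simp add: bounded_sequences_carrier)
  obtain M where M: "\<And>n. y n \<in> carrier A" "\<And>n. alg_norm A (y n) \<le> M"
    using y unfolding bounded_sequences_carrier by auto
  have lim: "((\<lambda>n. M * uniform_norm2 A (x n)) \<longlongrightarrow> 0) U"
    using tendsto_mult_left[OF trace_kernel_limit[OF x], of M] by simp
  have le: "alg_norm A (y n) * uniform_norm2 A (x n) \<le> M * uniform_norm2 A (x n)" for n
    by (intro mult_right_mono M(2) uniform_norm2_nonneg[OF T] xn)
  show "(\<lambda>n. y n \<otimes> x n) \<in> trace_kernel_ideal U A"
  proof (rule trace_kernel_memI[OF _ lim])
    show "(\<lambda>n. y n \<otimes> x n) \<in> carrier (bounded_sequences A)" by (rule bounded_sequences_closed(2)[OF y xc])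
    show "uniform_norm2 A (y n \<otimes> x n) \<le> M * uniform_norm2 A (x n)" for n
      using uniform_norm2_mult_left[OF T M(1) xn, of n n] le[of n] by linarith
  qed
  show "(\<lambda>n. x n \<otimes> y n) \<in> trace_kernel_ideal U A"
  proof (rule trace_kernel_memI[OF _ lim])
    show "(\<lambda>n. x n \<otimes> y n) \<in> carrier (bounded_sequences A)" by (rule bounded_sequences_closed(2)[OF xc y])
    show "uniform_norm2 A (x n \<otimes> y n) \<le> M * uniform_norm2 A (x n)" for n
      using uniform_norm2_mult_right[OF T xn M(1), of n n] le[of n] by (simp add: mult.commute)
  qed
qed

lemma trace_kernel_zero: "(\<lambda>n. \<zero>) \<in> trace_kernel_ideal U A"
proof (rule trace_kernel_memI)
  show "(\<lambda>n. \<zero>) \<in> carrier (bounded_sequences A)" unfolding bounded_sequences_carrier by auto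
  show "((\<lambda>n. 0 :: real) \<longlongrightarrow> 0) U" by simp
  show "uniform_norm2 A \<zero> \<le> 0" for n :: nat
    using uniform_norm2_scale[OF T M.zero_closed, of 0] by (simp add: scale_zero)
qed

lemma trace_kernel_is_ideal: "ideal (trace_kernel_ideal U A) (bounded_sequences A)"
proof (rule idealI[OF bounded_sequences_ring])
  let ?B = "bounded_sequences A" and ?J = "trace_kernel_ideal U A"
  interpret B: ring ?B by (rule bounded_sequences_ring)
  show "subgroup ?J (add_monoid ?B)"
  proof
    show "?J \<subseteq> carrier (add_monoid ?B)" using trace_kernel_carrier by auto
    show "\<one>\<^bsub>add_monoid ?B\<^esub> \<in> ?J" using trace_kernel_zero by (simp add: bounded_sequences_simps)
    fix x y assume x: "x \<in> ?J"
    have xn: "x n \<in> carrier A" for n using trace_kernel_carrier[OF x] by (simp add: bounded_sequences_carrier)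
    have "\<ominus>\<^bsub>?B\<^esub> x = (\<lambda>n. (-1) \<odot> x n)"
      by (rule B.minus_equality[OF _ trace_kernel_carrier[OF x] trace_kernel_carrier[OF trace_kernel_scale[OF x]]])
        (simp add: bounded_sequences_simps neg_scale[symmetric] M.l_neg xn)
    then show "inv\<^bsub>add_monoid ?B\<^esub> x \<in> ?J" using trace_kernel_scale[OF x] by (simp add: a_inv_def)
    assume y: "y \<in> ?J"
    show "x \<otimes>\<^bsub>add_monoid ?B\<^esub> y \<in> ?J" using trace_kernel_add[OF x y] by (simp add: bounded_sequences_simps)
  qed
  fix x y assume "x \<in> ?J" "y \<in> carrier ?B"
  then show "y \<otimes>\<^bsub>?B\<^esub> x \<in> ?J" "x \<otimes>\<^bsub>?B\<^esub> y \<in> ?J"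
    unfolding bounded_sequences_simps by (rule trace_kernel_mult)+
qed

definition ultrapower_class :: "(nat \<Rightarrow> 'a) \<Rightarrow> (nat \<Rightarrow> 'a) set" where
  "ultrapower_class x = trace_kernel_ideal U A +>\<^bsub>bounded_sequences A\<^esub> x"

lemma ultrapower_class_eq:
  assumes "x \<in> carrier (bounded_sequences A)" "y \<in> carrier (bounded_sequences A)"
    and "(\<lambda>n. x n \<ominus> y n) \<in> trace_kernel_ideal U A"
  shows "ultrapower_class x = ultrapower_class y"
proof -
  interpret I: ideal "trace_kernel_ideal U A" "bounded_sequences A" by (rule trace_kernel_is_ideal)
  have "x \<ominus>\<^bsub>bounded_sequences A\<^esub> y \<in> trace_kernel_ideal U A" using assms by (simp add: bounded_sequences_diff)
  then show ?thesis unfolding ultrapower_class_def using I.quotient_eq_iff_same_a_r_cos[OF trace_kernel_is_ideal] assms by blast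
qed

lemma ultrapower_class_eq_imp:
  assumes "x \<in> carrier (bounded_sequences A)" "y \<in> carrier (bounded_sequences A)" "ultrapower_class x = ultrapower_class y"
  shows "(\<lambda>n. x n \<ominus> y n) \<in> trace_kernel_ideal U A"
proof -
  interpret I: ideal "trace_kernel_ideal U A" "bounded_sequences A" by (rule trace_kernel_is_ideal)
  have "x \<ominus>\<^bsub>bounded_sequences A\<^esub> y \<in> trace_kernel_ideal U A"
    using assms unfolding ultrapower_class_def using I.quotient_eq_iff_same_a_r_cos[OF trace_kernel_is_ideal] by blast
  then show ?thesis using assms by (simp add: bounded_sequences_diff)
qed

lemma ultrapower_class_mem: "y \<in> ultrapower_class x \<longleftrightarrow> (\<exists>h\<in>trace_kernel_ideal U A. y = (\<lambda>n. h n \<oplus> x n))"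
  unfolding ultrapower_class_def a_r_coset_def' by (auto simp: bounded_sequences_simps)

lemma ultrapower_carrier: "carrier (tracial_ultrapower U A) = ultrapower_class ` carrier (bounded_sequences A)"
  unfolding tracial_ultrapower_def quotient_algebra_def FactRing_def A_RCOSETS_def' ultrapower_class_def by auto

lemma ultrapower_mult:
  assumes "x \<in> carrier (bounded_sequences A)" "y \<in> carrier (bounded_sequences A)"
  shows "ultrapower_class x \<otimes>\<^bsub>tracial_ultrapower U A\<^esub> ultrapower_class y = ultrapower_class (\<lambda>n. x n \<otimes> y n)"
  using ideal.rcoset_mult_add[OF trace_kernel_is_ideal assms]
  by (simp add: tracial_ultrapower_def quotient_algebra_def FactRing_def ultrapower_class_def bounded_sequences_simps)

lemma ultrapower_one: "\<one>\<^bsub>tracial_ultrapower U A\<^esub> = ultrapower_class (\<lambda>n. \<one>)"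
  by (simp add: tracial_ultrapower_def quotient_algebra_def FactRing_def ultrapower_class_def bounded_sequences_simps)

text \<open>The adjoint in the quotient is a union over all representatives; each of them gives the
  same coset, because the ideal is closed under adjoints.\<close>

lemma ultrapower_adj:
  assumes x: "x \<in> carrier (bounded_sequences A)"
  shows "adj (tracial_ultrapower U A) (ultrapower_class x) = ultrapower_class (\<lambda>n. adj A (x n))"
proof -
  interpret I: ideal "trace_kernel_ideal U A" "bounded_sequences A" by (rule trace_kernel_is_ideal)
  have xa: "(\<lambda>n. adj A (x n)) \<in> carrier (bounded_sequences A)" by (rule bounded_sequences_closed(4)[OF x x])
  have xn: "x n \<in> carrier A" for n using x by (simp add: bounded_sequences_carrier)
  have 1: "ultrapower_class (\<lambda>n. adj A (y n)) = ultrapower_class (\<lambda>n. adj A (x n))" if y: "y \<in> ultrapower_class x" for y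
  proof -
    obtain h where h: "h \<in> trace_kernel_ideal U A" "y = (\<lambda>n. h n \<oplus> x n)" using y ultrapower_class_mem by blast
    note hc = trace_kernel_carrier[OF h(1)]
    have hn: "h n \<in> carrier A" for n using hc by (simp add: bounded_sequences_carrier)
    have yc: "y \<in> carrier (bounded_sequences A)" unfolding h(2) by (rule bounded_sequences_closed(1)[OF hc x])
    have "adj A (y n) \<ominus> adj A (x n) = adj A (h n)" for n
      unfolding h(2) using hn[of n] xn[of n]
      by (simp add: adj_add a_minus_def M.a_assoc M.r_neg closed)
    then show ?thesis
      using trace_kernel_adj[OF h(1)] by (intro ultrapower_class_eq bounded_sequences_closed(4)[OF yc yc] xa) simp
  qed
  have "(\<lambda>n. x n) \<in> ultrapower_class x"
    unfolding ultrapower_class_mem using xn by (intro bexI[OF _ trace_kernel_zero]) simp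
  then have ne: "ultrapower_class x \<noteq> {}" by blast
  have "(\<Union>y\<in>ultrapower_class x. ultrapower_class (\<lambda>n. adj A (y n))) = ultrapower_class (\<lambda>n. adj A (x n))" by (rule SUP_eq_const[OF ne 1])
  then show ?thesis
    by (simp add: tracial_ultrapower_def quotient_algebra_def ultrapower_class_def[symmetric] bounded_sequences_simps)
qed

lemma ultrapower_diff:
  assumes x: "x \<in> carrier (bounded_sequences A)" and y: "y \<in> carrier (bounded_sequences A)"
  shows "ultrapower_class x \<ominus>\<^bsub>tracial_ultrapower U A\<^esub> ultrapower_class y = ultrapower_class (\<lambda>n. x n \<ominus> y n)"
proof -
  let ?B = "bounded_sequences A" and ?J = "trace_kernel_ideal U A"
  interpret I: ideal ?J ?B by (rule trace_kernel_is_ideal)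
  interpret h: ring_hom_ring ?B "?B Quot ?J" "(+>\<^bsub>?B\<^esub>) ?J" by (rule I.rcos_ring_hom_ring)
  \<comment> \<open>Subtraction involves only the carrier, zero and addition, which the two records
    share, so the ring homomorphism onto the factor ring applies.\<close>
  have eq: "X \<ominus>\<^bsub>tracial_ultrapower U A\<^esub> Y = X \<ominus>\<^bsub>?B Quot ?J\<^esub> Y" for X Y
    unfolding tracial_ultrapower_def quotient_algebra_def a_minus_def a_inv_def m_inv_def by simp
  show ?thesis
    unfolding eq bounded_sequences_diff[OF x y, symmetric] unfolding a_minus_def ultrapower_class_def
    using x y by (simp add: h.hom_add h.hom_a_inv)
qed

text \<open>The representative \<open>x\<close> competes in the infimum defining the quotient norm.
  Nonnegativity of the norm is needed because a real infimum is a lower bound only for sets bounded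
  below.\<close>

lemma ultrapower_norm_le:
  assumes x: "x \<in> carrier (bounded_sequences A)" and le: "\<And>n. alg_norm A (x n) \<le> c"
  shows "alg_norm (tracial_ultrapower U A) (ultrapower_class x) \<le> c"
proof -
  let ?N = "alg_norm (bounded_sequences A)"
  have xn: "x n \<in> carrier A" for n using x by (simp add: bounded_sequences_carrier)
  have N0: "0 \<le> ?N y" if y: "y \<in> carrier (bounded_sequences A)" for y
  proof -
    obtain M where M: "\<And>n. y n \<in> carrier A" "\<And>n. alg_norm A (y n) \<le> M"
      using y unfolding bounded_sequences_carrier by auto
    have "alg_norm A (y 0) \<le> ?N y"
      unfolding bounded_sequences_simps using M(2) by (intro cSUP_upper bdd_aboveI[of _ M]) auto
    then show ?thesis using alg_norm_nonneg[OF M(1)[of 0]] by linarith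
  qed
  have cc: "y \<in> carrier (bounded_sequences A)" if "y \<in> ultrapower_class x" for y
    using that bounded_sequences_closed(1)[OF trace_kernel_carrier x] by (auto simp: ultrapower_class_mem)
  have "x \<in> ultrapower_class x" unfolding ultrapower_class_mem using xn by (intro bexI[OF _ trace_kernel_zero]) simp
  then have "(INF y\<in>ultrapower_class x. ?N y) \<le> ?N x"
    using N0 cc by (intro cINF_lower bdd_belowI[of _ 0]) auto
  also have "?N x \<le> c" unfolding bounded_sequences_simps using le by (intro cSUP_least) auto
  finally show ?thesis by (simp add: tracial_ultrapower_def quotient_algebra_def)
qed

text \<open>A representative \<open>y\<close> differs from its Hermitian part by half of
  \<open>y n \<ominus> adj A (y n)\<close>, which lies in the ideal when the class is self-adjoint.
  The bound is enlarged to at least 1 so that it can be divided by.\<close>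

lemma ultrapower_self_adjoint_lift:
  assumes X: "X \<in> self_adjoints (tracial_ultrapower U A)"
  obtains x M where "X = ultrapower_class x" "0 < M" "\<And>n. x n \<in> carrier A" "\<And>n. adj A (x n) = x n"
    "\<And>n. alg_norm A (x n) \<le> M" "x \<in> carrier (bounded_sequences A)"
proof -
  obtain y where y: "y \<in> carrier (bounded_sequences A)" "X = ultrapower_class y"
    using X unfolding self_adjoints_def ultrapower_carrier by auto
  have yn: "y n \<in> carrier A" for n using y by (simp add: bounded_sequences_carrier)
  note ya = bounded_sequences_closed(4)[OF y(1) y(1)]
  have "ultrapower_class y = ultrapower_class (\<lambda>n. adj A (y n))"
    using X ultrapower_adj[OF y(1)] unfolding self_adjoints_def y(2) by simp
  from ultrapower_class_eq_imp[OF y(1) ya this] have d: "(\<lambda>n. y n \<ominus> adj A (y n)) \<in> trace_kernel_ideal U A" .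
  define x where "x = (\<lambda>n. (1 / 2) \<odot> (y n \<oplus> adj A (y n)))"
  have xB: "x \<in> carrier (bounded_sequences A)"
    unfolding x_def
    using bounded_sequences_closed(3)[OF bounded_sequences_closed(1)[OF y(1) ya] y(1)] .
  have xsa: "adj A (x n) = x n" for n
    using yn[of n] by (simp add: x_def adj_smult adj_add closed adj_adj M.a_comm)
  have "y n \<ominus> x n = (1 / 2) \<odot> (y n \<ominus> adj A (y n))" for n
  proof -
    have y2: "y n = (1 / 2) \<odot> y n \<oplus> (1 / 2) \<odot> y n"
      using scale_add[OF yn[of n], of "1 / 2" "1 / 2"] by (simp add: scale_one yn)
    have m: "(- (1 / 2)) \<odot> y n \<oplus> (1 / 2) \<odot> y n = \<zero>"
      using scale_add[OF yn[of n], of "- (1 / 2)" "1 / 2"] by (simp add: scale_zero yn)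
    have "y n \<ominus> x n = y n \<oplus> ((- (1 / 2)) \<odot> y n \<oplus> (- (1 / 2)) \<odot> adj A (y n))"
      using yn[of n] by (simp add: x_def diff_scale closed scale_add_right scale_scale)
    also have "\<dots> = ((1 / 2) \<odot> y n \<oplus> (1 / 2) \<odot> y n) \<oplus> ((- (1 / 2)) \<odot> y n \<oplus> (- (1 / 2)) \<odot> adj A (y n))"
      using y2 by simp
    also have "\<dots> = ((- (1 / 2)) \<odot> y n \<oplus> (1 / 2) \<odot> y n) \<oplus> ((1 / 2) \<odot> y n \<oplus> (- (1 / 2)) \<odot> adj A (y n))"
      using yn[of n] by (simp add: closed M.a_ac)
    also have "\<dots> = (1 / 2) \<odot> (y n \<ominus> adj A (y n))"
      unfolding m using yn[of n] by (simp add: diff_scale closed scale_add_right scale_scale)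
    finally show ?thesis .
  qed
  then have "ultrapower_class y = ultrapower_class x"
    using trace_kernel_scale[OF d, of "1 / 2"] by (intro ultrapower_class_eq y(1) xB) simp
  moreover obtain M where M: "\<And>n. x n \<in> carrier A" "\<And>n. alg_norm A (x n) \<le> M"
    using xB unfolding bounded_sequences_carrier by auto
  ultimately show thesis
    using that[of x "max M 1"] xsa xB y(2) M by (auto simp: le_max_iff_disj)
qed

end

end

text \<open>A filter that avoids every single index is finer than the cofinite filter, so ordinary
  convergence implies convergence along \<open>U\<close>.\<close>

lemma nonprincipal_null_sequence:
  assumes "nonprincipal_ultrafilter U"
  shows "((\<lambda>n. c / real (Suc n)) \<longlongrightarrow> 0) U"
proof -
  have ne: "eventually (\<lambda>n. n \<noteq> m) U" for m using assms unfolding nonprincipal_ultrafilter_def by blast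
  have "eventually (\<lambda>n. N \<le> n) U" for N
  proof (induction N)
    case (Suc N)
    show ?case using eventually_conj[OF Suc ne[of N]] by (rule eventually_mono) auto
  qed simp
  then have "U \<le> sequentially"
    by (auto simp: le_sequentially)
  moreover have "(\<lambda>n. c / real (Suc n)) \<longlonglongrightarrow> 0"
    by (rule LIMSEQ_Suc[OF lim_const_over_n])
  ultimately show ?thesis by (rule tendsto_mono)
qed

theorem theorem3p5:
  fixes A :: "'a cstar_struct" and U :: "nat filter"
  assumes "nonprincipal_ultrafilter U"
    and "unital_cstar_algebra A"
    and "separable_algebra A"
    and "simple_algebra A"
    and "\<not> elementary_algebra A"
    and "tracially_LTH TYPE('z) A"
    and "locally_flat_dimension_growth TYPE('z) A"
  shows "real_rank_zero (tracial_ultrapower U A)"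
  unfolding real_rank_zero_def
proof (intro ballI allI impI)
  interpret unital_cstar_algebra A by fact
  have T: "tracial_states A \<noteq> {}" using assms(6) unfolding tracially_LTH_def by simp
  let ?Q = "tracial_ultrapower U A" and ?B = "bounded_sequences A" and ?J = "trace_kernel_ideal U A"
  fix X and \<epsilon> :: real assume X: "X \<in> self_adjoints ?Q" and \<epsilon>: "0 < \<epsilon>"
  obtain x M where x: "X = ultrapower_class U x" "0 < M" "\<And>n. x n \<in> carrier A" "\<And>n. adj A (x n) = x n"
    "\<And>n. alg_norm A (x n) \<le> M" "x \<in> carrier ?B"
    by (rule ultrapower_self_adjoint_lift[OF T X]) blast
  let ?M = "complex_of_real M" and ?iM = "complex_of_real (1 / M)"
  \<comment> \<open>After scaling by \<open>1 / M\<close> the approximation error is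
    \<open>2 * e\<close>; scaling back gives \<open>2 * e * M = \<epsilon> / 2\<close>.\<close>
  define e where "e = \<epsilon> / (4 * M)"
  have e: "0 < e" using \<epsilon> x(2) by (simp add: e_def)
  have MM: "?M * ?iM = 1" "?iM * ?M = 1" using x(2) by auto
  have ex: "\<exists>a' b c. a' \<in> carrier A \<and> b \<in> carrier A \<and> c \<in> carrier A \<and> adj A b = b \<and> adj A c = c \<and>
     alg_norm A a' \<le> 1 \<and> uniform_norm2 A (?iM \<odot>\<^bsub>A\<^esub> x n \<ominus>\<^bsub>A\<^esub> a') \<le> 1 / real (Suc n) \<and>
     alg_norm A (a' \<ominus>\<^bsub>A\<^esub> b) \<le> 2 * e \<and> alg_norm A c \<le> 1 / e \<and>
     uniform_norm2 A (\<one>\<^bsub>A\<^esub> \<ominus>\<^bsub>A\<^esub> b \<otimes>\<^bsub>A\<^esub> c) \<le> 1 / real (Suc n)" for n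
  proof (rule flat_growth_approximation[OF T assms(7) _ _ _ e])
    show "?iM \<odot>\<^bsub>A\<^esub> x n \<in> carrier A" by (intro closed x)
    show "adj A (?iM \<odot>\<^bsub>A\<^esub> x n) = ?iM \<odot>\<^bsub>A\<^esub> x n" using x by (simp add: adj_smult)
    show "alg_norm A (?iM \<odot>\<^bsub>A\<^esub> x n) \<le> 1"
      using x(2) x(5)[of n] norm_smult[OF x(3)[of n], of ?iM] by (simp add: norm_divide)
  qed simp
  have "\<exists>a b c. \<forall>n. a n \<in> carrier A \<and> b n \<in> carrier A \<and> c n \<in> carrier A \<and> adj A (b n) = b n \<and> adj A (c n) = c n \<and>
     alg_norm A (a n) \<le> 1 \<and> uniform_norm2 A (?iM \<odot>\<^bsub>A\<^esub> x n \<ominus>\<^bsub>A\<^esub> a n) \<le> 1 / real (Suc n) \<and>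
     alg_norm A (a n \<ominus>\<^bsub>A\<^esub> b n) \<le> 2 * e \<and> alg_norm A (c n) \<le> 1 / e \<and>
     uniform_norm2 A (\<one>\<^bsub>A\<^esub> \<ominus>\<^bsub>A\<^esub> b n \<otimes>\<^bsub>A\<^esub> c n) \<le> 1 / real (Suc n)"
    using allI[OF ex] unfolding choice_iff .
  then obtain a b c where a: "\<And>n. a n \<in> carrier A" and b: "\<And>n. b n \<in> carrier A" and c: "\<And>n. c n \<in> carrier A"
    and sa: "\<And>n. adj A (b n) = b n" "\<And>n. adj A (c n) = c n" and na: "\<And>n. alg_norm A (a n) \<le> 1"
    and ua: "\<And>n. uniform_norm2 A (?iM \<odot>\<^bsub>A\<^esub> x n \<ominus>\<^bsub>A\<^esub> a n) \<le> 1 / real (Suc n)"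
    and ab: "\<And>n. alg_norm A (a n \<ominus>\<^bsub>A\<^esub> b n) \<le> 2 * e" and nc: "\<And>n. alg_norm A (c n) \<le> 1 / e"
    and bc: "\<And>n. uniform_norm2 A (\<one>\<^bsub>A\<^esub> \<ominus>\<^bsub>A\<^esub> b n \<otimes>\<^bsub>A\<^esub> c n) \<le> 1 / real (Suc n)"
    by blast
  define a' where "a' = (\<lambda>n. ?M \<odot>\<^bsub>A\<^esub> a n)"
  define y where "y = (\<lambda>n. ?M \<odot>\<^bsub>A\<^esub> b n)"
  define w where "w = (\<lambda>n. ?iM \<odot>\<^bsub>A\<^esub> c n)"
  have aB: "a \<in> carrier ?B" unfolding bounded_sequences_carrier using a na by blast
  have cB: "c \<in> carrier ?B" unfolding bounded_sequences_carrier using c nc by blast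
  have dB: "(\<lambda>n. a n \<ominus>\<^bsub>A\<^esub> b n) \<in> carrier ?B"
    unfolding bounded_sequences_carrier using ab a b diff_closed by blast
  have bB: "b \<in> carrier ?B"
  proof -
    have "b n = a n \<oplus>\<^bsub>A\<^esub> (-1) \<odot>\<^bsub>A\<^esub> (a n \<ominus>\<^bsub>A\<^esub> b n)" for n
    proof -
      have "a n \<oplus>\<^bsub>A\<^esub> (-1) \<odot>\<^bsub>A\<^esub> (a n \<ominus>\<^bsub>A\<^esub> b n) = (a n \<oplus>\<^bsub>A\<^esub> (-1) \<odot>\<^bsub>A\<^esub> a n) \<oplus>\<^bsub>A\<^esub> b n"
        using a[of n] b[of n] by (simp add: diff_scale closed scale_add_right scale_scale scale_one M.a_assoc)
      also have "a n \<oplus>\<^bsub>A\<^esub> (-1) \<odot>\<^bsub>A\<^esub> a n = \<zero>\<^bsub>A\<^esub>" using a[of n] by (metis neg_scale M.r_neg)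
      finally show ?thesis using b[of n] by simp
    qed
    then have "b = (\<lambda>n. a n \<oplus>\<^bsub>A\<^esub> (-1) \<odot>\<^bsub>A\<^esub> (a n \<ominus>\<^bsub>A\<^esub> b n))" by blast
    then show ?thesis
      using bounded_sequences_closed(1)[OF aB bounded_sequences_closed(3)[OF dB dB, of "-1"]] by simp
  qed
  have a'B: "a' \<in> carrier ?B" unfolding a'_def by (rule bounded_sequences_closed(3)[OF aB aB])
  have yB: "y \<in> carrier ?B" unfolding y_def by (rule bounded_sequences_closed(3)[OF bB bB])
  have wB: "w \<in> carrier ?B" unfolding w_def by (rule bounded_sequences_closed(3)[OF cB cB])
  have oneB: "(\<lambda>n. \<one>\<^bsub>A\<^esub>) \<in> carrier ?B" by (rule bounded_sequences_closed(5)[OF aB aB])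
  have lim: "((\<lambda>n. k / real (Suc n)) \<longlongrightarrow> 0) U" for k by (rule nonprincipal_null_sequence[OF assms(1)])
  have diffB: "(\<lambda>n. p n \<ominus>\<^bsub>A\<^esub> q n) \<in> carrier ?B" if p: "p \<in> carrier ?B" and q: "q \<in> carrier ?B" for p q
  proof -
    interpret B: ring ?B by (rule bounded_sequences_ring)
    show ?thesis using B.minus_closed[OF p q] by (simp add: bounded_sequences_diff[OF p q])
  qed
  \<comment> \<open>The tracial approximants \<open>a'\<close> represent the same class as
    \<open>x\<close>. Only after this exchange is a distance in the operator norm of
    \<open>A\<close> available, namely that between \<open>a'\<close> and \<open>y\<close>.\<close>
  have "X = ultrapower_class U a'"
    unfolding x(1)
  proof (rule ultrapower_class_eq[OF T x(6) a'B], rule trace_kernel_memI[OF T diffB[OF x(6) a'B] lim[of M]])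
    fix n
    let ?d = "?iM \<odot>\<^bsub>A\<^esub> x n \<ominus>\<^bsub>A\<^esub> a n"
    have d: "?d \<in> carrier A" by (intro diff_closed closed x a)
    have "x n \<ominus>\<^bsub>A\<^esub> a' n = ?M \<odot>\<^bsub>A\<^esub> ?d"
    proof -
      have "?M \<odot>\<^bsub>A\<^esub> ?d = (?M * ?iM) \<odot>\<^bsub>A\<^esub> x n \<oplus>\<^bsub>A\<^esub> (-1) \<odot>\<^bsub>A\<^esub> (?M \<odot>\<^bsub>A\<^esub> a n)"
        using x(3)[of n] a[of n] by (simp add: diff_scale closed scale_add_right scale_scale)
      then show ?thesis unfolding MM a'_def using x(3)[of n] a[of n] by (simp add: diff_scale closed scale_one)
    qed
    then have "uniform_norm2 A (x n \<ominus>\<^bsub>A\<^esub> a' n) \<le> M * uniform_norm2 A ?d"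
      using uniform_norm2_scale[OF T d, of ?M] x(2) by simp
    also have "\<dots> \<le> M * (1 / real (Suc n))" using ua[of n] x(2) by (intro mult_left_mono) auto
    finally show "uniform_norm2 A (x n \<ominus>\<^bsub>A\<^esub> a' n) \<le> M / real (Suc n)" by simp
  qed
  then have Xy: "X \<ominus>\<^bsub>?Q\<^esub> ultrapower_class U y = ultrapower_class U (\<lambda>n. a' n \<ominus>\<^bsub>A\<^esub> y n)"
    using ultrapower_diff[OF T a'B yB] by simp
  have "alg_norm ?Q (X \<ominus>\<^bsub>?Q\<^esub> ultrapower_class U y) \<le> \<epsilon> / 2"
    unfolding Xy
  proof (rule ultrapower_norm_le[OF T diffB[OF a'B yB]])
    fix n
    have "a' n \<ominus>\<^bsub>A\<^esub> y n = ?M \<odot>\<^bsub>A\<^esub> (a n \<ominus>\<^bsub>A\<^esub> b n)"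
      unfolding a'_def y_def using a[of n] b[of n] by (simp add: diff_scale closed scale_add_right scale_scale)
    then have "alg_norm A (a' n \<ominus>\<^bsub>A\<^esub> y n) = M * alg_norm A (a n \<ominus>\<^bsub>A\<^esub> b n)"
      using norm_smult[OF diff_closed[OF a[of n] b[of n]], of ?M] x(2) by simp
    also have "\<dots> \<le> M * (2 * e)" using ab[of n] x(2) by (intro mult_left_mono) auto
    also have "\<dots> = \<epsilon> / 2" using x(2) by (simp add: e_def)
    finally show "alg_norm A (a' n \<ominus>\<^bsub>A\<^esub> y n) \<le> \<epsilon> / 2" .
  qed
  then have close: "alg_norm ?Q (X \<ominus>\<^bsub>?Q\<^esub> ultrapower_class U y) < \<epsilon>" using \<epsilon> by simp
  have yw: "y n \<otimes>\<^bsub>A\<^esub> w n = b n \<otimes>\<^bsub>A\<^esub> c n" and wy: "w n \<otimes>\<^bsub>A\<^esub> y n = c n \<otimes>\<^bsub>A\<^esub> b n" for n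
  proof -
    have "y n \<otimes>\<^bsub>A\<^esub> w n = (?M * ?iM) \<odot>\<^bsub>A\<^esub> (b n \<otimes>\<^bsub>A\<^esub> c n)" "w n \<otimes>\<^bsub>A\<^esub> y n = (?iM * ?M) \<odot>\<^bsub>A\<^esub> (c n \<otimes>\<^bsub>A\<^esub> b n)"
      unfolding y_def w_def using b[of n] c[of n]
      by (simp_all only: smult_mult_left smult_mult_right scale_scale closed mult.commute)
    then show "y n \<otimes>\<^bsub>A\<^esub> w n = b n \<otimes>\<^bsub>A\<^esub> c n" "w n \<otimes>\<^bsub>A\<^esub> y n = c n \<otimes>\<^bsub>A\<^esub> b n"
      unfolding MM using b[of n] c[of n] by (simp_all add: scale_one closed)
  qed
  have yw1: "ultrapower_class U y \<otimes>\<^bsub>?Q\<^esub> ultrapower_class U w = \<one>\<^bsub>?Q\<^esub>"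
    unfolding ultrapower_mult[OF T yB wB] ultrapower_one[OF T] yw
    by (rule ultrapower_class_eq[OF T oneB bounded_sequences_closed(2)[OF bB cB], symmetric],
        rule trace_kernel_memI[OF T diffB[OF oneB bounded_sequences_closed(2)[OF bB cB]] lim[of 1] bc])
  \<comment> \<open>Taking adjoints exchanges the self-adjoint factors, so the approximate right
    inverse is also an approximate left inverse.\<close>
  have "uniform_norm2 A (\<one>\<^bsub>A\<^esub> \<ominus>\<^bsub>A\<^esub> c n \<otimes>\<^bsub>A\<^esub> b n) \<le> 1 / real (Suc n)" for n
  proof -
    have "adj A (\<one>\<^bsub>A\<^esub> \<ominus>\<^bsub>A\<^esub> b n \<otimes>\<^bsub>A\<^esub> c n) = \<one>\<^bsub>A\<^esub> \<ominus>\<^bsub>A\<^esub> c n \<otimes>\<^bsub>A\<^esub> b n"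
      using b[of n] c[of n] by (simp add: diff_scale closed adj_add adj_smult adj_mult adj_one sa)
    then show ?thesis
      using bc[of n] uniform_norm2_adj[OF T, of "\<one>\<^bsub>A\<^esub> \<ominus>\<^bsub>A\<^esub> b n \<otimes>\<^bsub>A\<^esub> c n"] b[of n] c[of n] by (simp add: diff_closed closed)
  qed
  then have wy1: "ultrapower_class U w \<otimes>\<^bsub>?Q\<^esub> ultrapower_class U y = \<one>\<^bsub>?Q\<^esub>"
    unfolding ultrapower_mult[OF T wB yB] ultrapower_one[OF T] wy
    by (intro ultrapower_class_eq[OF T oneB bounded_sequences_closed(2)[OF cB bB], symmetric]
        trace_kernel_memI[OF T diffB[OF oneB bounded_sequences_closed(2)[OF cB bB]] lim[of 1]])
  have yQ: "ultrapower_class U y \<in> carrier ?Q" and wQ: "ultrapower_class U w \<in> carrier ?Q"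
    unfolding ultrapower_carrier[OF T] using yB wB by auto
  have "adj ?Q (ultrapower_class U y) = ultrapower_class U y"
    unfolding ultrapower_adj[OF T yB] using b sa by (simp add: y_def adj_smult)
  then have "ultrapower_class U y \<in> self_adjoints ?Q \<inter> Units ?Q"
    unfolding self_adjoints_def Units_def using yQ wQ yw1 wy1 by blast
  then show "\<exists>Y\<in>self_adjoints ?Q \<inter> Units ?Q. alg_norm ?Q (X \<ominus>\<^bsub>?Q\<^esub> Y) < \<epsilon>" using close by blast
qed

end
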